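(* Let $n$ be a positive integer, $\mathcal{A}$ an abelian von Neumann algebra, and $T$ an operator in $\mathbb{M}_n(\mathcal{A})$. Then $T$ is strongly irreducible in $\mathbb{M}_n(\mathcal{A})$ if and only if there exists a unitary operator $U$ in $\mathbb{M}_n(\mathcal{A})$ such that $U^*TU=(t_{ij})_{1\leqslant i,j\leqslant n}$ satisfies: (1) $t_{ij}=0$ for $i>j$, i.e., $U^*TU$ is upper triangular; (2) $t_{jj}=t_{nn}$ for $1\leqslant j\leqslant n-1$; (3) $R(t_{j,j+1})=I_{\mathcal{A}}$ for $1\leqslant j\leqslant n-1$. Under these conditions, the relative commutant $\{T\}'\cap\mathbb{M}_n(\mathcal{A})$ is the strong-operator closure of $\mathcal{A}[T]$, i.e. $\{T\}'\cap\mathbb{M}_n(\mathcal{A})=\overline{\mathcal{A}[T]}^{SOT}$. In particular, $A-\tau(A)$ is nilpotent for every $A\in\{T\}'\cap\mathbb{M}_n(\mathcal{A})$, where $\tau$ is the center-valued trace of $\mathbb{M}_n(\mathcal{A})$.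
   Context: An operator $T$ in a von Neumann algebra $\mathcal{M}$ is strongly irreducible in $\mathcal{M}$ if every idempotent ($P^2=P$) in $\{T\}'\cap\mathcal{M}$ (elements of $\mathcal{M}$ commuting with $T$) lies in the center $\mathcal{Z}(\mathcal{M})$. The center of $\mathbb{M}_n(\mathcal{A})=\mathbb{M}_n\otimes\mathcal{A}$ is $I_n\otimes\mathcal{A}$, and the center-valued trace is $\tau(A)=I_n\otimes\frac1n\sum_{j}a_{jj}$ for $A=(a_{ij})$. $R(a)$ is the range projection of $a\in\mathcal{A}$, i.e. the smallest projection $p\in\mathcal{A}$ with $pa=a$; $I_{\mathcal{A}}$ is the identity of $\mathcal{A}$. $\mathcal{A}[T]$ is the set of all operators $\sum_{j=0}^k (I_n\otimes a_j)T^j$ with $k\geqslant 0$ and $a_j\in\mathcal{A}$, i.e., the unital subalgebra generated by $T$ and the center $I_n\otimes\mathcal{A}$. *)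

theory Defs
  imports "HOL-Analysis.Analysis" "Jordan_Normal_Form.Matrix"
begin

section \<open>Complex Hilbert spaces and bounded operators\<close>

text \<open>The inner product is linear in the first argument. The trivial space is not excluded.\<close>

class complex_hilbert = banach +
  fixes scaleC :: "complex \<Rightarrow> 'a \<Rightarrow> 'a"  (infixr \<open>*\<^sub>C\<close> 75)
    and cinner :: "'a \<Rightarrow> 'a \<Rightarrow> complex"
  assumes scaleC_of_real: "complex_of_real r *\<^sub>C x = r *\<^sub>R x"
    and scaleC_add_right: "c *\<^sub>C (x + y) = c *\<^sub>C x + c *\<^sub>C y"
    and scaleC_add_left: "(c + d) *\<^sub>C x = c *\<^sub>C x + d *\<^sub>C x"
    and scaleC_scaleC: "c *\<^sub>C (d *\<^sub>C x) = (c * d) *\<^sub>C x"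
    and cinner_commute: "cinner x y = cnj (cinner y x)"
    and cinner_add_left: "cinner (x + y) z = cinner x z + cinner y z"
    and cinner_scaleC_left: "cinner (c *\<^sub>C x) y = c * cinner x y"
    and cinner_self: "cinner x x = complex_of_real ((norm x)\<^sup>2)"

lemma norm_scaleC: "norm (c *\<^sub>C (x :: 'a::complex_hilbert)) = cmod c * norm x"
proof -
  have "complex_of_real ((norm (c *\<^sub>C x))\<^sup>2) = c * cnj (c * cinner x x)"
    by (metis cinner_self cinner_commute cinner_scaleC_left)
  also have "\<dots> = complex_of_real ((cmod c * norm x)\<^sup>2)"
    by (simp add: cinner_self power_mult_distrib complex_norm_square mult.assoc
        flip: of_real_power)
  finally have "(norm (c *\<^sub>C x))\<^sup>2 = (cmod c * norm x)\<^sup>2"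
    by (simp only: of_real_eq_iff)
  then show ?thesis by (simp add: power2_eq_iff_nonneg)
qed

lemma bounded_linear_scaleC: "bounded_linear (\<lambda>x :: 'a::complex_hilbert. c *\<^sub>C x)"
proof (rule bounded_linear_intro[where K = "cmod c"])
  fix r :: real and x :: 'a
  have "c *\<^sub>C (r *\<^sub>R x) = complex_of_real r *\<^sub>C (c *\<^sub>C x)"
    by (metis scaleC_of_real scaleC_scaleC mult.commute)
  then show "c *\<^sub>C (r *\<^sub>R x) = r *\<^sub>R (c *\<^sub>C x)"
    by (simp add: scaleC_of_real)
qed (simp_all add: scaleC_add_right norm_scaleC)

text \<open>The type of all bounded complex-linear operators on a Hilbert space.\<close>

typedef (overloaded) 'a bop =
  "{f :: 'a::complex_hilbert \<Rightarrow> 'a. bounded_linear f \<and> (\<forall>c x. f (c *\<^sub>C x) = c *\<^sub>C f x)}"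
  morphisms bop_apply Abs_bop
  by (rule exI[of _ "\<lambda>x. x"]) (simp add: bounded_linear_ident)

setup_lifting type_definition_bop

instantiation bop :: (complex_hilbert) "{ring, monoid_mult}"
begin

lift_definition zero_bop :: "'a bop" is "\<lambda>x. 0"
  by (metis (mono_tags, lifting) bounded_linear_zero scaleC_of_real scaleC_scaleC
      mult_zero_right of_real_0 scaleR_zero_left)

lift_definition one_bop :: "'a bop" is "\<lambda>x. x"
  by (simp add: bounded_linear_ident)

lift_definition plus_bop :: "'a bop \<Rightarrow> 'a bop \<Rightarrow> 'a bop" is "\<lambda>f g x. f x + g x"
  by (auto simp: scaleC_add_right intro: bounded_linear_add)

lift_definition uminus_bop :: "'a bop \<Rightarrow> 'a bop" is "\<lambda>f x. - f x"
  by (auto intro: bounded_linear_minus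
      simp: linear_neg[OF bounded_linear.linear[OF bounded_linear_scaleC]])

lift_definition minus_bop :: "'a bop \<Rightarrow> 'a bop \<Rightarrow> 'a bop" is "\<lambda>f g x. f x - g x"
  by (auto intro: bounded_linear_sub
      simp: linear_diff[OF bounded_linear.linear[OF bounded_linear_scaleC]])

lift_definition times_bop :: "'a bop \<Rightarrow> 'a bop \<Rightarrow> 'a bop" is "\<lambda>f g x. f (g x)"
  by (auto intro: bounded_linear_compose)

instance
  by standard
    (transfer; auto simp: algebra_simps linear_add[OF bounded_linear.linear])+

end

lift_definition bop_scale :: "complex \<Rightarrow> 'a::complex_hilbert bop \<Rightarrow> 'a bop"
  is "\<lambda>c f x. c *\<^sub>C f x"
  by (auto intro: bounded_linear_compose[OF bounded_linear_scaleC]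
      simp: scaleC_scaleC mult.commute)

text \<open>The Hilbert space adjoint; it exists and is unique by the Riesz representation theorem.\<close>

definition bop_adj :: "'a::complex_hilbert bop \<Rightarrow> 'a bop" where
  "bop_adj T = (THE S. \<forall>x y. cinner (bop_apply T x) y = cinner x (bop_apply S y))"

definition bop_sot :: "'a::complex_hilbert bop topology" where
  "bop_sot = topology_generated_by
     {{S. norm (bop_apply (S - T) x) < e} | T x e. 0 < e}"

section \<open>Abelian von Neumann algebras\<close>

text \<open>Concrete von Neumann algebras: strong-operator closed unital \<open>*\<close>-subalgebras of the
  algebra of all bounded operators.\<close>

definition von_neumann_algebra :: "'a::complex_hilbert bop set \<Rightarrow> bool" where
  "von_neumann_algebra A \<longleftrightarrow>
     1 \<in> A \<and>
     (\<forall>a\<in>A. \<forall>b\<in>A. a + b \<in> A \<and> a * b \<in> A) \<and>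
     (\<forall>c. \<forall>a\<in>A. bop_scale c a \<in> A) \<and>
     (\<forall>a\<in>A. bop_adj a \<in> A) \<and>
     closedin bop_sot A"

definition abelian_von_neumann_algebra :: "'a::complex_hilbert bop set \<Rightarrow> bool" where
  "abelian_von_neumann_algebra A \<longleftrightarrow>
     von_neumann_algebra A \<and> (\<forall>a\<in>A. \<forall>b\<in>A. a * b = b * a)"

definition is_projection :: "'a::complex_hilbert bop \<Rightarrow> bool" where
  "is_projection p \<longleftrightarrow> p * p = p \<and> bop_adj p = p"

text \<open>\<open>p = R(a)\<close>: the smallest projection \<open>p\<close> in \<open>A\<close> with \<open>p a = a\<close>. For projections,
  \<open>p \<le> q\<close> means that the range of \<open>p\<close> is contained in that of \<open>q\<close>, i.e. \<open>q p = p\<close>.\<close>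

definition is_range_projection ::
    "'a::complex_hilbert bop set \<Rightarrow> 'a bop \<Rightarrow> 'a bop \<Rightarrow> bool" where
  "is_range_projection A a p \<longleftrightarrow>
     p \<in> A \<and> is_projection p \<and> p * a = a \<and>
     (\<forall>q\<in>A. is_projection q \<and> q * a = a \<longrightarrow> q * p = p)"

section \<open>Matrix algebras\<close>

text \<open>\<open>carrier_mat n n\<close> over \<open>'a bop\<close> is the algebra of all bounded operators on the \<open>n\<close>-fold
  Hilbert sum of \<open>'a\<close>; \<open>matrix_algebra n A\<close> is its subalgebra \<open>M\<^sub>n(A)\<close>.\<close>

definition matrix_algebra :: "nat \<Rightarrow> 'b set \<Rightarrow> 'b mat set" where
  "matrix_algebra n A = {M \<in> carrier_mat n n. \<forall>i<n. \<forall>j<n. M $$ (i, j) \<in> A}"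

definition mat_adj :: "'a::complex_hilbert bop mat \<Rightarrow> 'a bop mat" where
  "mat_adj M = mat (dim_col M) (dim_row M) (\<lambda>(i, j). bop_adj (M $$ (j, i)))"

definition unitary_in :: "nat \<Rightarrow> 'a::complex_hilbert bop set \<Rightarrow> 'a bop mat \<Rightarrow> bool" where
  "unitary_in n A U \<longleftrightarrow>
     U \<in> matrix_algebra n A \<and> mat_adj U * U = 1\<^sub>m n \<and> U * mat_adj U = 1\<^sub>m n"

text \<open>The library's matrix powers need \<open>0 \<noteq> 1\<close> for the entries, which fails for operators on
  the trivial space.\<close>

definition mat_power :: "nat \<Rightarrow> 'a::complex_hilbert bop mat \<Rightarrow> nat \<Rightarrow> 'a bop mat" where
  "mat_power n T k = ((\<lambda>M. M * T) ^^ k) (1\<^sub>m n)"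

text \<open>The norm of \<open>M x\<close> in the \<open>n\<close>-fold Hilbert sum, where \<open>x = (x 0, \<dots>, x (n - 1))\<close>.\<close>

definition mat_apply_norm :: "nat \<Rightarrow> 'a::complex_hilbert bop mat \<Rightarrow> (nat \<Rightarrow> 'a) \<Rightarrow> real" where
  "mat_apply_norm n M x = L2_set (\<lambda>i. norm (\<Sum>j<n. bop_apply (M $$ (i, j)) (x j))) {..<n}"

definition mat_sot :: "nat \<Rightarrow> 'a::complex_hilbert bop mat topology" where
  "mat_sot n = topology_generated_by
     {{S \<in> carrier_mat n n. mat_apply_norm n (S - T) x < e} | T x e.
        T \<in> carrier_mat n n \<and> 0 < e}"

text \<open>\<open>I\<^sub>n \<otimes> a\<close>\<close>

definition amplification :: "nat \<Rightarrow> 'a::complex_hilbert bop \<Rightarrow> 'a bop mat" where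
  "amplification n a = mat n n (\<lambda>(i, j). if i = j then a else 0)"

definition center_valued_trace :: "nat \<Rightarrow> 'a::complex_hilbert bop mat \<Rightarrow> 'a bop mat" where
  "center_valued_trace n M =
     amplification n (bop_scale (1 / of_nat n) (\<Sum>j<n. M $$ (j, j)))"

definition center :: "'b::times set \<Rightarrow> 'b set" where
  "center M = {Z \<in> M. \<forall>X\<in>M. X * Z = Z * X}"

definition relative_commutant :: "'b::times set \<Rightarrow> 'b \<Rightarrow> 'b set" where
  "relative_commutant M T = {X \<in> M. X * T = T * X}"

definition strongly_irreducible_in :: "'b::times set \<Rightarrow> 'b \<Rightarrow> bool" where
  "strongly_irreducible_in M T \<longleftrightarrow>
     T \<in> M \<and> (\<forall>P \<in> relative_commutant M T. P * P = P \<longrightarrow> P \<in> center M)"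

text \<open>\<open>A[T]\<close>, the operators \<open>\<Sum>l\<le>k. (I\<^sub>n \<otimes> a l) T^l\<close>. The sum is taken entrywise because matrices
  of all sizes share one type, which therefore has no zero.\<close>

definition generated_algebra ::
    "nat \<Rightarrow> 'a::complex_hilbert bop set \<Rightarrow> 'a bop mat \<Rightarrow> 'a bop mat set" where
  "generated_algebra n A T =
     {mat n n (\<lambda>ij. \<Sum>l\<le>k. (amplification n (a l) * mat_power n T l) $$ ij) | k a.
        \<forall>l\<le>(k::nat). a l \<in> A}"

end

theory Submission
  imports Defs "Jordan_Normal_Form.Schur_Decomposition"
begin

text \<open>An abelian von Neumann algebra \<open>A\<close> is an algebra of functions on its spectrum, and \<open>T\<close> is a
  matrix valued function there. It is strongly irreducible if the only idempotent functions that
  commute with it are the projections of \<open>A\<close>. There are two ways to find other idempotents.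

  First, suppose that the value of \<open>T\<close> at some point has two distinct eigenvalues. Then a polynomial
  in this value is an idempotent that is not scalar (\<open>complex_splitting\<close>), and Newton's iteration
  extends it to a neighbourhood of the point, that is, to a projection of \<open>A\<close>
  (\<open>idempotent_lifting\<close>). So if \<open>T\<close> is strongly irreducible, the trace \<open>\<tau>(T)\<close> is its only eigenvalue,
  and \<open>N = T - \<tau>(T)\<close> is nilpotent (\<open>strongly_irreducible_nilpotent\<close>). Second, suppose that \<open>N^(n-1)\<close>
  vanishes on a projection. Then a Jordan chain of length less than \<open>n\<close> splits off there
  (\<open>strongly_irreducible_power_regular\<close>).

  Because \<open>N\<close> is nilpotent, no eigenvalues have to be chosen in a coherent way in order to
  triangularise it. It suffices to find a vector of length one in the kernel
  (\<open>kernel_column\<close>) and to move it to the first coordinate by a reflection (\<open>householder\<close>). The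
  product of the superdiagonal is the corner entry of \<open>N^(n-1)\<close>, so each entry of the superdiagonal has
  range projection \<open>1\<close>.

  Conversely, let \<open>M\<close> be strictly upper triangular with such a superdiagonal. A matrix that commutes
  with \<open>M\<close> is upper triangular with constant diagonal, so it is a scalar plus a nilpotent, and it is
  scalar if it is idempotent (\<open>commutant_idempotent_scalar\<close>). Its product with some \<open>c \<in> A\<close> of
  range projection \<open>1\<close> is a polynomial in \<open>M\<close> (\<open>commutant_polynomial\<close>). Such a \<open>c\<close> has strong
  approximate inverses (\<open>regular_approximate_inverse\<close>), so the polynomials are strongly dense in the
  commutant.

  The analysis in \<open>A\<close> rests on strong limits of sequences: they give square roots, support
  projections and quotients, hence spectral projections. The points of the spectrum are represented
  by ultrafilters of projections.\<close>

section \<open>Bounded operators on a complex Hilbert space\<close>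

notation bop_apply (infixr \<open>\<rhd>\<close> 75)
notation bop_adj (\<open>_\<^sup>\<star>\<close> [1000] 999)

lemma cinner_add_right: "cinner x (y + z) = cinner x y + cinner x z"
  by (metis cinner_commute cinner_add_left complex_cnj_add)

lemma cinner_scaleC_right: "cinner x (c *\<^sub>C y) = cnj c * cinner x y"
  by (metis cinner_commute cinner_scaleC_left complex_cnj_mult)

lemma cinner_zero_left [simp]: "cinner 0 y = 0"
  using cinner_add_left[of 0 0 y] by simp

lemma cinner_zero_right [simp]: "cinner y 0 = 0"
  using cinner_add_right[of y 0 0] by simp

lemma cinner_minus_left: "cinner (- x) y = - cinner x y"
  using cinner_add_left[of "- x" x y] by (simp add: eq_neg_iff_add_eq_0)

lemma cinner_minus_right: "cinner x (- y) = - cinner x y"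
  using cinner_add_right[of x "- y" y] by (simp add: eq_neg_iff_add_eq_0)

lemma cinner_diff_left: "cinner (x - y) z = cinner x z - cinner y z"
  using cinner_add_left[of x "- y" z] by (simp add: cinner_minus_left)

lemma cinner_diff_right: "cinner x (y - z) = cinner x y - cinner x z"
  using cinner_add_right[of x y "- z"] by (simp add: cinner_minus_right)

lemma cinner_scaleR_left: "cinner (r *\<^sub>R x) y = complex_of_real r * cinner x y"
  by (metis cinner_scaleC_left scaleC_of_real)

lemma cinner_scaleR_right: "cinner x (r *\<^sub>R y) = complex_of_real r * cinner x y"
  by (metis cinner_scaleC_right scaleC_of_real complex_cnj_complex_of_real)

lemmas cinner_linear = cinner_add_left cinner_add_right cinner_diff_left cinner_diff_right
  cinner_minus_left cinner_minus_right cinner_scaleC_left cinner_scaleC_right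
  cinner_scaleR_left cinner_scaleR_right

lemma Re_cinner_self: "Re (cinner x x) = (norm x)\<^sup>2"
  by (simp add: cinner_self)

lemma Re_cinner_commute: "Re (cinner x y) = Re (cinner y x)"
  by (subst cinner_commute) simp

lemma scaleC_one [simp]: "1 *\<^sub>C (x :: 'a::complex_hilbert) = x"
  using scaleC_of_real[of 1 x] by simp

lemma norm_add_squared: "(norm (x + y :: 'a::complex_hilbert))\<^sup>2 = (norm x)\<^sup>2 + 2 * Re (cinner x y) + (norm y)\<^sup>2"
  by (simp flip: Re_cinner_self add: cinner_linear Re_cinner_commute)

lemma norm_diff_squared: "(norm (x - y :: 'a::complex_hilbert))\<^sup>2 = (norm x)\<^sup>2 - 2 * Re (cinner x y) + (norm y)\<^sup>2"
  by (simp flip: Re_cinner_self add: cinner_linear Re_cinner_commute)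

lemma nonneg_quadratic_imp_linear_zero:
  fixes b c :: real
  assumes "\<And>t. 0 \<le> 2 * t * b + t\<^sup>2 * c" "0 \<le> c"
  shows "b = 0"
proof (rule ccontr)
  assume "b \<noteq> 0"
  have "2 * (- b / (c + 1)) * b + (- b / (c + 1))\<^sup>2 * c = (b / (c + 1))\<^sup>2 * (- 2 * (c + 1) + c)"
    using assms(2) by (simp add: divide_simps power2_eq_square) (simp add: algebra_simps)
  also have "\<dots> < 0"
    using \<open>b \<noteq> 0\<close> assms(2) by (intro mult_pos_neg) auto
  finally show False using assms(1)[of "- b / (c + 1)"] by simp
qed

lemma cauchy_schwarz_Re: "Re (cinner x y) \<le> norm x * norm (y :: 'a::complex_hilbert)"
proof (cases "y = 0")
  case False
  have "0 \<le> (norm ((norm y) *\<^sub>R x - (norm x) *\<^sub>R y))\<^sup>2" by simp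
  also have "\<dots> = 2 * (norm x)\<^sup>2 * (norm y)\<^sup>2 - 2 * norm x * norm y * Re (cinner x y)"
    by (simp add: norm_diff_squared cinner_linear power_mult_distrib)
  finally have *: "norm x * norm y * Re (cinner x y) \<le> norm x * norm y * (norm x * norm y)"
    by (simp add: power2_eq_square algebra_simps)
  show ?thesis
  proof (cases "x = 0")
    case True then show ?thesis by simp
  next
    case 2: False
    then have "0 < norm x * norm y" using False by simp
    with * show ?thesis by (simp only: mult_le_cancel_left_pos)
  qed
qed simp

text \<open>The functional is represented by the minimiser of \<open>J x = \<parallel>x\<parallel>\<^sup>2 - 2 Re (\<phi> x)\<close>: by the
  parallelogram law a minimising sequence is Cauchy, and the first variation of \<open>J\<close> at its limit
  \<open>z\<close> says \<open>Re \<langle>y, z\<rangle> = Re (\<phi> y)\<close>.\<close>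

lemma riesz_representation:
  fixes \<phi> :: "'a::complex_hilbert \<Rightarrow> complex"
  assumes bl: "bounded_linear \<phi>" and hom: "\<And>c x. \<phi> (c *\<^sub>C x) = c * \<phi> x"
  shows "\<exists>z. \<forall>x. \<phi> x = cinner x z"
proof -
  interpret bounded_linear \<phi> by (rule bl)
  define J where "J x = (norm x)\<^sup>2 - 2 * Re (\<phi> x)" for x
  obtain K where K: "\<And>x. norm (\<phi> x) \<le> norm x * K" using nonneg_bounded by blast
  have lower: "- K\<^sup>2 \<le> J x" for x
  proof -
    have "2 * Re (\<phi> x) \<le> 2 * (norm x * K)"
      using K[of x] complex_Re_le_cmod[of "\<phi> x"] by linarith
    also have "\<dots> \<le> (norm x)\<^sup>2 + K\<^sup>2" using sum_squares_bound[of "norm x" K] by simp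
    finally show ?thesis unfolding J_def by simp
  qed
  define m where "m = Inf (range J)"
  have bdd: "bdd_below (range J)" using lower by (intro bdd_belowI[of _ "- K\<^sup>2"]) auto
  have m_le: "m \<le> J x" for x unfolding m_def by (rule cInf_lower) (use bdd in auto)
  have "\<exists>x. J x < m + 1 / real (Suc k)" for k
  proof -
    have "Inf (range J) < m + 1 / real (Suc k)" unfolding m_def by simp
    then obtain w where "w \<in> range J" "w < m + 1 / real (Suc k)"
      using cInf_lessD[of "range J"] by blast
    then show ?thesis by blast
  qed
  then obtain x where x: "\<And>k. J (x k) < m + 1 / real (Suc k)" by metis
  have par: "(norm (u - v))\<^sup>2 \<le> 2 * (J u - m) + 2 * (J v - m)" for u v
  proof -
    have "2 * J u + 2 * J v = 4 * J ((1/2) *\<^sub>R (u + v)) + (norm (u - v))\<^sup>2"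
      unfolding J_def
      by (simp add: norm_add_squared norm_diff_squared cinner_linear add scaleR power_mult_distrib
          power2_eq_square[of "1/2::real"] field_simps) 
    with m_le[of "(1/2) *\<^sub>R (u + v)"] show ?thesis by simp
  qed
  have "Cauchy x"
  proof (rule metric_CauchyI)
    fix e :: real assume e: "0 < e"
    obtain M where M: "1 / real (Suc M) < e\<^sup>2 / 4"
      using e nat_approx_posE[of "e\<^sup>2 / 4"] by auto
    have "dist (x i) (x j) < e" if "i \<ge> M" "j \<ge> M" for i j
    proof -
      have "1 / real (Suc i) \<le> 1 / real (Suc M)" "1 / real (Suc j) \<le> 1 / real (Suc M)"
        using that by (auto simp: frac_le)
      then have "J (x i) < m + e\<^sup>2 / 4" "J (x j) < m + e\<^sup>2 / 4"
        using x[of i] x[of j] M by auto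
      then have "(norm (x i - x j))\<^sup>2 < e\<^sup>2"
        using par[of "x i" "x j"] by argo
      then show ?thesis using e by (simp add: dist_norm power2_less_imp_less)
    qed
    then show "\<exists>M. \<forall>i\<ge>M. \<forall>j\<ge>M. dist (x i) (x j) < e" by blast
  qed
  then obtain z where z: "x \<longlonglongrightarrow> z"
    using Cauchy_convergent convergent_def by blast
  have "(\<lambda>k. J (x k)) \<longlonglongrightarrow> J z"
    unfolding J_def by (intro tendsto_intros tendsto z)
  moreover have "(\<lambda>k. m + 1 / real (Suc k)) \<longlonglongrightarrow> m + 0"
    by (intro tendsto_intros LIMSEQ_Suc[OF lim_1_over_n])
  ultimately have "J z \<le> m + 0"
    by (rule LIMSEQ_le) (use x in \<open>auto intro: less_imp_le\<close>)
  then have J_min: "J z \<le> J y" for y using m_le[of y] by simp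
  have Re_eq: "Re (\<phi> y) = Re (cinner y z)" for y
  proof -
    have "Re (cinner y z) - Re (\<phi> y) = 0"
    proof (rule nonneg_quadratic_imp_linear_zero[where c = "(norm y)\<^sup>2"])
      fix t :: real
      have "J (z + t *\<^sub>R y) = J z + (2 * t * (Re (cinner y z) - Re (\<phi> y)) + t\<^sup>2 * (norm y)\<^sup>2)"
        unfolding J_def by (simp add: norm_add_squared cinner_linear add scaleR
            power_mult_distrib algebra_simps Re_cinner_commute[of z y])
      with J_min[of "z + t *\<^sub>R y"]
      show "0 \<le> 2 * t * (Re (cinner y z) - Re (\<phi> y)) + t\<^sup>2 * (norm y)\<^sup>2" by simp
    qed simp
    then show ?thesis by simp
  qed
  have "\<phi> y = cinner y z" for y
    using Re_eq[of y] Re_eq[of "\<i> *\<^sub>C y"]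
    by (simp add: hom cinner_linear complex_eq_iff)
  then show ?thesis by blast
qed

lemma bounded_linear_bop: "bounded_linear (bop_apply a)"
  using bop_apply[of a] by simp

lemma bop_apply_scaleC: "a \<rhd> (c *\<^sub>C x) = c *\<^sub>C (a \<rhd> x)"
  using bop_apply[of a] by simp

lemma bop_apply_add: "a \<rhd> (x + y) = a \<rhd> x + a \<rhd> y"
  by (rule linear_add[OF bounded_linear.linear[OF bounded_linear_bop]])

lemma bop_apply_diff: "a \<rhd> (x - y) = a \<rhd> x - a \<rhd> y"
  by (rule linear_diff[OF bounded_linear.linear[OF bounded_linear_bop]])

lemma bop_apply_minus: "a \<rhd> (- x) = - (a \<rhd> x)"
  by (rule linear_neg[OF bounded_linear.linear[OF bounded_linear_bop]])

lemma bop_apply_zero [simp]: "a \<rhd> 0 = 0"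
  by (rule linear_0[OF bounded_linear.linear[OF bounded_linear_bop]])

lemma bop_apply_scaleR: "a \<rhd> (r *\<^sub>R x) = r *\<^sub>R (a \<rhd> x)"
  by (rule linear_scale[OF bounded_linear.linear[OF bounded_linear_bop]])

lemmas bop_apply_simps [simp] =
  zero_bop.rep_eq one_bop.rep_eq plus_bop.rep_eq minus_bop.rep_eq uminus_bop.rep_eq
  times_bop.rep_eq bop_scale.rep_eq

lemma bop_apply_sum [simp]: "(\<Sum>i\<in>I. f i) \<rhd> x = (\<Sum>i\<in>I. f i \<rhd> x)"
  by (induct I rule: infinite_finite_induct) auto

lemma bop_eqI: "(\<And>x. a \<rhd> x = b \<rhd> x) \<Longrightarrow> a = b"
  by (simp add: bop_apply_inject[symmetric] fun_eq_iff)

lemma cinner_eqI: "(\<And>z. cinner x z = cinner y z) \<Longrightarrow> x = (y :: 'a::complex_hilbert)"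
  using Re_cinner_self[of "x - y"] by (simp add: cinner_linear)

lemma cinner_eqI_right: "(\<And>z. cinner z x = cinner z y) \<Longrightarrow> x = (y :: 'a::complex_hilbert)"
  by (rule cinner_eqI) (metis cinner_commute)

lemma bounded_linear_cinner_left: "bounded_linear (\<lambda>x :: 'a::complex_hilbert. cinner x y)"
proof (rule bounded_linear_intro[where K = "2 * norm y"])
  fix x :: 'a
  have *: "\<bar>Re (cinner u y)\<bar> \<le> norm u * norm y" for u :: 'a
    using cauchy_schwarz_Re[of u y] cauchy_schwarz_Re[of "- u" y]
    by (auto simp: cinner_linear)
  have "Re (cinner (\<i> *\<^sub>C x) y) = - Im (cinner x y)" by (simp add: cinner_linear)
  with *[of x] *[of "\<i> *\<^sub>C x"] show "norm (cinner x y) \<le> norm x * (2 * norm y)"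
    using cmod_le[of "cinner x y"] by (simp add: norm_scaleC algebra_simps)
qed (simp_all add: cinner_linear scaleR_conv_of_real)

text \<open>The vector representing \<open>x \<mapsto> \<langle>a x, y\<rangle>\<close> depends linearly on \<open>y\<close> because it is unique, and its
  norm is at most \<open>\<parallel>a\<parallel> \<parallel>y\<parallel>\<close> by the Cauchy-Schwarz inequality.\<close>

lemma adjoint_exists:
  fixes a :: "'a::complex_hilbert bop"
  shows "\<exists>b. \<forall>x y. cinner (a \<rhd> x) y = cinner x (b \<rhd> y)"
proof -
  have "\<exists>z. \<forall>x. cinner (a \<rhd> x) y = cinner x z" for y
    by (rule riesz_representation)
      (auto intro: bounded_linear_compose[OF bounded_linear_cinner_left bounded_linear_bop]
        simp: bop_apply_scaleC cinner_linear)
  then obtain f where f: "\<And>x y. cinner (a \<rhd> x) y = cinner x (f y)" by metis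
  obtain K where K: "K \<ge> 0" "\<And>x. norm (a \<rhd> x) \<le> norm x * K"
    using bounded_linear.nonneg_bounded[OF bounded_linear_bop[of a]] by blast
  have scaleC: "f (c *\<^sub>C y) = c *\<^sub>C f y" for c y
    by (rule cinner_eqI_right) (simp add: cinner_linear flip: f)
  have "bounded_linear f"
  proof (rule bounded_linear_intro[where K = K])
    show "f (x + y) = f x + f y" for x y
      by (rule cinner_eqI_right) (simp add: cinner_linear flip: f)
    show "f (r *\<^sub>R x) = r *\<^sub>R f x" for r x
      by (simp add: scaleC flip: scaleC_of_real)
    show "norm (f y) \<le> norm y * K" for y
    proof -
      have "norm (f y) * norm (f y) = Re (cinner (a \<rhd> f y) y)"
        by (simp add: f Re_cinner_self power2_eq_square)
      also have "\<dots> \<le> norm (a \<rhd> f y) * norm y" by (rule cauchy_schwarz_Re)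
      also have "\<dots> \<le> norm (f y) * (norm y * K)"
        using mult_right_mono[OF K(2)[of "f y"] norm_ge_zero[of y]] by (simp add: mult_ac)
      finally show ?thesis
        using K(1) by (cases "norm (f y) = 0") (auto simp: mult_le_cancel_left)
    qed
  qed
  then have "bop_apply (Abs_bop f) = f" using scaleC by (simp add: Abs_bop_inverse)
  then show ?thesis using f by metis
qed

lemma cinner_adj_right: "cinner x (a\<^sup>\<star> \<rhd> y) = cinner (a \<rhd> x) y"
proof -
  obtain b where b: "\<And>x y. cinner (a \<rhd> x) y = cinner x (b \<rhd> y)" using adjoint_exists by metis
  have "\<exists>!S. \<forall>x y. cinner (a \<rhd> x) y = cinner x (S \<rhd> y)"
  proof (rule ex1I[of _ b])
    fix S assume S: "\<forall>x y. cinner (a \<rhd> x) y = cinner x (S \<rhd> y)"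
    have "cinner z (S \<rhd> y) = cinner z (b \<rhd> y)" for z y
      using S[rule_format, of z y] b[of z y] by simp
    then show "S = b" by (blast intro: bop_eqI cinner_eqI_right)
  qed (simp add: b)
  then have "\<forall>x y. cinner (a \<rhd> x) y = cinner x (a\<^sup>\<star> \<rhd> y)"
    unfolding bop_adj_def by (rule theI')
  then show ?thesis by simp
qed

lemma cinner_adj_left: "cinner (a\<^sup>\<star> \<rhd> x) y = cinner x (a \<rhd> y)"
  by (metis cinner_adj_right cinner_commute)

lemma adj_eqI: "(\<And>x y. cinner x (b \<rhd> y) = cinner (a \<rhd> x) y) \<Longrightarrow> a\<^sup>\<star> = b"
  by (intro bop_eqI cinner_eqI_right) (simp add: cinner_adj_right)

lemma adj_adj [simp]: "(a\<^sup>\<star>)\<^sup>\<star> = a"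
  by (rule adj_eqI) (simp add: cinner_adj_left)

lemma adj_mult: "(a * b)\<^sup>\<star> = b\<^sup>\<star> * a\<^sup>\<star>"
  by (rule adj_eqI) (simp add: cinner_adj_right)

lemma adj_add: "(a + b)\<^sup>\<star> = a\<^sup>\<star> + b\<^sup>\<star>"
  by (rule adj_eqI) (simp add: cinner_adj_right cinner_linear)

lemma adj_diff: "(a - b)\<^sup>\<star> = a\<^sup>\<star> - b\<^sup>\<star>"
  by (rule adj_eqI) (simp add: cinner_adj_right cinner_linear)

lemma adj_minus: "(- a)\<^sup>\<star> = - (a\<^sup>\<star>)"
  by (rule adj_eqI) (simp add: cinner_adj_right cinner_linear)

lemma adj_scale: "(bop_scale c a)\<^sup>\<star> = bop_scale (cnj c) (a\<^sup>\<star>)"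
  by (rule adj_eqI) (simp add: cinner_adj_right cinner_linear)

lemma adj_zero [simp]: "0\<^sup>\<star> = 0"
  by (rule adj_eqI) simp

lemma adj_one [simp]: "1\<^sup>\<star> = 1"
  by (rule adj_eqI) simp

lemma adj_sum: "(\<Sum>i\<in>I. f i)\<^sup>\<star> = (\<Sum>i\<in>I. (f i)\<^sup>\<star>)"
  by (induct I rule: infinite_finite_induct) (auto simp: adj_add)

lemma adj_power: "(a ^ k)\<^sup>\<star> = (a\<^sup>\<star>) ^ k"
  by (induct k) (auto simp: adj_mult power_commutes)

lemmas adj_simps = adj_mult adj_add adj_diff adj_minus adj_scale adj_sum adj_power

lemma norm_apply_squared: "(norm (a \<rhd> x))\<^sup>2 = Re (cinner ((a\<^sup>\<star> * a) \<rhd> x) x)"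
  by (simp add: cinner_adj_left Re_cinner_self)

lemma adj_mult_self_eq_0: "a\<^sup>\<star> * a = 0 \<Longrightarrow> a = 0"
  by (rule bop_eqI) (use norm_apply_squared[of a] in simp)

subsection \<open>Scalars and the operator norm\<close>

lemma scale_mult_left: "bop_scale c a * b = bop_scale c (a * b)"
  by (rule bop_eqI) simp

lemma scale_mult_right: "a * bop_scale c b = bop_scale c (a * b)"
  by (rule bop_eqI) (simp add: bop_apply_scaleC)

lemma scale_scale [simp]: "bop_scale c (bop_scale d a) = bop_scale (c * d) a"
  by (rule bop_eqI) (simp add: scaleC_scaleC)

lemma scale_one [simp]: "bop_scale 1 a = a"
  by (rule bop_eqI) simp

lemma scaleC_zero_left [simp]: "0 *\<^sub>C (x :: 'a::complex_hilbert) = 0"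
  using scaleC_of_real[of 0 x] by simp

lemma scaleC_zero_right [simp]: "c *\<^sub>C (0 :: 'a::complex_hilbert) = 0"
  using scaleC_add_right[of c 0 "0::'a"] by simp

lemma scale_zero [simp]: "bop_scale 0 a = 0" "bop_scale c 0 = 0"
  by (rule bop_eqI; simp)+

lemma scaleC_minus_left: "(- c) *\<^sub>C (x :: 'a::complex_hilbert) = - (c *\<^sub>C x)"
  using scaleC_add_left[of "- c" c x] by (simp add: eq_neg_iff_add_eq_0)

lemma scaleC_minus_right: "c *\<^sub>C (- (x :: 'a::complex_hilbert)) = - (c *\<^sub>C x)"
  using scaleC_add_right[of c "- x" x] by (simp add: eq_neg_iff_add_eq_0)

lemma scale_add_right: "bop_scale c (a + b) = bop_scale c a + bop_scale c b"
  by (rule bop_eqI) (simp add: scaleC_add_right)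

lemma scale_add_left: "bop_scale (c + d) a = bop_scale c a + bop_scale d a"
  by (rule bop_eqI) (simp add: scaleC_add_left)

lemma scale_minus_right: "bop_scale c (- a) = - bop_scale c a"
  by (rule bop_eqI) (simp add: scaleC_minus_right)

lemma scale_minus_left: "bop_scale (- c) a = - bop_scale c a"
  by (rule bop_eqI) (simp add: scaleC_minus_left)

lemma scale_diff_right: "bop_scale c (a - b) = bop_scale c a - bop_scale c b"
  using scale_add_right[of c a "- b"] by (simp add: scale_minus_right)

lemma scale_diff_left: "bop_scale (c - d) a = bop_scale c a - bop_scale d a"
  using scale_add_left[of c "- d" a] by (simp add: scale_minus_left)

lemmas scale_simps = scale_mult_left scale_mult_right scale_add_right scale_add_left
  scale_minus_right scale_minus_left scale_diff_right scale_diff_left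

definition bop_norm :: "'a::complex_hilbert bop \<Rightarrow> real" where
  "bop_norm a = onorm (bop_apply a)"

lemma bop_norm_nonneg [simp]: "0 \<le> bop_norm a"
  unfolding bop_norm_def by (rule onorm_pos_le[OF bounded_linear_bop])

lemma bop_norm: "norm (a \<rhd> x) \<le> bop_norm a * norm x"
  unfolding bop_norm_def by (rule onorm[OF bounded_linear_bop])

lemma bop_norm_le: "0 \<le> K \<Longrightarrow> (\<And>x. norm (a \<rhd> x) \<le> K * norm x) \<Longrightarrow> bop_norm a \<le> K"
  unfolding bop_norm_def by (rule onorm_bound)

lemma bop_norm_add: "bop_norm (a + b) \<le> bop_norm a + bop_norm b"
  unfolding bop_norm_def plus_bop.rep_eq
  by (rule onorm_triangle[OF bounded_linear_bop bounded_linear_bop])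

lemma bop_norm_minus [simp]: "bop_norm (- a) = bop_norm a"
  unfolding bop_norm_def uminus_bop.rep_eq by (rule onorm_neg)

lemma bop_norm_mult: "bop_norm (a * b) \<le> bop_norm a * bop_norm b"
proof (rule bop_norm_le)
  fix x
  have "norm (a \<rhd> b \<rhd> x) \<le> bop_norm a * norm (b \<rhd> x)" by (rule bop_norm)
  also have "\<dots> \<le> bop_norm a * (bop_norm b * norm x)"
    by (intro mult_left_mono bop_norm) simp
  finally show "norm ((a * b) \<rhd> x) \<le> bop_norm a * bop_norm b * norm x" by (simp add: mult_ac)
qed simp

lemma bop_norm_zero [simp]: "bop_norm 0 = 0"
  by (rule antisym[OF bop_norm_le]) auto

lemma bop_norm_sum: "bop_norm (\<Sum>i\<in>I. f i) \<le> (\<Sum>i\<in>I. bop_norm (f i))"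
proof (induct I rule: infinite_finite_induct)
  case (insert x F)
  then show ?case using bop_norm_add[of "f x" "sum f F"] by simp
qed auto

lemma bop_norm_eq_0: "bop_norm a = 0 \<Longrightarrow> a = 0"
  by (rule bop_eqI) (use bop_norm[of a] in simp)

lemma tendsto_bop_apply: "X \<longlonglongrightarrow> x \<Longrightarrow> (\<lambda>k. a \<rhd> X k) \<longlonglongrightarrow> a \<rhd> x"
  by (rule bounded_linear.tendsto[OF bounded_linear_bop])

lemma tendsto_cinner:
  fixes X Y :: "nat \<Rightarrow> 'a::complex_hilbert"
  assumes "X \<longlonglongrightarrow> x" shows "(\<lambda>k. cinner (X k) y) \<longlonglongrightarrow> cinner x y"
  by (rule bounded_linear.tendsto[OF bounded_linear_cinner_left assms])

section \<open>Abelian von Neumann algebras\<close>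

subsection \<open>Strong limits\<close>

lemma limitin_topology_generated_by:
  assumes "l \<in> \<Union>\<B>"
    and "\<And>B. B \<in> \<B> \<Longrightarrow> l \<in> B \<Longrightarrow> eventually (\<lambda>k. f k \<in> B) F"
  shows "limitin (topology_generated_by \<B>) f l F"
  unfolding limitin_def
proof (intro conjI allI impI)
  show "l \<in> topspace (topology_generated_by \<B>)"
    using assms(1) by (simp add: topology_generated_by_topspace)
  fix V assume "openin (topology_generated_by \<B>) V \<and> l \<in> V"
  then have "generate_topology_on \<B> V" "l \<in> V"
    by (auto simp: openin_topology_generated_by_iff)
  then show "eventually (\<lambda>k. f k \<in> V) F"
  proof induct
    case (Int a b)
    then show ?case by (auto intro: eventually_conj)
  next
    case (UN K)
    then obtain X where X: "X \<in> K" "l \<in> X" by blast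
    from UN(2)[OF this] show ?case by (rule eventually_mono) (use X in blast)
  qed (use assms(2) in auto)
qed

lemma limitin_bop_sot:
  assumes "\<And>x. (\<lambda>k. a k \<rhd> x) \<longlonglongrightarrow> b \<rhd> x"
  shows "limitin bop_sot a b sequentially"
  unfolding bop_sot_def
proof (rule limitin_topology_generated_by)
  show "b \<in> \<Union> {{S. norm ((S - T) \<rhd> x) < e} |T x e. 0 < e}"
    by (rule UnionI[of "{S. norm ((S - b) \<rhd> 0) < 1}"], rule CollectI,
        rule exI[of _ b], rule exI[of _ 0], rule exI[of _ 1]) simp_all
next
  fix B assume "B \<in> {{S. norm ((S - T) \<rhd> x) < e} |T x e. 0 < (e::real)}" "b \<in> B"
  then obtain T x e where B: "B = {S. norm ((S - T) \<rhd> x) < e}" "norm (b \<rhd> x - T \<rhd> x) < e"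
    by auto
  have "(\<lambda>k. norm (a k \<rhd> x - T \<rhd> x)) \<longlonglongrightarrow> norm (b \<rhd> x - T \<rhd> x)"
    by (intro tendsto_intros assms)
  then show "\<forall>\<^sub>F k in sequentially. a k \<in> B"
    using order_tendstoD(2)[OF _ B(2)] by (simp add: B)
qed

locale abelian_vna =
  fixes A :: "'a::complex_hilbert bop set"
  assumes abelian_vna: "abelian_von_neumann_algebra A"
begin

lemma vna: "von_neumann_algebra A"
  using abelian_vna unfolding abelian_von_neumann_algebra_def by simp

lemma comm: "a \<in> A \<Longrightarrow> b \<in> A \<Longrightarrow> a * b = b * a"
  using abelian_vna unfolding abelian_von_neumann_algebra_def by simp

lemma one_in [simp]: "1 \<in> A"
  and add_in [simp]: "a \<in> A \<Longrightarrow> b \<in> A \<Longrightarrow> a + b \<in> A"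
  and mult_in [simp]: "a \<in> A \<Longrightarrow> b \<in> A \<Longrightarrow> a * b \<in> A"
  and scale_in [simp]: "a \<in> A \<Longrightarrow> bop_scale c a \<in> A"
  and adj_in [simp]: "a \<in> A \<Longrightarrow> a\<^sup>\<star> \<in> A"
  and closed: "closedin bop_sot A"
  using vna unfolding von_neumann_algebra_def by blast+

lemma zero_in [simp]: "0 \<in> A"
  using scale_in[OF one_in, of 0] by simp

lemma minus_in [simp]: "a \<in> A \<Longrightarrow> - a \<in> A"
  using scale_in[of a "-1"] by (simp add: scale_minus_left)

lemma diff_in [simp]: "a \<in> A \<Longrightarrow> b \<in> A \<Longrightarrow> a - b \<in> A"
  using add_in[of a "- b"] by simp

lemma sum_in [simp]: "(\<And>i. i \<in> I \<Longrightarrow> f i \<in> A) \<Longrightarrow> (\<Sum>i\<in>I. f i) \<in> A"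
  by (induct I rule: infinite_finite_induct) auto

lemma power_in [simp]: "a \<in> A \<Longrightarrow> a ^ k \<in> A"
  by (induct k) auto

lemma left_comm: "a \<in> A \<Longrightarrow> b \<in> A \<Longrightarrow> a * (b * c) = b * (a * c)"
  using comm[of a b] by (simp add: mult.assoc[symmetric])

text \<open>All elements of \<open>A\<close> that are constructed below arise as limits of this kind.\<close>

lemma strong_limit:
  assumes "\<And>k. a k \<in> A" and bound: "\<And>k x. norm (a k \<rhd> x) \<le> K * norm x"
    and conv: "\<And>x. Cauchy (\<lambda>k. a k \<rhd> x)"
  shows "\<exists>b\<in>A. \<forall>x. (\<lambda>k. a k \<rhd> x) \<longlonglongrightarrow> b \<rhd> x"
proof -
  have "\<exists>l. (\<lambda>k. a k \<rhd> x) \<longlonglongrightarrow> l" for x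
    using conv Cauchy_convergent convergent_def by blast
  then obtain f where f: "\<And>x. (\<lambda>k. a k \<rhd> x) \<longlonglongrightarrow> f x" by metis
  have "bounded_linear f"
  proof (rule bounded_linear_intro[where K = K])
    show "f (x + y) = f x + f y" for x y
      by (rule LIMSEQ_unique[OF f]) (use tendsto_add[OF f f] in \<open>simp add: bop_apply_add\<close>)
    show "f (r *\<^sub>R x) = r *\<^sub>R f x" for r x
      by (rule LIMSEQ_unique[OF f]) (use tendsto_scaleR[OF tendsto_const f] in \<open>simp add: bop_apply_scaleR\<close>)
    show "norm (f x) \<le> norm x * K" for x
      by (rule LIMSEQ_le_const2[OF tendsto_norm[OF f]]) (use bound in \<open>auto simp: mult.commute\<close>)
  qed
  moreover have "f (c *\<^sub>C x) = c *\<^sub>C f x" for c x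
    by (rule LIMSEQ_unique[OF f])
      (use bounded_linear.tendsto[OF bounded_linear_scaleC f] in \<open>simp add: bop_apply_scaleC\<close>)
  ultimately have "bop_apply (Abs_bop f) = f" by (simp add: Abs_bop_inverse)
  then have lim: "(\<lambda>k. a k \<rhd> x) \<longlonglongrightarrow> Abs_bop f \<rhd> x" for x using f by simp
  have "Abs_bop f \<in> A"
    by (rule limitin_closedin[OF limitin_bop_sot[OF lim] closed]) (simp_all add: assms(1))
  with lim show ?thesis by blast
qed

end

subsection \<open>Positivity\<close>

definition pos :: "'a::complex_hilbert bop \<Rightarrow> bool" where
  "pos a \<longleftrightarrow> a\<^sup>\<star> = a \<and> (\<forall>x. 0 \<le> Re (cinner (a \<rhd> x) x))"

lemma pos_adj: "pos a \<Longrightarrow> a\<^sup>\<star> = a"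
  by (simp add: pos_def)

lemma posD: "pos a \<Longrightarrow> 0 \<le> Re (cinner (a \<rhd> x) x)"
  by (simp add: pos_def)

lemma pos_zero [simp]: "pos 0" and pos_one [simp]: "pos 1"
  by (simp_all add: pos_def Re_cinner_self)

lemma pos_add: "pos a \<Longrightarrow> pos b \<Longrightarrow> pos (a + b)"
  by (simp add: pos_def adj_simps cinner_linear)

lemma pos_scale: "pos a \<Longrightarrow> 0 \<le> r \<Longrightarrow> pos (bop_scale (complex_of_real r) a)"
  by (simp add: pos_def adj_simps cinner_linear)

lemma pos_adj_mult_self: "pos (a\<^sup>\<star> * a)"
  by (simp add: pos_def adj_simps cinner_adj_left Re_cinner_self)

lemma pos_conj: "pos a \<Longrightarrow> pos (b\<^sup>\<star> * a * b)"
  by (simp add: pos_def adj_simps cinner_adj_left mult.assoc)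

lemma pos_sandwich:
  assumes "pos a" "b\<^sup>\<star> = b" shows "pos (b * a * b)"
  using pos_conj[OF assms(1), of b] assms(2) by simp

lemma pos_power:
  assumes "pos a" shows "pos (a ^ k)"
proof -
  have adj: "(a ^ j)\<^sup>\<star> = a ^ j" for j using assms by (simp add: adj_power pos_adj)
  obtain j where "k = j + j \<or> k = j + 1 + j"
    by (metis evenE oddE mult_2 add.assoc add.commute)
  then show ?thesis
  proof
    assume "k = j + j"
    then show ?thesis using pos_sandwich[OF pos_one adj, of j] by (simp add: power_add)
  next
    assume "k = j + 1 + j"
    then show ?thesis using pos_sandwich[OF assms adj, of j] by (simp add: power_add mult.assoc power_commutes)
  qed
qed

text \<open>The identity \<open>h - h\<^sup>2 = h (1 - h) h + (1 - h) h (1 - h)\<close> writes the difference as a sum of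
  positive operators.\<close>

lemma pos_diff_square:
  assumes "pos h" "pos (1 - h)" shows "pos (h - h * h)"
proof -
  have "h - h * h = h * (1 - h) * h + (1 - h) * h * (1 - h)"
    by (simp add: algebra_simps)
  then show ?thesis
    using pos_add[OF pos_sandwich[OF assms(2) pos_adj[OF assms(1)]]
        pos_sandwich[OF assms(1) pos_adj[OF assms(2)]]] by simp
qed

lemma pos_contraction_norm_squared:
  assumes "pos h" "pos (1 - h)" shows "(norm (h \<rhd> x))\<^sup>2 \<le> Re (cinner (h \<rhd> x) x)"
  using posD[OF pos_diff_square[OF assms], of x]
  by (simp add: norm_apply_squared pos_adj[OF assms(1)] cinner_linear)

lemma pos_contraction_norm:
  assumes "pos h" "pos (1 - h)" shows "norm (h \<rhd> x) \<le> norm x"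
proof (rule power2_le_imp_le)
  have "Re (cinner (h \<rhd> x) x) \<le> (norm x)\<^sup>2"
    using posD[OF assms(2), of x] by (simp add: cinner_linear Re_cinner_self)
  with pos_contraction_norm_squared[OF assms, of x]
  show "(norm (h \<rhd> x))\<^sup>2 \<le> (norm x)\<^sup>2" by (rule order_trans)
qed simp

lemma selfadj_le_norm:
  assumes "a\<^sup>\<star> = a" "bop_norm a \<le> K"
  shows "pos (bop_scale (complex_of_real K) 1 - a)"
  unfolding pos_def
proof (intro conjI allI)
  fix x
  have "Re (cinner (a \<rhd> x) x) \<le> norm (a \<rhd> x) * norm x" by (rule cauchy_schwarz_Re)
  also have "\<dots> \<le> (K * norm x) * norm x"
    using bop_norm[of a x] assms(2)
    by (intro mult_right_mono order_trans[OF bop_norm]) (auto intro: mult_right_mono)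
  finally show "0 \<le> Re (cinner ((bop_scale (complex_of_real K) 1 - a) \<rhd> x) x)"
    by (simp add: cinner_linear Re_cinner_self power2_eq_square)
qed (simp add: adj_simps assms)

lemma pos_normalize:
  assumes "pos h"
  obtains r where "0 < r" "pos (bop_scale (complex_of_real r) h)" "pos (1 - bop_scale (complex_of_real r) h)"
proof -
  define K where "K = bop_norm h + 1"
  have K: "K > 0" unfolding K_def by (simp add: add_nonneg_pos)
  have "pos (bop_scale (complex_of_real (1 / K)) (bop_scale (complex_of_real K) 1 - h))"
    using K by (intro pos_scale selfadj_le_norm) (auto simp: K_def pos_adj assms)
  moreover have "bop_scale (complex_of_real (1 / K)) (bop_scale (complex_of_real K) 1 - h)
      = 1 - bop_scale (complex_of_real (1 / K)) h"
    using K by (simp add: scale_simps flip: of_real_mult)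
  ultimately have "pos (1 - bop_scale (complex_of_real (1 / K)) h)" by simp
  then show ?thesis
    using K assms by (intro that[of "1 / K"] pos_scale) auto
qed

context abelian_vna
begin

text \<open>For \<open>i \<le> j\<close> the difference \<open>D = a j - a i\<close> satisfies \<open>D\<^sup>2 \<le> D\<close>, so \<open>\<parallel>D x\<parallel>\<^sup>2\<close> is bounded by the increment of the bounded
  increasing scalar sequence \<open>\<langle>a k x, x\<rangle>\<close>.\<close>

lemma monotone_limit:
  assumes in_A: "\<And>k. a k \<in> A" and pos: "\<And>k. pos (a k)" and le_one: "\<And>k. pos (1 - a k)"
    and step: "\<And>k. pos (a (Suc k) - a k)"
  shows "\<exists>b\<in>A. pos b \<and> pos (1 - b) \<and> (\<forall>x. (\<lambda>k. a k \<rhd> x) \<longlonglongrightarrow> b \<rhd> x)"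
proof -
  have mono: "pos (a j - a i)" if "i \<le> j" for i j
    using that
  proof (induct rule: dec_induct)
    case (step n)
    then show ?case using pos_add[OF assms(4)[of n] step(3)] by simp
  qed simp
  have diff: "(norm (a j \<rhd> x - a i \<rhd> x))\<^sup>2 \<le> Re (cinner (a j \<rhd> x) x) - Re (cinner (a i \<rhd> x) x)"
    if "i \<le> j" for i j x
  proof -
    have "pos (1 - (a j - a i))"
      using pos_add[OF le_one[of j] pos[of i]] by (simp add: algebra_simps)
    from pos_contraction_norm_squared[OF mono[OF that] this, of x]
    show ?thesis by (simp add: cinner_linear)
  qed
  have Cauchy: "Cauchy (\<lambda>k. a k \<rhd> x)" for x
  proof -
    define s where "s k = Re (cinner (a k \<rhd> x) x)" for k
    have "Bseq s"
    proof (rule BseqI')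
      fix k
      have "0 \<le> s k" "s k \<le> (norm x)\<^sup>2"
        using posD[OF pos[of k], of x] posD[OF le_one[of k], of x]
        by (simp_all add: s_def cinner_linear Re_cinner_self)
      then show "norm (s k) \<le> (norm x)\<^sup>2" by simp
    qed
    moreover have "incseq s"
      unfolding s_def
      by (rule incseq_SucI) (use posD[OF step, of _ x] in \<open>simp add: cinner_linear\<close>)
    ultimately have "Cauchy s" by (simp add: Bseq_mono_convergent convergent_Cauchy incseq_imp_monoseq Bseq_monoseq_convergent)
    show ?thesis
    proof (rule metric_CauchyI)
      fix e :: real assume e: "0 < e"
      obtain M where M: "\<And>i j. i \<ge> M \<Longrightarrow> j \<ge> M \<Longrightarrow> dist (s i) (s j) < e\<^sup>2"
        using metric_CauchyD[OF \<open>Cauchy s\<close>, of "e\<^sup>2"] e by auto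
      have le: "dist (a j \<rhd> x) (a i \<rhd> x) < e" if "M \<le> i" "i \<le> j" for i j
      proof -
        have "(norm (a j \<rhd> x - a i \<rhd> x))\<^sup>2 \<le> s j - s i" using diff[OF that(2)] by (simp add: s_def)
        also have "\<dots> < e\<^sup>2" using M[of j i] that by (simp add: dist_real_def)
        finally show ?thesis using e by (simp add: dist_norm power2_less_imp_less)
      qed
      have "dist (a i \<rhd> x) (a j \<rhd> x) < e" if "i \<ge> M" "j \<ge> M" for i j
        using le[of i j] le[of j i] that by (cases "i \<le> j") (auto simp: dist_commute)
      then show "\<exists>M. \<forall>i\<ge>M. \<forall>j\<ge>M. dist (a i \<rhd> x) (a j \<rhd> x) < e" by blast
    qed
  qed
  have "norm (a k \<rhd> x) \<le> 1 * norm x" for k x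
    using pos_contraction_norm[OF pos le_one] by simp
  from strong_limit[OF in_A this Cauchy]
  obtain b where b: "b \<in> A" "\<And>x. (\<lambda>k. a k \<rhd> x) \<longlonglongrightarrow> b \<rhd> x" by blast
  have inner: "(\<lambda>k. cinner (a k \<rhd> x) y) \<longlonglongrightarrow> cinner (b \<rhd> x) y" for x y
    by (rule tendsto_cinner[OF b(2)])
  have "cinner (b \<rhd> x) y = cinner x (b \<rhd> y)" for x y
  proof (rule LIMSEQ_unique[OF inner])
    have "(\<lambda>k. cnj (cinner (a k \<rhd> y) x)) \<longlonglongrightarrow> cnj (cinner (b \<rhd> y) x)"
      by (intro tendsto_intros inner)
    moreover have "cnj (cinner (a k \<rhd> y) x) = cinner (a k \<rhd> x) y" for k
      by (metis cinner_commute cinner_adj_left pos pos_adj)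
    ultimately show "(\<lambda>k. cinner (a k \<rhd> x) y) \<longlonglongrightarrow> cinner x (b \<rhd> y)"
      by (simp flip: cinner_commute)
  qed
  then have "b\<^sup>\<star> = b" by (intro adj_eqI) simp
  moreover have "0 \<le> Re (cinner (b \<rhd> x) x)" for x
    by (rule LIMSEQ_le_const[OF tendsto_Re[OF inner]]) (use posD[OF pos] in auto)
  moreover have "0 \<le> Re (cinner ((1 - b) \<rhd> x) x)" for x
  proof (rule LIMSEQ_le_const)
    show "(\<lambda>k. Re (cinner ((1 - a k) \<rhd> x) x)) \<longlonglongrightarrow> Re (cinner ((1 - b) \<rhd> x) x)"
      using tendsto_diff[OF tendsto_const tendsto_Re[OF inner]] by (simp add: cinner_linear)
  qed (use posD[OF le_one] in auto)
  ultimately show ?thesis using b by (auto simp: pos_def adj_simps)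
qed

end

lemma strong_mult_tendsto:
  assumes "\<And>k x. norm (a k \<rhd> x) \<le> K * norm x"
    and "\<And>x. (\<lambda>k. a k \<rhd> x) \<longlonglongrightarrow> a' \<rhd> x" and "\<And>x. (\<lambda>k. b k \<rhd> x) \<longlonglongrightarrow> b' \<rhd> x"
  shows "(\<lambda>k. (a k * b k) \<rhd> x) \<longlonglongrightarrow> (a' * b') \<rhd> x"
proof -
  have "(\<lambda>k. K * norm (b k \<rhd> x - b' \<rhd> x)) \<longlonglongrightarrow> K * norm (b' \<rhd> x - b' \<rhd> x)"
    by (intro tendsto_intros assms)
  then have "(\<lambda>k. K * norm (b k \<rhd> x - b' \<rhd> x)) \<longlonglongrightarrow> 0" by simp
  then have "(\<lambda>k. a k \<rhd> (b k \<rhd> x - b' \<rhd> x)) \<longlonglongrightarrow> 0"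
    by (rule Lim_null_comparison[rotated]) (simp add: assms(1))
  from tendsto_add[OF this assms(2)[of "b' \<rhd> x"]] show ?thesis by (simp add: bop_apply_diff)
qed

subsection \<open>Square roots\<close>

text \<open>Polynomials in \<open>x\<close> with nonnegative coefficients. For positive \<open>x\<close> they are positive, and
  they are closed under products; this replaces the fact that commuting positive operators have
  positive products, whose usual proof needs square roots.\<close>

inductive_set power_cone :: "'a::complex_hilbert bop \<Rightarrow> 'a bop set" for x where
  power: "x ^ k \<in> power_cone x"
| add: "p \<in> power_cone x \<Longrightarrow> q \<in> power_cone x \<Longrightarrow> p + q \<in> power_cone x"
| scale: "p \<in> power_cone x \<Longrightarrow> 0 \<le> r \<Longrightarrow> bop_scale (complex_of_real r) p \<in> power_cone x"

lemma power_cone_mult: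
  assumes "p \<in> power_cone x" "q \<in> power_cone x" shows "p * q \<in> power_cone x"
  using assms
proof (induct arbitrary: q)
  case (power k)
  then show ?case
    by induct (auto simp: distrib_left scale_simps power_add[symmetric] intro: power_cone.intros)
qed (auto simp: distrib_right scale_simps intro: power_cone.intros)

lemma power_cone_pos:
  assumes "p \<in> power_cone x" "pos x" shows "pos p"
  using assms(1) by induct (auto intro: pos_power pos_add pos_scale assms(2))

lemma (in abelian_vna) power_cone_in:
  assumes "p \<in> power_cone x" "x \<in> A" shows "p \<in> A"
  using assms(1) by induct (auto simp: assms(2))

context abelian_vna
begin

text \<open>For \<open>0 \<le> h \<le> 1\<close> the increasing sequence \<open>y' = (x + y\<^sup>2) / 2\<close> with \<open>x = 1 - h\<close> converges to
  a solution of \<open>2 y = x + y\<^sup>2\<close>, that is of \<open>(1 - y)\<^sup>2 = h\<close>.\<close>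

lemma contraction_sqrt:
  assumes h: "h \<in> A" "pos h" "pos (1 - h)"
  shows "\<exists>s\<in>A. pos s \<and> s * s = h"
proof -
  define x where "x = 1 - h"
  define y where "y = rec_nat 0 (\<lambda>_ w. bop_scale (1 / 2) (x + w * w))"
  have y_0: "y 0 = 0" and y_Suc: "\<And>k. y (Suc k) = bop_scale (1 / 2) (x + y k * y k)"
    by (simp_all add: y_def)
  have half: "bop_scale (1 / 2) p \<in> power_cone x" if "p \<in> power_cone x" for p
    using power_cone.scale[OF that, of "1 / 2"] by simp
  have x_cone: "x \<in> power_cone x" using power_cone.power[of x 1] by simp
  have cone: "y k \<in> power_cone x" for k
  proof (induct k)
    case 0
    then show ?case using power_cone.scale[OF x_cone, of 0] by (simp add: y_0)
  next
    case (Suc k)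
    then show ?case unfolding y_Suc by (intro half power_cone.add x_cone power_cone_mult)
  qed
  have y_in: "y k \<in> A" for k
    by (rule power_cone_in[OF cone]) (simp add: x_def h)
  have y_pos: "pos (y k)" for k
    by (rule power_cone_pos[OF cone]) (simp add: x_def h)
  have "y (Suc k) - y k \<in> power_cone x" for k
  proof (induct k)
    case 0
    then show ?case using half[OF x_cone] by (simp add: y_0 y_Suc)
  next
    case (Suc k)
    have "y (Suc (Suc k)) - y (Suc k)
        = bop_scale (1 / 2) (y (Suc k) * y (Suc k) - y k * y k)"
      by (simp only: y_Suc[of "Suc k"] y_Suc[of k] scale_diff_right[symmetric]) (simp add: y_Suc)
    also have "y (Suc k) * y (Suc k) - y k * y k = (y (Suc k) - y k) * (y (Suc k) + y k)"
      using comm[OF y_in[of "Suc k"] y_in[of k]] by (simp add: algebra_simps)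
    finally show ?case using Suc cone by (auto intro!: half power_cone_mult power_cone.add)
  qed
  then have step: "pos (y (Suc k) - y k)" for k
    by (rule power_cone_pos) (simp add: x_def h)
  have le_one: "pos (1 - y k)" for k
  proof (induct k)
    case (Suc k)
    have "1 - y (Suc k) = bop_scale (complex_of_real (1 / 2)) (h + ((1 - y k) + (y k - y k * y k)))"
    proof -
      have "1 = bop_scale (1 / 2) (1 + 1)" by (simp add: scale_add_right flip: scale_add_left)
      then have "1 - y (Suc k) = bop_scale (1 / 2) ((1 + 1) - (x + y k * y k))"
        unfolding y_Suc scale_diff_right by (rule arg_cong)
      then show ?thesis by (simp add: x_def algebra_simps)
    qed
    then show ?case
      using pos_scale[OF pos_add[OF h(2) pos_add[OF Suc pos_diff_square[OF y_pos Suc]]], of "1/2"]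
      by simp
  qed (simp add: y_0)
  obtain l where l: "l \<in> A" "pos (1 - l)" "\<And>u. (\<lambda>k. y k \<rhd> u) \<longlonglongrightarrow> l \<rhd> u"
    using monotone_limit[of y, OF y_in y_pos le_one step] by blast
  have "l + l = x + l * l"
  proof (rule bop_eqI)
    fix u
    have "norm (y k \<rhd> v) \<le> 1 * norm v" for k v
      using pos_contraction_norm[OF y_pos le_one] by simp
    from strong_mult_tendsto[OF this l(3) l(3)]
    have lim: "(\<lambda>k. x \<rhd> u + (y k * y k) \<rhd> u) \<longlonglongrightarrow> x \<rhd> u + (l * l) \<rhd> u"
      by (intro tendsto_intros)
    have "x \<rhd> u + (y k * y k) \<rhd> u = y (Suc k) \<rhd> u + y (Suc k) \<rhd> u" for k
    proof -
      have "y (Suc k) + y (Suc k) = x + y k * y k"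
        by (simp add: y_Suc flip: scale_add_left)
      from arg_cong[OF this, of "\<lambda>b. b \<rhd> u"] show ?thesis by simp
    qed
    moreover have "(\<lambda>k. y (Suc k) \<rhd> u + y (Suc k) \<rhd> u) \<longlonglongrightarrow> l \<rhd> u + l \<rhd> u"
      by (intro tendsto_add LIMSEQ_Suc l(3))
    ultimately have "(\<lambda>k. x \<rhd> u + (y k * y k) \<rhd> u) \<longlonglongrightarrow> l \<rhd> u + l \<rhd> u"
      by (simp only:)
    from LIMSEQ_unique[OF this lim] show "(l + l) \<rhd> u = (x + l * l) \<rhd> u" by simp
  qed
  then have "(1 - l) * (1 - l) = h" by (simp add: x_def algebra_simps)
  with l show ?thesis by (intro bexI[of _ "1 - l"]) auto
qed

lemma positive_sqrt:
  assumes "h \<in> A" "pos h" shows "\<exists>s\<in>A. pos s \<and> s * s = h"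
proof -
  obtain r where r: "0 < r" "pos (bop_scale (complex_of_real r) h)"
    "pos (1 - bop_scale (complex_of_real r) h)" using pos_normalize[OF assms(2)] .
  obtain s where s: "s \<in> A" "pos s" "s * s = bop_scale (complex_of_real r) h"
    using contraction_sqrt[OF _ r(2,3)] assms(1) by auto
  define t where "t = bop_scale (complex_of_real (1 / sqrt r)) s"
  have "complex_of_real (1 / sqrt r) * complex_of_real (1 / sqrt r) * complex_of_real r
      = complex_of_real (1 / sqrt r * (1 / sqrt r) * r)" by (simp only: of_real_mult)
  also have "\<dots> = 1" using r(1) by simp
  finally have "t * t = h" by (simp add: t_def scale_simps s(3) mult.assoc)
  moreover have "t \<in> A" "pos t"
    using s r(1) pos_scale[of s "1 / sqrt r"] unfolding t_def by simp_all
  ultimately show ?thesis by blast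
qed

lemma pos_mult:
  assumes "a \<in> A" "b \<in> A" "pos a" "pos b" shows "pos (a * b)"
proof -
  obtain s where s: "s \<in> A" "pos s" "s * s = a" using positive_sqrt[OF assms(1,3)] by blast
  have "a * b = s * b * s" 
    using comm[OF s(1) assms(2)] left_comm[OF s(1) assms(2), of s]
    by (simp add: s(3)[symmetric] mult.assoc)
  then show ?thesis using pos_sandwich[OF assms(4) pos_adj[OF s(2)]] by simp
qed

subsection \<open>Support projections and division\<close>

text \<open>With \<open>h = r b\<^sup>\<star> b\<close> scaled to a contraction, \<open>(1 - h)^M\<close> decreases to the projection \<open>q\<close> onto
  the kernel of \<open>b\<close>, and the partial sums \<open>D\<close> of the Neumann series \<open>r b\<^sup>\<star> \<Sum> (1 - h)^m\<close> satisfy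
  \<open>b D = 1 - (1 - h)^M\<close>: they invert \<open>b\<close> approximately on the support of \<open>b\<close>.\<close>

lemma approximate_inverse:
  assumes b: "b \<in> A"
  shows "\<exists>D q. (\<forall>M. D M \<in> A) \<and> q \<in> A \<and> is_projection q \<and> b * q = 0 \<and>
    (\<forall>x. (\<lambda>M. (b * D M) \<rhd> x) \<longlonglongrightarrow> x - q \<rhd> x) \<and>
    (\<forall>M x. norm ((b * D M) \<rhd> x) \<le> norm x)"
proof -
  obtain r where r: "0 < r" "pos (bop_scale (complex_of_real r) (b\<^sup>\<star> * b))"
    "pos (1 - bop_scale (complex_of_real r) (b\<^sup>\<star> * b))" using pos_normalize[OF pos_adj_mult_self] .
  define h where "h = bop_scale (complex_of_real r) (b\<^sup>\<star> * b)"
  define x where "x = 1 - h"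
  have h: "h \<in> A" "pos h" "pos x" using r b by (simp_all add: h_def x_def)
  have x: "x \<in> A" "x\<^sup>\<star> = x" using h by (auto simp: x_def intro: pos_adj)
  define a where "a M = 1 - x ^ M" for M
  have sum: "h * (\<Sum>m<M. x ^ m) = a M" for M
  proof (induct M)
    case (Suc M)
    have "h * (\<Sum>m<Suc M. x ^ m) = a M + h * x ^ M" using Suc by (simp add: distrib_left)
    moreover have "h * x ^ M = x ^ M - x * x ^ M" by (simp add: x_def algebra_simps)
    ultimately show ?case by (simp add: a_def)
  qed (simp add: a_def)
  have step: "pos (a (Suc M) - a M)" for M
  proof -
    have "a (Suc M) - a M = h * x ^ M" unfolding sum[symmetric] by (simp add: distrib_left)
    then show ?thesis using pos_mult[of h "x ^ M"] h x by (simp add: pos_power)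
  qed
  have a_pos: "pos (a M)" for M
  proof (induct M)
    case (Suc M)
    then show ?case using pos_add[OF Suc step[of M]] by simp
  qed (simp add: a_def)
  have le_one: "pos (1 - a M)" for M by (simp add: a_def pos_power h)
  have a_in: "a M \<in> A" for M by (simp add: a_def x)
  obtain l where l: "l \<in> A" "pos l" "\<And>u. (\<lambda>M. a M \<rhd> u) \<longlonglongrightarrow> l \<rhd> u"
    using monotone_limit[of a, OF a_in a_pos le_one step] by blast
  define q where "q = 1 - l"
  have pow: "(\<lambda>M. (x ^ M) \<rhd> u) \<longlonglongrightarrow> q \<rhd> u" for u
    using tendsto_diff[OF tendsto_const[of u] l(3)[of u]] by (simp add: a_def q_def)
  have "x * q = q"
  proof (rule bop_eqI)
    fix u
    have "(\<lambda>M. x \<rhd> ((x ^ M) \<rhd> u)) \<longlonglongrightarrow> q \<rhd> u" using LIMSEQ_Suc[OF pow[of u]] by simp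
    from LIMSEQ_unique[OF tendsto_bop_apply[OF pow] this] show "(x * q) \<rhd> u = q \<rhd> u" by simp
  qed
  then have hq: "h * q = 0" by (simp add: x_def algebra_simps)
  have xq: "x ^ M * q = q" for M by (induct M) (simp_all add: mult.assoc \<open>x * q = q\<close>)
  have "(x ^ M) \<rhd> (q \<rhd> u) = q \<rhd> u" for M u
    using arg_cong[OF xq[of M], of "\<lambda>f. f \<rhd> u"] by simp
  then have "q * q = q" using pow[of "q \<rhd> _"] by (intro bop_eqI) (simp add: LIMSEQ_const_iff)
  have q_adj: "q\<^sup>\<star> = q" using l(2) by (simp add: q_def adj_simps pos_adj)
  have "(b * q)\<^sup>\<star> * (b * q) = 0"
  proof -
    have "bop_scale (complex_of_real (1 / r)) (h * q) = b\<^sup>\<star> * (b * q)"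
      using r(1) by (simp add: h_def scale_simps mult.assoc flip: of_real_mult)
    then show ?thesis by (simp add: hq adj_mult mult.assoc)
  qed
  then have bq: "b * q = 0" by (rule adj_mult_self_eq_0)
  define D where "D M = bop_scale (complex_of_real r) (b\<^sup>\<star> * (\<Sum>m<M. x ^ m))" for M
  have bD: "b * D M = a M" for M
    using comm[of b "b\<^sup>\<star>"] b unfolding sum[symmetric] D_def h_def
    by (simp add: scale_simps flip: mult.assoc)
  show ?thesis
  proof (intro exI[of _ D] exI[of _ q] conjI allI)
    show "D M \<in> A" for M using b x by (simp add: D_def)
    show "q \<in> A" using l by (simp add: q_def)
    show "is_projection q" using \<open>q * q = q\<close> q_adj by (simp add: is_projection_def)
    show "b * q = 0" by (rule bq)
    show "(\<lambda>M. (b * D M) \<rhd> u) \<longlonglongrightarrow> u - q \<rhd> u" for u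
      using l(3)[of u] by (simp only: bD q_def) simp
    show "norm ((b * D M) \<rhd> u) \<le> norm u" for M u
      unfolding bD by (rule pos_contraction_norm[OF a_pos le_one])
  qed
qed

lemma is_projection_complement: "is_projection p \<Longrightarrow> is_projection (1 - p)"
  by (simp add: is_projection_def adj_simps algebra_simps)

lemma is_projection_mult:
  assumes "p \<in> A" "q \<in> A" "is_projection p" "is_projection q"
  shows "is_projection (p * q)"
proof -
  have "p * q * (p * q) = p * p * (q * q)"
    using left_comm[OF assms(2,1), of q] by (simp add: mult.assoc)
  then show ?thesis
    using assms comm[OF assms(2,1)] by (simp add: is_projection_def adj_mult)
qed

lemma support_projection:
  assumes a: "a \<in> A"
  obtains p where "p \<in> A" "is_projection p" "p * a = a" "\<And>z. z \<in> A \<Longrightarrow> z * a = 0 \<Longrightarrow> z * p = 0"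
proof -
  obtain D q where D: "\<And>M. D M \<in> A" "q \<in> A" "is_projection q" "a * q = 0"
    "\<And>x. (\<lambda>M. (a * D M) \<rhd> x) \<longlonglongrightarrow> x - q \<rhd> x"
    using approximate_inverse[OF a] by blast
  show ?thesis
  proof (rule that[of "1 - q"])
    show "(1 - q) * a = a" using comm[OF a D(2)] D(4) by (simp add: algebra_simps)
    fix z assume z: "z \<in> A" "z * a = 0"
    show "z * (1 - q) = 0"
    proof (rule bop_eqI)
      fix x
      have "(\<lambda>M. z \<rhd> ((a * D M) \<rhd> x)) \<longlonglongrightarrow> z \<rhd> (x - q \<rhd> x)"
        by (rule tendsto_bop_apply[OF D(5)])
      moreover have "z \<rhd> ((a * D M) \<rhd> x) = 0" for M
        using arg_cong[OF z(2), of "\<lambda>f. f \<rhd> (D M \<rhd> x)"] by simp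
      ultimately show "(z * (1 - q)) \<rhd> x = 0 \<rhd> x" by (simp add: LIMSEQ_const_iff)
    qed
  qed (use D is_projection_complement in auto)
qed

text \<open>With the approximate inverses \<open>D\<close> of \<open>b\<close> the quotient is the strong limit of \<open>a D\<close>: the inequality
  between \<open>a\<close> and \<open>b\<close> transfers the Cauchy property from \<open>b D x\<close> to \<open>a D x\<close>.\<close>

lemma division:
  assumes a: "a \<in> A" and b: "b \<in> A" and K: "0 \<le> K" and le: "\<And>x. norm (a \<rhd> x) \<le> K * norm (b \<rhd> x)"
  shows "\<exists>c\<in>A. a = c * b"
proof -
  obtain D q where D: "\<And>M. D M \<in> A" "q \<in> A" "is_projection q" "b * q = 0"
    "\<And>x. (\<lambda>M. (b * D M) \<rhd> x) \<longlonglongrightarrow> x - q \<rhd> x"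
    "\<And>M x. norm ((b * D M) \<rhd> x) \<le> norm x"
    using approximate_inverse[OF b] by blast
  have bound: "norm ((a * D M) \<rhd> x) \<le> K * norm x" for M x
    using order_trans[OF le[of "D M \<rhd> x"] mult_left_mono[OF D(6)[of M x] K, simplified]] by simp
  have "Cauchy (\<lambda>M. (a * D M) \<rhd> x)" for x
  proof (rule metric_CauchyI)
    fix e :: real assume e: "0 < e"
    have "0 < e / (K + 1)" using e K by simp
    then obtain N where N: "\<And>i j. i \<ge> N \<Longrightarrow> j \<ge> N \<Longrightarrow>
        dist ((b * D i) \<rhd> x) ((b * D j) \<rhd> x) < e / (K + 1)"
      using metric_CauchyD[OF LIMSEQ_imp_Cauchy[OF D(5)]] by metis
    have "dist ((a * D i) \<rhd> x) ((a * D j) \<rhd> x) < e" if "i \<ge> N" "j \<ge> N" for i j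
    proof -
      have "dist ((a * D i) \<rhd> x) ((a * D j) \<rhd> x) \<le> K * dist ((b * D i) \<rhd> x) ((b * D j) \<rhd> x)"
        using le[of "D i \<rhd> x - D j \<rhd> x"] by (simp add: dist_norm bop_apply_diff)
      also have "\<dots> \<le> (K + 1) * dist ((b * D i) \<rhd> x) ((b * D j) \<rhd> x)"
        by (intro mult_right_mono) auto
      also have "\<dots> < e" using N[OF that] K by (simp add: pos_less_divide_eq mult.commute)
      finally show ?thesis .
    qed
    then show "\<exists>N. \<forall>i\<ge>N. \<forall>j\<ge>N. dist ((a * D i) \<rhd> x) ((a * D j) \<rhd> x) < e" by blast
  qed
  from strong_limit[OF _ bound this] obtain c where
    c: "c \<in> A" "\<And>x. (\<lambda>M. (a * D M) \<rhd> x) \<longlonglongrightarrow> c \<rhd> x" using a D(1) by auto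
  have aq: "a \<rhd> (q \<rhd> x) = 0" for x
    using le[of "q \<rhd> x"] arg_cong[OF D(4), of "\<lambda>f. f \<rhd> x"] by simp
  have "a = c * b"
  proof (rule bop_eqI)
    fix x
    have "(\<lambda>M. a \<rhd> ((b * D M) \<rhd> x)) \<longlonglongrightarrow> a \<rhd> (x - q \<rhd> x)"
      by (rule tendsto_bop_apply[OF D(5)])
    then have "(\<lambda>M. a \<rhd> ((b * D M) \<rhd> x)) \<longlonglongrightarrow> a \<rhd> x" by (simp add: bop_apply_diff aq)
    moreover have "a \<rhd> ((b * D M) \<rhd> x) = (a * D M) \<rhd> (b \<rhd> x)" for M
      using arg_cong[OF comm[OF b D(1)[of M]], of "\<lambda>f. a \<rhd> (f \<rhd> x)"] by simp
    ultimately have "(\<lambda>M. (a * D M) \<rhd> (b \<rhd> x)) \<longlonglongrightarrow> a \<rhd> x" by simp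
    from LIMSEQ_unique[OF this c(2)] show "a \<rhd> x = (c * b) \<rhd> x" by simp
  qed
  with c(1) show ?thesis by blast
qed

text \<open>For \<open>a \<in> A\<close> this says that \<open>a\<close> has range projection \<open>1\<close>, in a form that suits cancellation.\<close>

definition regular :: "'a bop \<Rightarrow> bool" where
  "regular a \<longleftrightarrow> (\<forall>z\<in>A. z * a = 0 \<longrightarrow> z = 0)"

lemma regularD: "regular a \<Longrightarrow> z \<in> A \<Longrightarrow> z * a = 0 \<Longrightarrow> z = 0"
  by (simp add: regular_def)

lemma regular_one: "regular 1"
  by (simp add: regular_def)

lemma regular_mult: "a \<in> A \<Longrightarrow> regular a \<Longrightarrow> regular b \<Longrightarrow> regular (a * b)"
  unfolding regular_def by (auto simp flip: mult.assoc)

lemma range_projection_one_iff_regular: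
  assumes a: "a \<in> A" shows "is_range_projection A a 1 \<longleftrightarrow> regular a"
proof
  assume R: "is_range_projection A a 1"
  obtain p where p: "p \<in> A" "is_projection p" "p * a = a" "\<And>z. z \<in> A \<Longrightarrow> z * a = 0 \<Longrightarrow> z * p = 0"
    using support_projection[OF a] by blast
  then have "p = 1" using R unfolding is_range_projection_def by simp
  with p(4) show "regular a" by (simp add: regular_def)
next
  assume reg: "regular a"
  have "q * 1 = 1" if "q \<in> A" "q * a = a" for q
    using regularD[OF reg, of "1 - q"] that by (simp add: algebra_simps)
  then show "is_range_projection A a 1"
    by (auto simp: is_range_projection_def is_projection_def)
qed

text \<open>The projection onto the kernel of a regular element is annihilated by it, so it is \<open>0\<close>.\<close>

lemma regular_approximate_inverse:
  assumes c: "c \<in> A" "regular c"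
  obtains D where "\<And>M. D M \<in> A" "\<And>x. (\<lambda>M. (D M * c) \<rhd> x) \<longlonglongrightarrow> x"
proof -
  obtain D q where D: "\<And>M. D M \<in> A" and q: "q \<in> A" "c * q = 0"
    and lim: "\<And>x. (\<lambda>M. (c * D M) \<rhd> x) \<longlonglongrightarrow> x - q \<rhd> x"
    using approximate_inverse[OF c(1)] by blast
  have "q * c = 0" using comm[OF c(1) q(1)] q(2) by simp
  then have "q = 0" by (rule regularD[OF c(2) q(1)])
  with lim have "(\<lambda>M. (c * D M) \<rhd> x) \<longlonglongrightarrow> x" for x by simp
  moreover have "D M * c = c * D M" for M by (rule comm[OF D c(1)])
  ultimately show thesis using D by (intro that[of D]) simp_all
qed

end

subsection \<open>Spectral projections\<close>

context abelian_vna
begin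

text \<open>The projection is the support of \<open>\<bar>a\<bar> + a\<close>, where \<open>\<bar>a\<bar>\<close> is the square root of \<open>a\<^sup>2\<close>. It
  annihilates \<open>\<bar>a\<bar> - a\<close> since \<open>(\<bar>a\<bar> - a) (\<bar>a\<bar> + a) = 0\<close>.\<close>

lemma spectral_projection:
  assumes a: "a \<in> A" "a\<^sup>\<star> = a"
  shows "\<exists>e\<in>A. is_projection e \<and> pos (e * a) \<and> pos (- ((1 - e) * a))"
proof -
  obtain s where s: "s \<in> A" "pos s" "s * s = a * a"
    using positive_sqrt[of "a * a"] pos_adj_mult_self[of a] a by auto
  obtain e where e: "e \<in> A" "is_projection e" "e * (s + a) = s + a"
      "\<And>z. z \<in> A \<Longrightarrow> z * (s + a) = 0 \<Longrightarrow> z * e = 0"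
    using support_projection[of "s + a"] s(1) a(1) by auto
  have e': "e * e = e" "e\<^sup>\<star> = e" using e(2) by (auto simp: is_projection_def)
  have "(s - a) * (s + a) = 0" using comm[OF s(1) a(1)] s(3) by (simp add: algebra_simps)
  then have "(s - a) * e = 0" using e(4) s(1) a(1) by simp
  then have "e * a = e * s" using comm[of "s - a" e] s(1) a(1) e(1) by (simp add: algebra_simps)
  also have "\<dots> = e * s * e" using comm[OF s(1) e(1)] e'(1) by (metis mult.assoc)
  finally have 1: "pos (e * a)" using pos_sandwich[OF s(2) e'(2)] by simp
  define f where "f = 1 - e"
  have f: "f \<in> A" "f * f = f" "f\<^sup>\<star> = f" using e(1) e' by (simp_all add: f_def algebra_simps adj_simps)
  have "- (f * a) = f * s" using e(3) unfolding f_def by (simp add: algebra_simps)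
  also have "\<dots> = f * s * f" using comm[OF s(1) f(1)] f(2) by (metis mult.assoc)
  finally have 2: "pos (- ((1 - e) * a))" using pos_sandwich[OF s(2) f(3)] by (simp add: f_def)
  from 1 2 e show ?thesis by blast
qed

text \<open>On a spectral projection where \<open>a\<^sup>\<star> a \<ge> \<delta> > 0\<close> the operator \<open>a\<close> is bounded below, so that the
  projection can be divided by \<open>a\<close>. Half of the quotient of \<open>\<parallel>a x\<parallel>\<^sup>2\<close> and \<open>\<parallel>x\<parallel>\<^sup>2\<close> is a value of \<open>\<delta>\<close> for which
  the projection is not \<open>0\<close>.\<close>

lemma invertible_on_projection:
  assumes a: "a \<in> A" "a \<noteq> 0"
  obtains e c where "e \<in> A" "c \<in> A" "is_projection e" "e \<noteq> 0" "c * a = e"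
proof -
  obtain x where x: "a \<rhd> x \<noteq> 0" using a(2) bop_eqI[of a 0] by auto
  then have x0: "0 < (norm x)\<^sup>2" by auto
  define \<delta> where "\<delta> = (norm (a \<rhd> x))\<^sup>2 / (2 * (norm x)\<^sup>2)"
  have \<delta>: "0 < \<delta>" using x x0 by (simp add: \<delta>_def)
  define g where "g = a\<^sup>\<star> * a - bop_scale (complex_of_real \<delta>) 1"
  have g: "g \<in> A" "g\<^sup>\<star> = g" using a by (simp_all add: g_def adj_simps)
  have g_inner: "Re (cinner (g \<rhd> y) y) = (norm (a \<rhd> y))\<^sup>2 - \<delta> * (norm y)\<^sup>2" for y
    by (simp add: g_def norm_apply_squared cinner_linear Re_cinner_self)
  obtain e where e: "e \<in> A" "is_projection e" "pos (e * g)" "pos (- ((1 - e) * g))"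
    using spectral_projection[OF g] by blast
  have e': "e * e = e" "e\<^sup>\<star> = e" using e(2) by (auto simp: is_projection_def)
  have "e \<noteq> 0"
  proof
    assume "e = 0"
    then have "(norm (a \<rhd> x))\<^sup>2 \<le> \<delta> * (norm x)\<^sup>2"
      using posD[OF e(4), of x] g_inner[of x] by (simp add: cinner_linear)
    then show False using x x0 by (simp add: \<delta>_def)
  qed
  have bound: "norm (e \<rhd> y) \<le> (1 / sqrt \<delta>) * norm ((a * e) \<rhd> y)" for y
  proof -
    have "cinner ((e * g) \<rhd> e \<rhd> y) (e \<rhd> y) = cinner (g \<rhd> e \<rhd> y) (e \<rhd> y)"
    proof -
      have "e \<rhd> e \<rhd> y = e \<rhd> y" using arg_cong[OF e'(1), of "\<lambda>f. f \<rhd> y"] by simp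
      then show ?thesis using cinner_adj_left[of e "g \<rhd> e \<rhd> y" "e \<rhd> y"] e'(2) by simp
    qed
    then have "\<delta> * (norm (e \<rhd> y))\<^sup>2 \<le> (norm (a \<rhd> e \<rhd> y))\<^sup>2"
      using posD[OF e(3), of "e \<rhd> y"] g_inner[of "e \<rhd> y"] by simp
    then have "(sqrt \<delta> * norm (e \<rhd> y))\<^sup>2 \<le> (norm (a \<rhd> e \<rhd> y))\<^sup>2"
      using \<delta> by (simp add: power_mult_distrib)
    then have "sqrt \<delta> * norm (e \<rhd> y) \<le> norm (a \<rhd> e \<rhd> y)"
      by (rule power2_le_imp_le) simp
    then show ?thesis using \<delta> by (simp add: pos_le_divide_eq mult.commute)
  qed
  obtain c where c: "c \<in> A" "e = c * (a * e)"
    using division[OF e(1) mult_in[OF a(1) e(1)] _ bound] \<delta> by auto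
  then have "e = (c * e) * a" using comm[OF a(1) e(1)] by (simp add: mult.assoc)
  then show ?thesis using that[of e "c * e"] e c \<open>e \<noteq> 0\<close> by auto
qed

subsection \<open>Characters\<close>

text \<open>The points of the spectrum of \<open>A\<close> are described by ultrafilters of projections. Every \<open>a \<in> A\<close>
  is nearly scalar on some projection of an ultrafilter, and the scalar in the limit is the value
  of \<open>a\<close> at that point.\<close>

definition projection_ultrafilter :: "'a bop set \<Rightarrow> bool" where
  "projection_ultrafilter F \<longleftrightarrow> F \<subseteq> {e \<in> A. is_projection e} \<and> 0 \<notin> F \<and>
     (\<forall>e\<in>F. \<forall>f\<in>F. e * f \<in> F) \<and> (\<forall>e\<in>A. is_projection e \<longrightarrow> e \<in> F \<or> 1 - e \<in> F)"

definition value_at :: "'a bop set \<Rightarrow> 'a bop \<Rightarrow> complex \<Rightarrow> bool" where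
  "value_at F a c \<longleftrightarrow> (\<forall>\<epsilon>>0. \<exists>e\<in>F. bop_norm ((a - bop_scale c 1) * e) \<le> \<epsilon>)"

definition character :: "'a bop set \<Rightarrow> 'a bop \<Rightarrow> complex" where
  "character F a = (THE c. value_at F a c)"

text \<open>By Zorn's lemma there is a maximal multiplicatively closed set of nonzero projections that contains
  \<open>e0\<close>. A projection whose products with all its members are nonzero belongs to it, by maximality.\<close>

lemma ultrafilter_exists:
  assumes e0: "e0 \<in> A" "is_projection e0" "e0 \<noteq> 0"
  obtains F where "projection_ultrafilter F" "e0 \<in> F"
proof -
  define S where "S = {F. e0 \<in> F \<and> 1 \<in> F \<and> F \<subseteq> {e \<in> A. is_projection e} \<and> 0 \<notin> F \<and>
     (\<forall>e\<in>F. \<forall>f\<in>F. e * f \<in> F)}"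
  have "\<exists>M\<in>S. \<forall>X\<in>S. M \<subseteq> X \<longrightarrow> X = M"
  proof (rule subset_Zorn_nonempty)
    have "(1 :: 'a bop) \<noteq> 0" using e0(3) by (metis mult_1_right mult_zero_right)
    then have "{1, e0} \<in> S" using e0 by (auto simp: S_def is_projection_def)
    then show "S \<noteq> {}" by blast
    fix C assume C: "C \<noteq> {}" "subset.chain S C"
    have CS: "e0 \<in> X" "X \<subseteq> {e \<in> A. is_projection e}" "0 \<notin> X" "1 \<in> X"
      "\<And>e f. e \<in> X \<Longrightarrow> f \<in> X \<Longrightarrow> e * f \<in> X" if "X \<in> C" for X
      using C(2) that by (auto simp: subset_chain_def S_def)
    show "\<Union>C \<in> S"
      unfolding S_def
    proof (intro CollectI conjI ballI)
      show "e0 \<in> \<Union>C" "1 \<in> \<Union>C" using C(1) CS(1,4) by blast+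
      show "\<Union>C \<subseteq> {e \<in> A. is_projection e}" using CS(2) by blast
      show "0 \<notin> \<Union>C" using CS(3) by blast
      fix e f assume "e \<in> \<Union>C" "f \<in> \<Union>C"
      then obtain X Y where XY: "e \<in> X" "X \<in> C" "f \<in> Y" "Y \<in> C" by blast
      have "X \<subseteq> Y \<or> Y \<subseteq> X" using C(2) XY by (auto simp: subset_chain_def)
      then obtain Z where "e \<in> Z" "f \<in> Z" "Z \<in> C" using XY by blast
      then show "e * f \<in> \<Union>C" using CS(5)[of Z e f] by blast
    qed
  qed
  then obtain F where F: "F \<in> S" and max: "\<And>X. X \<in> S \<Longrightarrow> F \<subseteq> X \<Longrightarrow> X = F" by blast
  have FA: "e \<in> A" "is_projection e" if "e \<in> F" for e using F that by (auto simp: S_def)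
  have Fm: "e * f \<in> F" if "e \<in> F" "f \<in> F" for e f using F that by (auto simp: S_def)
  have "e \<in> F" if e: "e \<in> A" "is_projection e" "\<And>f. f \<in> F \<Longrightarrow> e * f \<noteq> 0" for e
  proof -
    have ee: "e * e = e" using e(2) by (simp add: is_projection_def)
    define X where "X = F \<union> (\<lambda>f. e * f) ` F"
    have "x * y \<in> X" if xy: "x \<in> X" "y \<in> X" for x y
    proof -
      have absorb: "f * (e * g) = e * (f * g)" "e * (e * g) = e * g" if "f \<in> F" for f g
        using left_comm[OF FA(1)[OF that] e(1)] by (simp_all add: ee flip: mult.assoc)
      consider f g where "f \<in> F" "g \<in> F" "x = f \<or> x = e * f" "y = g \<or> y = e * g"
        using xy unfolding X_def by blast
      then have "x * y \<in> F \<or> (\<exists>h\<in>F. x * y = e * h)"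
        by cases (auto simp: absorb mult.assoc[of e] intro: Fm)
      then show ?thesis by (auto simp: X_def)
    qed
    moreover have "e0 \<in> X" "1 \<in> X" "F \<subseteq> X" using F by (auto simp: X_def S_def)
    moreover have "0 \<notin> X" using F e(3) by (fastforce simp: X_def S_def)
    moreover have "X \<subseteq> {e \<in> A. is_projection e}"
      using FA e by (auto simp: X_def is_projection_mult)
    ultimately have "X \<in> S" by (auto simp: S_def)
    then have "X = F" using max \<open>F \<subseteq> X\<close> by blast
    moreover have "e * 1 \<in> X" using F unfolding X_def S_def by blast
    ultimately show ?thesis by simp
  qed
  then have large: "\<exists>f\<in>F. e * f = 0" if "e \<in> A" "is_projection e" "e \<notin> F" for e
    using that by blast
  have "e \<in> F \<or> 1 - e \<in> F" if e: "e \<in> A" "is_projection e" for e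
  proof (rule ccontr)
    assume not: "\<not> (e \<in> F \<or> 1 - e \<in> F)"
    obtain f where f: "f \<in> F" "e * f = 0" using large[OF e] not by blast
    obtain g where g: "g \<in> F" "(1 - e) * g = 0"
      using large[of "1 - e"] e not is_projection_complement by auto
    have "f * g = e * f * g + f * ((1 - e) * g)"
      using comm[OF e(1) FA(1)[OF f(1)]] by (simp add: algebra_simps)
    then have "f * g = 0" using f g by simp
    then show False using Fm[OF f(1) g(1)] F by (simp add: S_def)
  qed
  then show ?thesis using F that[of F] by (auto simp: projection_ultrafilter_def S_def)
qed

text \<open>As a product of commuting positive operators, \<open>(\<epsilon> - g) (\<epsilon> + g) = \<epsilon>\<^sup>2 - g\<^sup>2\<close> is positive.\<close>

lemma bop_norm_le_of_pos:
  assumes g: "g \<in> A" "g\<^sup>\<star> = g" and \<epsilon>: "0 \<le> \<epsilon>"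
    and "pos (bop_scale (complex_of_real \<epsilon>) 1 - g)" "pos (bop_scale (complex_of_real \<epsilon>) 1 + g)"
  shows "bop_norm g \<le> \<epsilon>"
proof (rule bop_norm_le[OF \<epsilon>])
  fix x
  have "pos ((bop_scale (complex_of_real \<epsilon>) 1 - g) * (bop_scale (complex_of_real \<epsilon>) 1 + g))"
    using assms by (intro pos_mult) auto
  also have "(bop_scale (complex_of_real \<epsilon>) 1 - g) * (bop_scale (complex_of_real \<epsilon>) 1 + g)
      = bop_scale (complex_of_real (\<epsilon>\<^sup>2)) 1 - g * g"
    by (simp add: algebra_simps scale_simps power2_eq_square)
  finally have "(norm (g \<rhd> x))\<^sup>2 \<le> \<epsilon>\<^sup>2 * (norm x)\<^sup>2"
    using posD[of "bop_scale (complex_of_real (\<epsilon>\<^sup>2)) 1 - g * g" x] g(2)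
    by (simp add: norm_apply_squared cinner_linear Re_cinner_self)
  then have "(norm (g \<rhd> x))\<^sup>2 \<le> (\<epsilon> * norm x)\<^sup>2" by (simp add: power_mult_distrib)
  then show "norm (g \<rhd> x) \<le> \<epsilon> * norm x" by (rule power2_le_imp_le) (simp add: \<epsilon>)
qed

end

locale point = abelian_vna +
  fixes F :: "'a bop set"
  assumes ultrafilter: "projection_ultrafilter F"
begin

lemma F_in: "e \<in> F \<Longrightarrow> e \<in> A" and F_proj: "e \<in> F \<Longrightarrow> is_projection e"
  and F_nonzero: "0 \<notin> F" and F_mult: "e \<in> F \<Longrightarrow> f \<in> F \<Longrightarrow> e * f \<in> F"
  and F_ultra: "e \<in> A \<Longrightarrow> is_projection e \<Longrightarrow> e \<in> F \<or> 1 - e \<in> F"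
  using ultrafilter unfolding projection_ultrafilter_def by auto

lemma F_idem: "e \<in> F \<Longrightarrow> e * e = e"
  using F_proj by (simp add: is_projection_def)

lemma one_in_F: "1 \<in> F"
  using F_ultra[of 1] F_nonzero by (auto simp: is_projection_def)

lemma bop_norm_projection:
  assumes "e \<in> F" shows "bop_norm e \<le> 1"
proof -
  have "e\<^sup>\<star> * e = e" "(1 - e)\<^sup>\<star> * (1 - e) = 1 - e"
    using F_proj[OF assms] by (auto simp: is_projection_def adj_simps algebra_simps)
  then have "pos e" "pos (1 - e)" using pos_adj_mult_self by metis+
  then show ?thesis using pos_contraction_norm by (intro bop_norm_le) auto
qed

lemma F_fixed_vector:
  assumes "e \<in> F" shows "\<exists>y. y \<noteq> 0 \<and> e \<rhd> y = y"
proof -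
  obtain x where "e \<rhd> x \<noteq> 0" using assms F_nonzero bop_eqI[of e 0] by fastforce
  moreover have "e \<rhd> e \<rhd> x = e \<rhd> x"
    using arg_cong[OF F_idem[OF assms], of "\<lambda>f. f \<rhd> x"] by simp
  ultimately show ?thesis by blast
qed

lemma projection_cinner:
  "is_projection e \<Longrightarrow> e \<rhd> y = y \<Longrightarrow> cinner (e \<rhd> z) y = cinner z y"
  using cinner_adj_left[of e z y] by (simp add: is_projection_def)

text \<open>Moves the positivity of \<open>p b\<close>, for a larger projection \<open>p\<close>, to \<open>b e\<close>.\<close>

lemma compress:
  assumes "e \<in> A" "p \<in> A" "b \<in> A" "e * e = e" "p * e = e"
  shows "e * (p * b) * e = b * e"
proof -
  have "e * (p * b) * e = b * p * e * e"
    using comm[of e "p * b"] comm[of p b] assms(1-3) by simp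
  then show ?thesis by (simp add: mult.assoc assms(4,5))
qed

text \<open>Let \<open>E r\<close> be the spectral projection of \<open>a\<close> for \<open>[r, \<infinity>)\<close>. The value is the supremum of all \<open>r\<close> with
  \<open>E r \<in> F\<close>: close to it there are \<open>r\<close> with \<open>E r \<in> F\<close> from below and \<open>1 - E r \<in> F\<close> from above, and on
  the product of two such projections \<open>a\<close> is nearly scalar.\<close>

lemma value_at_selfadj:
  assumes a: "a \<in> A" "a\<^sup>\<star> = a"
  shows "\<exists>c. value_at F a (complex_of_real c)"
proof -
  let ?s = "\<lambda>r. bop_scale (complex_of_real r) 1 :: 'a bop"
  have "\<exists>e\<in>A. is_projection e \<and> pos (e * (a - ?s r)) \<and> pos (- ((1 - e) * (a - ?s r)))" for r
    using a by (intro spectral_projection) (auto simp: adj_simps)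
  then obtain E where E: "\<And>r. E r \<in> A" "\<And>r. is_projection (E r)" "\<And>r. pos (E r * (a - ?s r))"
    "\<And>r. pos (- ((1 - E r) * (a - ?s r)))" by metis
  define K where "K = bop_norm a + 1"
  have upper: "r \<le> K" if r: "E r \<in> F" for r
  proof -
    obtain y where y: "y \<noteq> 0" "E r \<rhd> y = y" using F_fixed_vector[OF r] by blast
    have "0 \<le> Re (cinner (E r \<rhd> (a - ?s r) \<rhd> y) y)"
      using posD[OF E(3)[of r], of y] by (simp only: times_bop.rep_eq)
    also have "cinner (E r \<rhd> (a - ?s r) \<rhd> y) y = cinner ((a - ?s r) \<rhd> y) y"
      by (rule projection_cinner[OF E(2) y(2)])
    finally have "r * (norm y)\<^sup>2 \<le> Re (cinner (a \<rhd> y) y)"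
      by (simp add: cinner_linear Re_cinner_self)
    also have "\<dots> \<le> norm (a \<rhd> y) * norm y" by (rule cauchy_schwarz_Re)
    also have "\<dots> \<le> bop_norm a * norm y * norm y"
      by (intro mult_right_mono bop_norm) simp
    finally have "r * (norm y)\<^sup>2 \<le> bop_norm a * (norm y)\<^sup>2"
      by (simp add: power2_eq_square mult.assoc)
    then show ?thesis using y(1) by (simp add: K_def)
  qed
  have lower: "E (- K) \<in> F"
  proof (rule ccontr)
    assume "E (- K) \<notin> F"
    then have f: "1 - E (- K) \<in> F" using F_ultra E by blast
    obtain y where y: "y \<noteq> 0" "(1 - E (- K)) \<rhd> y = y" using F_fixed_vector[OF f] by blast
    have "0 \<le> - Re (cinner ((1 - E (- K)) \<rhd> (a - ?s (- K)) \<rhd> y) y)"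
      using posD[OF E(4)[of "- K"], of y]
      by (simp only: uminus_bop.rep_eq times_bop.rep_eq cinner_minus_left uminus_complex.sel)
    also have "cinner ((1 - E (- K)) \<rhd> (a - ?s (- K)) \<rhd> y) y = cinner ((a - ?s (- K)) \<rhd> y) y"
      by (rule projection_cinner[OF F_proj[OF f] y(2)])
    finally have "K * (norm y)\<^sup>2 \<le> Re (cinner (a \<rhd> (- y)) y)"
      by (simp add: cinner_linear Re_cinner_self bop_apply_minus)
    also have "\<dots> \<le> norm (a \<rhd> (- y)) * norm y" by (rule cauchy_schwarz_Re)
    also have "\<dots> \<le> bop_norm a * norm (- y) * norm y"
      by (intro mult_right_mono bop_norm) simp
    finally have "K * (norm y)\<^sup>2 \<le> bop_norm a * (norm y)\<^sup>2"
      by (simp add: power2_eq_square mult.assoc)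
    then show False using y(1) by (simp add: K_def)
  qed
  define c where "c = Sup {r. E r \<in> F}"
  have bdd: "bdd_above {r. E r \<in> F}" by (intro bdd_aboveI[of _ K]) (use upper in auto)
  have "value_at F a (complex_of_real c)"
    unfolding value_at_def
  proof (intro allI impI)
    fix \<epsilon> :: real assume \<epsilon>: "0 < \<epsilon>"
    obtain r where r: "E r \<in> F" "c - \<epsilon> < r"
      using less_cSupD[of "{r. E r \<in> F}" "c - \<epsilon>"] lower \<epsilon> unfolding c_def by auto
    have "E (c + \<epsilon>) \<notin> F" using cSup_upper[OF _ bdd, of "c + \<epsilon>"] \<epsilon> unfolding c_def by auto
    then have f: "1 - E (c + \<epsilon>) \<in> F" using F_ultra E by blast
    define p where "p = E r" define q where "q = 1 - E (c + \<epsilon>)"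
    define e where "e = p * q"
    have e: "e \<in> F" using F_mult r f by (simp add: e_def p_def q_def)
    have in_A: "p \<in> A" "q \<in> A" "e \<in> A" using E e F_in by (auto simp: p_def q_def)
    have e_adj: "e\<^sup>\<star> = e" and e_idem: "e * e = e"
      using F_proj[OF e] by (auto simp: is_projection_def)
    have pe: "p * e = e" "q * e = e"
      using F_idem[of p] F_idem[of q] r f left_comm[OF in_A(2,1), of q]
      by (simp_all add: e_def p_def[symmetric] q_def[symmetric] flip: mult.assoc)
    have 1: "pos ((a - ?s r) * e)"
    proof -
      have "e * (p * (a - ?s r)) * e = (a - ?s r) * e"
        using a in_A by (intro compress pe e_idem) auto
      then show ?thesis using pos_sandwich[OF E(3)[of r] e_adj] by (simp add: p_def)
    qed
    have 2: "pos (- ((a - ?s (c + \<epsilon>)) * e))"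
    proof -
      have "e * (q * (a - ?s (c + \<epsilon>))) * e = (a - ?s (c + \<epsilon>)) * e"
        using a in_A by (intro compress pe e_idem) auto
      then have "e * (- (q * (a - ?s (c + \<epsilon>)))) * e = - ((a - ?s (c + \<epsilon>)) * e)" by simp
      then show ?thesis using pos_sandwich[OF E(4)[of "c + \<epsilon>"] e_adj] by (simp add: q_def)
    qed
    have pos_e: "pos e" using pos_adj_mult_self[of e] e_adj e_idem by simp
    have pos_1e: "pos (1 - e)"
      using pos_adj_mult_self[of "1 - e"] e_adj e_idem by (simp add: adj_simps algebra_simps)
    define g where "g = (a - ?s c) * e"
    have "bop_norm g \<le> \<epsilon>"
    proof (rule bop_norm_le_of_pos)
      show "g \<in> A" using a in_A by (simp add: g_def)
      show "g\<^sup>\<star> = g" using a in_A comm[of e "a - ?s c"] by (simp add: g_def adj_simps e_adj)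
      have eq1: "?s \<epsilon> - g = - ((a - ?s (c + \<epsilon>)) * e) + bop_scale (complex_of_real \<epsilon>) (1 - e)"
        by (simp add: g_def algebra_simps scale_simps)
      show "pos (?s \<epsilon> - g)"
        unfolding eq1 using \<epsilon> by (intro pos_add 2 pos_scale pos_1e) auto
      have eq2: "?s \<epsilon> + g = (a - ?s r) * e + (bop_scale (complex_of_real (r - (c - \<epsilon>))) e
          + bop_scale (complex_of_real \<epsilon>) (1 - e))"
        by (simp add: g_def algebra_simps scale_simps)
      show "pos (?s \<epsilon> + g)"
        unfolding eq2 using \<epsilon> r(2) by (intro pos_add 1 pos_scale pos_1e pos_e) auto
    qed (use \<epsilon> in simp)
    then show "\<exists>e\<in>F. bop_norm ((a - ?s c) * e) \<le> \<epsilon>" using e by (auto simp: g_def)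
  qed
  then show ?thesis by blast
qed

lemma value_at_unique:
  assumes "value_at F a c" "value_at F a d" shows "c = d"
proof (rule ccontr)
  assume "c \<noteq> d"
  define \<epsilon> where "\<epsilon> = cmod (c - d) / 4"
  have \<epsilon>: "0 < \<epsilon>" using \<open>c \<noteq> d\<close> by (simp add: \<epsilon>_def)
  obtain e f where e: "e \<in> F" "bop_norm ((a - bop_scale c 1) * e) \<le> \<epsilon>"
    and f: "f \<in> F" "bop_norm ((a - bop_scale d 1) * f) \<le> \<epsilon>"
    using assms \<epsilon> unfolding value_at_def by blast
  have ef: "e * f \<in> F" by (rule F_mult[OF e(1) f(1)])
  obtain y where y: "y \<noteq> 0" "(e * f) \<rhd> y = y" using F_fixed_vector[OF ef] by blast
  have "e * (e * f) = e * f" "f * (e * f) = e * f"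
    using F_idem[OF e(1)] F_idem[OF f(1)] left_comm[OF F_in[OF f(1)] F_in[OF e(1)], of f]
    by (simp_all flip: mult.assoc)
  from arg_cong[OF this(1), of "\<lambda>g. g \<rhd> y"] arg_cong[OF this(2), of "\<lambda>g. g \<rhd> y"]
  have ey: "e \<rhd> y = y" and fy: "f \<rhd> y = y"
    using y(2) by simp_all
  have "norm (a \<rhd> y - c *\<^sub>C y) \<le> \<epsilon> * norm y"
    using order_trans[OF bop_norm[of "(a - bop_scale c 1) * e" y] mult_right_mono[OF e(2)]]
    by (simp add: ey)
  moreover have "norm (a \<rhd> y - d *\<^sub>C y) \<le> \<epsilon> * norm y"
    using order_trans[OF bop_norm[of "(a - bop_scale d 1) * f" y] mult_right_mono[OF f(2)]]
    by (simp add: fy)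
  moreover have "(c - d) *\<^sub>C y = (a \<rhd> y - d *\<^sub>C y) - (a \<rhd> y - c *\<^sub>C y)"
    using scaleC_add_left[of c "- d" y] by (simp add: scaleC_minus_left)
  then have "cmod (c - d) * norm y \<le> norm (a \<rhd> y - d *\<^sub>C y) + norm (a \<rhd> y - c *\<^sub>C y)"
    by (metis norm_scaleC norm_triangle_ineq4)
  ultimately have "cmod (c - d) * norm y \<le> 2 * \<epsilon> * norm y" by simp
  moreover have "0 < norm y" using y by simp
  ultimately show False using \<epsilon> by (simp add: \<epsilon>_def mult_le_0_iff)
qed

lemma value_at_small:
  assumes "value_at F a c" "0 < \<epsilon>"
  shows "\<exists>e\<in>F. bop_norm ((a - bop_scale c 1) * e) \<le> \<epsilon>"
  using assms unfolding value_at_def by blast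

lemma bop_norm_restrict:
  assumes "e \<in> F" "f \<in> F" shows "bop_norm (a * (e * f)) \<le> bop_norm (a * e)" "bop_norm (a * (e * f)) \<le> bop_norm (a * f)"
proof -
  have "bop_norm (a * e * f) \<le> bop_norm (a * e) * 1" if "e \<in> F" "f \<in> F" for e f
    by (rule order_trans[OF bop_norm_mult mult_left_mono[OF bop_norm_projection[OF that(2)]]]) simp
  from this[OF assms] this[OF assms(2,1)]
  show "bop_norm (a * (e * f)) \<le> bop_norm (a * e)" "bop_norm (a * (e * f)) \<le> bop_norm (a * f)"
    using comm[OF F_in[OF assms(1)] F_in[OF assms(2)]] by (simp_all add: mult.assoc)
qed

lemma value_at_add:
  assumes "value_at F a c" "value_at F b d" shows "value_at F (a + b) (c + d)"
  unfolding value_at_def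
proof (intro allI impI)
  fix \<epsilon> :: real assume \<epsilon>: "0 < \<epsilon>"
  obtain e f where e: "e \<in> F" "bop_norm ((a - bop_scale c 1) * e) \<le> \<epsilon> / 2"
    and f: "f \<in> F" "bop_norm ((b - bop_scale d 1) * f) \<le> \<epsilon> / 2"
    using value_at_small[OF assms(1), of "\<epsilon> / 2"] value_at_small[OF assms(2), of "\<epsilon> / 2"] \<epsilon> by auto
  have "(a + b - bop_scale (c + d) 1) * (e * f)
      = (a - bop_scale c 1) * (e * f) + (b - bop_scale d 1) * (e * f)"
    by (simp add: algebra_simps scale_simps)
  then have "bop_norm ((a + b - bop_scale (c + d) 1) * (e * f))
      \<le> bop_norm ((a - bop_scale c 1) * (e * f)) + bop_norm ((b - bop_scale d 1) * (e * f))"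
    using bop_norm_add by simp
  also have "\<dots> \<le> \<epsilon>"
    using bop_norm_restrict(1)[OF e(1) f(1), of "a - bop_scale c 1"]
      bop_norm_restrict(2)[OF e(1) f(1), of "b - bop_scale d 1"] e f by linarith
  finally show "\<exists>e\<in>F. bop_norm ((a + b - bop_scale (c + d) 1) * e) \<le> \<epsilon>"
    using F_mult[OF e(1) f(1)] by blast
qed

lemma value_at_mult:
  assumes "value_at F a c" "value_at F b d" shows "value_at F (a * b) (c * d)"
  unfolding value_at_def
proof (intro allI impI)
  fix \<epsilon> :: real assume \<epsilon>: "0 < \<epsilon>"
  define K where "K = bop_norm a + cmod d + 1"
  have K: "0 < K" by (simp add: K_def add_nonneg_pos)
  obtain e f where e: "e \<in> F" "bop_norm ((a - bop_scale c 1) * e) \<le> \<epsilon> / K"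
    and f: "f \<in> F" "bop_norm ((b - bop_scale d 1) * f) \<le> \<epsilon> / K"
    using value_at_small[OF assms(1), of "\<epsilon> / K"] value_at_small[OF assms(2), of "\<epsilon> / K"] \<epsilon> K by auto
  have scale: "bop_norm (bop_scale d g) \<le> cmod d * bop_norm g" for g :: "'a bop"
  proof (rule bop_norm_le)
    show "norm (bop_scale d g \<rhd> x) \<le> cmod d * bop_norm g * norm x" for x
      using mult_left_mono[OF bop_norm[of g x], of "cmod d"] by (simp add: norm_scaleC mult.assoc)
  qed simp
  have "(a * b - bop_scale (c * d) 1) * (e * f)
      = a * ((b - bop_scale d 1) * (e * f)) + bop_scale d ((a - bop_scale c 1) * (e * f))"
    by (simp add: algebra_simps scale_simps)
  then have "bop_norm ((a * b - bop_scale (c * d) 1) * (e * f))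
      \<le> bop_norm a * bop_norm ((b - bop_scale d 1) * (e * f))
        + cmod d * bop_norm ((a - bop_scale c 1) * (e * f))"
    using order_trans[OF bop_norm_add add_mono[OF bop_norm_mult scale]] by simp
  also have "\<dots> \<le> bop_norm a * (\<epsilon> / K) + cmod d * (\<epsilon> / K)"
    using bop_norm_restrict(1)[OF e(1) f(1), of "a - bop_scale c 1"]
      bop_norm_restrict(2)[OF e(1) f(1), of "b - bop_scale d 1"] e f
    by (intro add_mono mult_left_mono) auto
  also have "\<dots> \<le> K * (\<epsilon> / K)"
    using \<epsilon> K by (simp add: K_def distrib_right[symmetric] del: times_divide_eq_right) 
  also have "\<dots> = \<epsilon>" using K by simp
  finally show "\<exists>e\<in>F. bop_norm ((a * b - bop_scale (c * d) 1) * e) \<le> \<epsilon>"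
    using F_mult[OF e(1) f(1)] by blast
qed

lemma value_at_scalar: "value_at F (bop_scale c 1) c"
  using one_in_F by (auto simp: value_at_def intro!: bexI[of _ 1])

lemma value_at_exists:
  assumes "a \<in> A" shows "\<exists>c. value_at F a c"
proof -
  define u where "u = bop_scale (1 / 2) (a + a\<^sup>\<star>)"
  define v where "v = bop_scale (- \<i> / 2) (a - a\<^sup>\<star>)"
  have uv: "u \<in> A" "u\<^sup>\<star> = u" "v \<in> A" "v\<^sup>\<star> = v"
    using assms by (simp_all add: u_def v_def adj_simps add.commute scale_simps)
  have "bop_scale (1 / 2) a + bop_scale (1 / 2) a = a" by (simp flip: scale_add_left)
  then have "a = u + bop_scale \<i> 1 * v"
    by (simp add: u_def v_def scale_simps algebra_simps)
  with value_at_add[OF _ value_at_mult[OF value_at_scalar]] value_at_selfadj uv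
  show ?thesis by metis
qed

lemma value_at_character: "a \<in> A \<Longrightarrow> value_at F a (character F a)"
  unfolding character_def by (rule theI') (metis value_at_exists value_at_unique)

lemma character_eqI: "value_at F a c \<Longrightarrow> character F a = c"
  unfolding character_def by (blast intro: value_at_unique)

lemma character_add: "a \<in> A \<Longrightarrow> b \<in> A \<Longrightarrow> character F (a + b) = character F a + character F b"
  by (intro character_eqI value_at_add value_at_character)

lemma character_mult: "a \<in> A \<Longrightarrow> b \<in> A \<Longrightarrow> character F (a * b) = character F a * character F b"
  by (intro character_eqI value_at_mult value_at_character)

lemma character_scalar: "character F (bop_scale c 1) = c"
  by (intro character_eqI value_at_scalar)

lemma character_one [simp]: "character F 1 = 1"
  using character_scalar[of 1] by simp

lemma character_zero [simp]: "character F 0 = 0"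
  using character_scalar[of 0] by simp

lemma character_sum:
  "(\<And>i. i \<in> I \<Longrightarrow> f i \<in> A) \<Longrightarrow> character F (\<Sum>i\<in>I. f i) = (\<Sum>i\<in>I. character F (f i))"
  by (induct I rule: infinite_finite_induct) (auto simp: character_add)

lemma character_projection: "e \<in> F \<Longrightarrow> character F e = 1"
  by (rule character_eqI) (auto simp: value_at_def algebra_simps F_idem intro!: bexI[of _ e])

end

text \<open>A nonzero \<open>a\<close> becomes invertible on some projection, so no character carried by that projection
  vanishes on \<open>a\<close>: the characters separate the points of \<open>A\<close>.\<close>

lemma (in abelian_vna) character_nonzero:
  assumes "a \<in> A" "a \<noteq> 0"
  obtains F where "point A F" "character F a \<noteq> 0"
proof -
  obtain e c where ec: "e \<in> A" "c \<in> A" "is_projection e" "e \<noteq> 0" "c * a = e"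
    using invertible_on_projection[OF assms] by blast
  obtain F where F: "projection_ultrafilter F" "e \<in> F"
    using ultrafilter_exists[OF ec(1,3,4)] by blast
  interpret point A F by standard (rule F)
  have "character F c * character F a = 1"
    using character_mult[OF ec(2) assms(1)] character_projection[OF F(2)] ec(5) by simp
  then have "character F a \<noteq> 0" by auto
  with point_axioms show ?thesis by (rule that)
qed

section \<open>Locally finite matrices\<close>

text \<open>Matrices indexed by \<open>nat \<times> nat\<close> whose rows and columns are finitely supported form one ring
  with unit, which contains the \<open>n \<times> n\<close> matrices for all \<open>n\<close> as corners \<open>p X p\<close>, and which contains
  all the scalars \<open>I \<otimes> a\<close>. An \<open>m \<times> m\<close> block of a larger matrix needs no reindexing: it is the
  compression to a set of indices. This makes inductions on the size straightforward.\<close>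

typedef (overloaded) 'r lfmat = "{f :: nat \<Rightarrow> nat \<Rightarrow> 'r::zero.
    (\<forall>i. finite {j. f i j \<noteq> 0}) \<and> (\<forall>j. finite {i. f i j \<noteq> 0})}"
  morphisms ent Abs_lfmat
  by (rule exI[of _ "\<lambda>_ _. 0"]) simp

setup_lifting type_definition_lfmat

lemma lfmat_eqI: "(\<And>i j. ent X i j = ent Y i j) \<Longrightarrow> X = Y"
  by (simp add: ent_inject[symmetric] fun_eq_iff)

lemma finite_row: "finite {j. ent X i j \<noteq> 0}" and finite_column: "finite {i. ent X i j \<noteq> 0}"
  using ent[of X] by auto

instantiation lfmat :: (ring) ring
begin

lift_definition zero_lfmat :: "'a lfmat" is "\<lambda>_ _. 0" by simp

lift_definition plus_lfmat :: "'a lfmat \<Rightarrow> 'a lfmat \<Rightarrow> 'a lfmat" is "\<lambda>f g i j. f i j + g i j"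
proof (intro conjI allI)
  fix f g :: "nat \<Rightarrow> nat \<Rightarrow> 'a" and i
  assume *: "(\<forall>i. finite {j. f i j \<noteq> 0}) \<and> (\<forall>j. finite {i. f i j \<noteq> 0})"
    "(\<forall>i. finite {j. g i j \<noteq> 0}) \<and> (\<forall>j. finite {i. g i j \<noteq> 0})"
  show "finite {j. f i j + g i j \<noteq> 0}"
    by (rule finite_subset[of _ "{j. f i j \<noteq> 0} \<union> {j. g i j \<noteq> 0}"]) (use * in auto)
  show "finite {j. f j i + g j i \<noteq> 0}"
    by (rule finite_subset[of _ "{j. f j i \<noteq> 0} \<union> {j. g j i \<noteq> 0}"]) (use * in auto)
qed

lift_definition uminus_lfmat :: "'a lfmat \<Rightarrow> 'a lfmat" is "\<lambda>f i j. - f i j" by simp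

definition minus_lfmat :: "'a lfmat \<Rightarrow> 'a lfmat \<Rightarrow> 'a lfmat" where "minus_lfmat X Y = X + - Y"

lift_definition times_lfmat :: "'a lfmat \<Rightarrow> 'a lfmat \<Rightarrow> 'a lfmat"
  is "\<lambda>f g i j. \<Sum>k\<in>{k. f i k \<noteq> 0}. f i k * g k j"
proof (intro conjI allI)
  fix f g :: "nat \<Rightarrow> nat \<Rightarrow> 'a" and i
  assume *: "(\<forall>i. finite {j. f i j \<noteq> 0}) \<and> (\<forall>j. finite {i. f i j \<noteq> 0})"
    "(\<forall>i. finite {j. g i j \<noteq> 0}) \<and> (\<forall>j. finite {i. g i j \<noteq> 0})"
  show "finite {j. (\<Sum>k | f i k \<noteq> 0. f i k * g k j) \<noteq> 0}"
  proof (rule finite_subset)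
    show "{j. (\<Sum>k | f i k \<noteq> 0. f i k * g k j) \<noteq> 0} \<subseteq> (\<Union>k\<in>{k. f i k \<noteq> 0}. {j. g k j \<noteq> 0})"
      by (auto elim!: sum.not_neutral_contains_not_neutral)
  qed (use * in auto)
  show "finite {j. (\<Sum>k | f j k \<noteq> 0. f j k * g k i) \<noteq> 0}"
  proof (rule finite_subset)
    show "{j. (\<Sum>k | f j k \<noteq> 0. f j k * g k i) \<noteq> 0} \<subseteq> (\<Union>k\<in>{k. g k i \<noteq> 0}. {j. f j k \<noteq> 0})"
      by (auto elim!: sum.not_neutral_contains_not_neutral) (metis mult_zero_right)
  qed (use * in auto)
qed

lemma ent_times':
  assumes "finite K" "\<And>k. k \<notin> K \<Longrightarrow> ent X i k = 0 \<or> ent Y k j = 0"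
  shows "ent (X * Y :: 'a lfmat) i j = (\<Sum>k\<in>K. ent X i k * ent Y k j)"
proof -
  let ?S = "{k. ent X i k \<noteq> 0}"
  have "ent (X * Y) i j = (\<Sum>k\<in>?S. ent X i k * ent Y k j)" by (simp add: times_lfmat.rep_eq)
  also have "\<dots> = (\<Sum>k\<in>?S \<union> K. ent X i k * ent Y k j)"
    by (rule sum.mono_neutral_left) (use assms(1) finite_row in auto)
  also have "\<dots> = (\<Sum>k\<in>K. ent X i k * ent Y k j)"
  proof (rule sum.mono_neutral_right)
    show "\<forall>k\<in>?S \<union> K - K. ent X i k * ent Y k j = 0"
      using assms(2) by (metis DiffD2 mult_zero_left mult_zero_right)
  qed (use assms(1) finite_row in auto)
  finally show ?thesis .
qed

instance
proof
  fix X Y V :: "'a lfmat"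
  note simps = plus_lfmat.rep_eq uminus_lfmat.rep_eq zero_lfmat.rep_eq
  show "X + Y + V = X + (Y + V)" by (rule lfmat_eqI) (simp add: simps add.assoc)
  show "X + Y = Y + X" by (rule lfmat_eqI) (simp add: simps add.commute)
  show "0 + X = X" "- X + X = 0" by (rule lfmat_eqI; simp add: simps)+
  show "X - Y = X + - Y" by (simp add: minus_lfmat_def)
  show "X * Y * V = X * (Y * V)"
  proof (rule lfmat_eqI)
    fix i j
    define K where "K = {k. ent X i k \<noteq> 0}"
    define L where "L = {l. ent V l j \<noteq> 0}"
    have fin: "finite K" "finite L" by (simp_all add: K_def L_def finite_row finite_column)
    have "ent (X * Y * V) i j = (\<Sum>l\<in>L. (\<Sum>k\<in>K. ent X i k * ent Y k l) * ent V l j)"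
      by (subst ent_times'[of L], use fin in \<open>simp_all add: L_def\<close>)
        (subst ent_times'[of K], use fin in \<open>simp_all add: K_def\<close>)
    also have "\<dots> = (\<Sum>k\<in>K. ent X i k * (\<Sum>l\<in>L. ent Y k l * ent V l j))"
      by (simp add: sum_distrib_left sum_distrib_right mult.assoc) (rule sum.swap)
    also have "\<dots> = ent (X * (Y * V)) i j"
      by (subst ent_times'[of K X i], use fin in \<open>simp_all add: K_def\<close>)
        (subst ent_times'[of L], use fin in \<open>simp_all add: L_def\<close>)
    finally show "ent (X * Y * V) i j = ent (X * (Y * V)) i j" .
  qed
  show "(X + Y) * V = X * V + Y * V"
  proof (rule lfmat_eqI)
    fix i j
    have *: "ent (U * V) i j = (\<Sum>k\<in>{l. ent V l j \<noteq> 0}. ent U i k * ent V k j)" for U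
      by (rule ent_times') (auto simp: finite_column)
    show "ent ((X + Y) * V) i j = ent (X * V + Y * V) i j"
      by (simp add: * simps distrib_right sum.distrib)
  qed
  show "X * (Y + V) = X * Y + X * V"
    by (rule lfmat_eqI) (simp add: times_lfmat.rep_eq simps distrib_left sum.distrib)
qed

end

lemmas ent_times = ent_times'

lift_definition scalar :: "'r::zero \<Rightarrow> 'r lfmat" is "\<lambda>a i j. if i = j then a else 0"
  by simp

lift_definition index_proj :: "nat set \<Rightarrow> 'r::{zero,one} lfmat" is "\<lambda>I i j. if i = j \<and> i \<in> I then 1 else 0"
proof (intro conjI allI)
  fix I i
  show "finite {j. (if i = j \<and> i \<in> I then 1 else 0 :: 'r) \<noteq> 0}"
    by (rule finite_subset[of _ "{i}"]) auto
  show "finite {j. (if j = i \<and> j \<in> I then 1 else 0 :: 'r) \<noteq> 0}"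
    by (rule finite_subset[of _ "{i}"]) auto
qed

lift_definition munit :: "nat \<Rightarrow> nat \<Rightarrow> 'r::{zero,one} lfmat" is "\<lambda>a b i j. if i = a \<and> j = b then 1 else 0"
  by simp

instantiation lfmat :: ("{ring, monoid_mult}") monoid_mult
begin

definition one_lfmat :: "'a lfmat" where "one_lfmat = scalar 1"

instance
proof
  fix X :: "'a lfmat"
  show "1 * X = X"
  proof (rule lfmat_eqI)
    fix i j
    show "ent (1 * X) i j = ent X i j"
      by (subst ent_times[of "{i}"]) (auto simp: one_lfmat_def scalar.rep_eq)
  qed
  show "X * 1 = X"
  proof (rule lfmat_eqI)
    fix i j
    show "ent (X * 1) i j = ent X i j"
      by (subst ent_times[of "{j}"]) (auto simp: one_lfmat_def scalar.rep_eq)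
  qed
qed

end

lemma ent_zero [simp]: "ent 0 i j = 0" by (simp add: zero_lfmat.rep_eq)

lemma ent_add [simp]: "ent (X + Y) i j = ent X i j + ent Y i j" by (simp add: plus_lfmat.rep_eq)

lemma ent_minus [simp]: "ent (- X) i j = - ent X i j" by (simp add: uminus_lfmat.rep_eq)

lemma ent_diff [simp]: "ent (X - Y) i j = ent X i j - ent Y i j"
  by (simp only: diff_conv_add_uminus ent_add ent_minus)

lemma ent_sum [simp]: "ent (\<Sum>x\<in>S. f x) i j = (\<Sum>x\<in>S. ent (f x) i j)"
  by (induct S rule: infinite_finite_induct) auto

lemma ent_scalar [simp]: "ent (scalar a) i j = (if i = j then a else 0)" by (simp add: scalar.rep_eq)

lemma ent_one [simp]: "ent 1 i j = (if i = j then 1 else 0)" by (simp add: one_lfmat_def)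

lemma ent_index_proj [simp]: "ent (index_proj I) i j = (if i = j \<and> i \<in> I then 1 else 0)"
  by (simp add: index_proj.rep_eq)

lemma ent_munit [simp]: "ent (munit a b) i j = (if i = a \<and> j = b then 1 else 0)"
  by (simp add: munit.rep_eq)

lemma ent_scalar_times [simp]: "ent (scalar a * X) i j = a * ent X i j"
  by (subst ent_times[of "{i}"]) auto

lemma ent_times_scalar [simp]: "ent (X * scalar a) i j = ent X i j * a"
  by (subst ent_times[of "{j}"]) auto

lemma ent_index_proj_times [simp]:
  "ent (index_proj I * X) i j = (if i \<in> I then ent X i j else (0 :: 'r::{ring,monoid_mult}))"
  by (subst ent_times[of "{i}"]) auto

lemma ent_times_index_proj [simp]:
  "ent (X * index_proj I) i j = (if j \<in> I then ent X i j else (0 :: 'r::{ring,monoid_mult}))"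
  by (subst ent_times[of "{j}"]) auto

lemma ent_munit_times [simp]:
  "ent (munit a b * X) i j = (if i = a then ent X b j else (0 :: 'r::{ring,monoid_mult}))"
  by (subst ent_times[of "{b}"]) auto

lemma ent_times_munit [simp]:
  "ent (X * munit a b) i j = (if j = b then ent X i a else (0 :: 'r::{ring,monoid_mult}))"
  by (subst ent_times[of "{a}"]) auto

lemma scalar_zero [simp]: "scalar (0::'r::ring) = 0" by (rule lfmat_eqI) simp

lemma scalar_one [simp]: "scalar (1::'r::{ring,monoid_mult}) = 1" by (simp add: one_lfmat_def)

lemma scalar_add: "scalar (a + b :: 'r::ring) = scalar a + scalar b" by (rule lfmat_eqI) simp

lemma scalar_minus: "scalar (- a :: 'r::ring) = - scalar a" by (rule lfmat_eqI) simp

lemma scalar_diff: "scalar (a - b :: 'r::ring) = scalar a - scalar b" by (rule lfmat_eqI) simp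

lemma scalar_mult: "scalar (a * b :: 'r::ring) = scalar a * scalar b" by (rule lfmat_eqI) simp

lemma munit_times: "munit a b * munit c d = (if b = c then munit a d else (0::'r::{ring,monoid_mult} lfmat))"
  by (rule lfmat_eqI) auto

lemma index_proj_times: "index_proj I * index_proj J = (index_proj (I \<inter> J) :: 'r::{ring,monoid_mult} lfmat)"
  by (rule lfmat_eqI) auto

lemma index_proj_idem [simp]: "index_proj I * index_proj I = (index_proj I :: 'r::{ring,monoid_mult} lfmat)"
  by (simp add: index_proj_times)

lemma index_proj_scalar: "index_proj I * scalar a = scalar a * (index_proj I :: 'r::{ring,monoid_mult} lfmat)"
  by (rule lfmat_eqI) auto

lemma munit_scalar: "munit i j * scalar a = scalar a * (munit i j :: 'r::{ring,monoid_mult} lfmat)"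
  by (rule lfmat_eqI) auto

subsection \<open>Supports\<close>

definition supported :: "nat set \<Rightarrow> 'r::zero lfmat \<Rightarrow> bool" where
  "supported I X \<longleftrightarrow> (\<forall>i j. ent X i j \<noteq> 0 \<longrightarrow> i \<in> I \<and> j \<in> I)"

lemma supported_iff:
  "supported I X \<longleftrightarrow> index_proj I * X = X \<and> X * index_proj I = (X :: 'r::{ring,monoid_mult} lfmat)"
proof
  assume *: "supported I X"
  have "ent X i j = 0" if "i \<notin> I \<or> j \<notin> I" for i j using * that unfolding supported_def by blast
  then show "index_proj I * X = X \<and> X * index_proj I = X" by (auto intro!: lfmat_eqI)
next
  assume *: "index_proj I * X = X \<and> X * index_proj I = X"
  have "ent (index_proj I * X) i j = ent X i j" "ent (X * index_proj I) i j = ent X i j" for i j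
    using * by simp_all
  then show "supported I X" unfolding supported_def by (metis ent_index_proj_times ent_times_index_proj)
qed

lemma supported_ent: "supported I X \<Longrightarrow> i \<notin> I \<or> j \<notin> I \<Longrightarrow> ent X i j = 0"
  unfolding supported_def by blast

lemma supported_left: "supported I X \<Longrightarrow> index_proj I * X = (X :: 'r::{ring,monoid_mult} lfmat)"
  and supported_right: "supported I X \<Longrightarrow> X * index_proj I = (X :: 'r::{ring,monoid_mult} lfmat)"
  by (simp_all add: supported_iff)

lemma supported_zero [simp]: "supported I 0" by (simp add: supported_def)

lemma supported_index_proj [simp]: "supported I (index_proj I :: 'r::{ring,monoid_mult} lfmat)"
  by (simp add: supported_def)

lemma supported_add: "supported I X \<Longrightarrow> supported I Y \<Longrightarrow> supported I (X + Y :: 'r::ring lfmat)"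
  unfolding supported_def by (metis add.right_neutral ent_add)

lemma supported_minus: "supported I X \<Longrightarrow> supported I (- X :: 'r::ring lfmat)"
  unfolding supported_def by simp

lemma supported_diff: "supported I X \<Longrightarrow> supported I Y \<Longrightarrow> supported I (X - Y :: 'r::ring lfmat)"
  by (simp only: diff_conv_add_uminus supported_add supported_minus)

lemma supported_mult:
  "supported I X \<Longrightarrow> supported I Y \<Longrightarrow> supported I (X * Y :: 'r::{ring,monoid_mult} lfmat)"
  unfolding supported_iff by (metis mult.assoc)

lemma supported_scalar: "supported I X \<Longrightarrow> supported I (scalar a * X :: 'r::ring lfmat)"
  unfolding supported_def by (metis ent_scalar_times mult_zero_right)

lemma supported_sum:
  "(\<And>x. x \<in> S \<Longrightarrow> supported I (f x)) \<Longrightarrow> supported I (\<Sum>x\<in>S. f x :: 'r::ring lfmat)"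
  by (induct S rule: infinite_finite_induct) (auto simp: supported_add)

lemma supported_munit: "i \<in> I \<Longrightarrow> j \<in> I \<Longrightarrow> supported I (munit i j :: 'r::{ring,monoid_mult} lfmat)"
  by (simp add: supported_def)

lemma supported_mono: "supported J X \<Longrightarrow> J \<subseteq> I \<Longrightarrow> supported I X"
  unfolding supported_def by blast

lemma ent_times_supported:
  assumes "finite I" "supported I X \<or> supported I Y"
  shows "ent (X * Y :: 'r::ring lfmat) i j = (\<Sum>k\<in>I. ent X i k * ent Y k j)"
  using assms by (intro ent_times) (auto dest: supported_ent)

subsection \<open>Adjoints and traces\<close>

lift_definition madj :: "'a::complex_hilbert bop lfmat \<Rightarrow> 'a bop lfmat" is "\<lambda>f i j. (f j i)\<^sup>\<star>"
proof (intro conjI allI)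
  fix f :: "nat \<Rightarrow> nat \<Rightarrow> 'a bop" and i
  assume *: "(\<forall>i. finite {j. f i j \<noteq> 0}) \<and> (\<forall>j. finite {i. f i j \<noteq> 0})"
  show "finite {j. (f j i)\<^sup>\<star> \<noteq> 0}"
    by (rule finite_subset[of _ "{j. f j i \<noteq> 0}"]) (use * in auto)
  show "finite {j. (f i j)\<^sup>\<star> \<noteq> 0}"
    by (rule finite_subset[of _ "{j. f i j \<noteq> 0}"]) (use * in auto)
qed

lemma ent_madj [simp]: "ent (madj X) i j = (ent X j i)\<^sup>\<star>" by (simp add: madj.rep_eq)

lemma madj_madj [simp]: "madj (madj X) = X" by (rule lfmat_eqI) simp

lemma madj_zero [simp]: "madj 0 = 0" by (rule lfmat_eqI) simp

lemma madj_one [simp]: "madj 1 = 1" by (rule lfmat_eqI) simp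

lemma madj_add: "madj (X + Y) = madj X + madj Y" by (rule lfmat_eqI) (simp add: adj_add)

lemma madj_diff: "madj (X - Y) = madj X - madj Y" by (rule lfmat_eqI) (simp add: adj_diff)

lemma madj_mult: "madj (X * Y) = madj Y * madj X"
proof (rule lfmat_eqI)
  fix i j
  have "ent (madj (X * Y)) i j = (\<Sum>k\<in>{k. ent X j k \<noteq> 0}. (ent Y k i)\<^sup>\<star> * (ent X j k)\<^sup>\<star>)"
    by (simp add: times_lfmat.rep_eq adj_simps)
  also have "\<dots> = ent (madj Y * madj X) i j"
    by (subst ent_times[of "{k. ent X j k \<noteq> 0}"]) (auto simp: finite_row)
  finally show "ent (madj (X * Y)) i j = ent (madj Y * madj X) i j" .
qed

lemma madj_scalar: "madj (scalar a) = scalar (a\<^sup>\<star>)" by (rule lfmat_eqI) auto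

lemma madj_munit: "madj (munit i j) = munit j i" by (rule lfmat_eqI) auto

lemma madj_index_proj: "madj (index_proj I) = index_proj I" by (rule lfmat_eqI) auto

lemma supported_madj: "supported I X \<Longrightarrow> supported I (madj X)"
  unfolding supported_def by (metis adj_zero ent_madj)

lemmas madj_simps = madj_mult madj_add madj_diff madj_scalar madj_munit madj_index_proj

definition tr :: "nat set \<Rightarrow> 'r::comm_monoid_add lfmat \<Rightarrow> 'r" where
  "tr I X = (\<Sum>i\<in>I. ent X i i)"

lemma tr_sum: "tr I (\<Sum>x\<in>S. f x) = (\<Sum>x\<in>S. tr I (f x :: 'r::ring lfmat))"
  unfolding tr_def ent_sum by (rule sum.swap)

lemma tr_scalar: "tr I (scalar a * X :: 'r::ring lfmat) = a * tr I X"
  by (simp add: tr_def sum_distrib_left)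

lemma tr_diff: "tr I (X - Y :: 'r::ring lfmat) = tr I X - tr I Y"
  by (simp add: tr_def sum_subtractf)

subsection \<open>Matrices over an abelian algebra\<close>

context abelian_vna
begin

definition full :: "'a bop lfmat set" where
  "full = {X. \<forall>i j. ent X i j \<in> A}"

lemma fullD: "X \<in> full \<Longrightarrow> ent X i j \<in> A"
  by (simp add: full_def)

lemma full_zero [simp]: "0 \<in> full" and full_one [simp]: "1 \<in> full"
  and full_add [simp]: "X \<in> full \<Longrightarrow> Y \<in> full \<Longrightarrow> X + Y \<in> full"
  and full_minus [simp]: "X \<in> full \<Longrightarrow> - X \<in> full"
  and full_diff [simp]: "X \<in> full \<Longrightarrow> Y \<in> full \<Longrightarrow> X - Y \<in> full"
  and full_scalar [simp]: "a \<in> A \<Longrightarrow> scalar a \<in> full"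
  and full_munit [simp]: "munit i j \<in> full"
  and full_index_proj [simp]: "index_proj I \<in> full"
  and full_madj [simp]: "X \<in> full \<Longrightarrow> madj X \<in> full"
  by (simp_all add: full_def)

lemma full_mult [simp]: "X \<in> full \<Longrightarrow> Y \<in> full \<Longrightarrow> X * Y \<in> full"
  by (simp add: full_def times_lfmat.rep_eq)

lemma full_power [simp]: "X \<in> full \<Longrightarrow> X ^ k \<in> full"
  by (induct k) auto

lemma full_sum [simp]: "(\<And>x. x \<in> S \<Longrightarrow> f x \<in> full) \<Longrightarrow> (\<Sum>x\<in>S. f x) \<in> full"
  by (induct S rule: infinite_finite_induct) auto

lemma scalar_comm: "X \<in> full \<Longrightarrow> a \<in> A \<Longrightarrow> X * scalar a = scalar a * X"
  by (rule lfmat_eqI) (simp add: comm fullD)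

lemma scalar_left_comm: "X \<in> full \<Longrightarrow> a \<in> A \<Longrightarrow> X * (scalar a * Y) = scalar a * (X * Y)"
  using scalar_comm[of X a] by (simp only: mult.assoc[symmetric])

definition mats :: "nat set \<Rightarrow> 'a bop lfmat set" where
  "mats I = {X \<in> full. supported I X}"

lemma matsD: "X \<in> mats I \<Longrightarrow> X \<in> full" "X \<in> mats I \<Longrightarrow> supported I X"
  by (simp_all add: mats_def)

lemma mats_ent [simp]: "X \<in> mats I \<Longrightarrow> ent X i j \<in> A"
  by (simp add: mats_def full_def)

lemma mats_left: "X \<in> mats I \<Longrightarrow> index_proj I * X = X"
  and mats_right: "X \<in> mats I \<Longrightarrow> X * index_proj I = X"
  by (simp_all add: mats_def supported_left supported_right)

lemma mats_zero [simp]: "0 \<in> mats I" and mats_index_proj [simp]: "index_proj I \<in> mats I"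
  and mats_add [simp]: "X \<in> mats I \<Longrightarrow> Y \<in> mats I \<Longrightarrow> X + Y \<in> mats I"
  and mats_diff [simp]: "X \<in> mats I \<Longrightarrow> Y \<in> mats I \<Longrightarrow> X - Y \<in> mats I"
  and mats_minus [simp]: "X \<in> mats I \<Longrightarrow> - X \<in> mats I"
  and mats_mult [simp]: "X \<in> mats I \<Longrightarrow> Y \<in> mats I \<Longrightarrow> X * Y \<in> mats I"
  and mats_scalar [simp]: "a \<in> A \<Longrightarrow> X \<in> mats I \<Longrightarrow> scalar a * X \<in> mats I"
  and mats_munit: "i \<in> I \<Longrightarrow> j \<in> I \<Longrightarrow> munit i j \<in> mats I"
  and mats_madj [simp]: "X \<in> mats I \<Longrightarrow> madj X \<in> mats I"
  and mats_sum [simp]: "(\<And>x. x \<in> S \<Longrightarrow> f x \<in> mats I) \<Longrightarrow> (\<Sum>x\<in>S. f x) \<in> mats I"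
  by (simp_all add: mats_def supported_add supported_diff supported_minus supported_mult
      supported_scalar supported_munit supported_madj supported_sum)

lemma mats_times_power: "X \<in> mats I \<Longrightarrow> Y \<in> mats I \<Longrightarrow> X * Y ^ k \<in> mats I"
  by (induct k) (auto simp: power_Suc2 simp del: power_Suc simp flip: mult.assoc)

lemma mats_power [simp]: "X \<in> mats I \<Longrightarrow> index_proj I * X ^ k \<in> mats I"
  by (rule mats_times_power) simp_all

lemma index_proj_power_comm:
  assumes "X \<in> mats I" shows "X ^ k * index_proj I = index_proj I * X ^ k"
proof (induct k)
  case (Suc k)
  have "X * X ^ k * index_proj I = X * index_proj I * X ^ k" by (simp add: mult.assoc Suc)
  also have "\<dots> = index_proj I * X * X ^ k" by (simp add: mats_left mats_right assms)
  finally show ?case by (simp add: mult.assoc)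
qed simp

lemma index_proj_power_Suc: "X \<in> mats I \<Longrightarrow> index_proj I * X ^ Suc k = X ^ Suc k"
  by (simp add: mats_left flip: mult.assoc)

lemma ent_times_mats:
  assumes "finite I" "X \<in> mats I \<or> Y \<in> mats I"
  shows "ent (X * Y) i j = (\<Sum>k\<in>I. ent X i k * ent Y k j)"
  using assms by (intro ent_times_supported) (auto simp: mats_def)

lemma tr_commute:
  assumes "finite I" "X \<in> mats I" "Y \<in> full"
  shows "tr I (X * Y) = tr I (Y * X)"
proof -
  have "tr I (X * Y) = (\<Sum>i\<in>I. \<Sum>k\<in>I. ent X i k * ent Y k i)"
    using assms by (simp add: tr_def ent_times_mats)
  also have "\<dots> = (\<Sum>k\<in>I. \<Sum>i\<in>I. ent X i k * ent Y k i)" by (rule sum.swap)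
  also have "\<dots> = (\<Sum>k\<in>I. \<Sum>i\<in>I. ent Y k i * ent X i k)"
    using assms by (intro sum.cong refl comm) (auto intro: fullD matsD)
  also have "\<dots> = tr I (Y * X)" using assms by (simp add: tr_def ent_times_mats)
  finally show ?thesis .
qed

lemma tr_in: "X \<in> full \<Longrightarrow> tr I X \<in> A"
  by (simp add: tr_def fullD)

end

section \<open>Unitary triangularisation of nilpotent matrices\<close>

context abelian_vna
begin

subsection \<open>Columns of length one\<close>

text \<open>A vector with entries in \<open>A\<close> is encoded as a matrix with the single nonzero column \<open>m\<close>, so that
  inner products become products of matrices. A length that is only a projection \<open>r\<close>, that is, one
  on a part of the spectrum and zero on the rest, allows vectors to be glued.\<close>

definition unit_column :: "nat \<Rightarrow> 'a bop \<Rightarrow> 'a bop lfmat \<Rightarrow> bool" where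
  "unit_column m r V \<longleftrightarrow> V \<in> full \<and> r \<in> A \<and> is_projection r \<and> V * munit m m = V \<and>
     madj V * V = scalar r * munit m m \<and> scalar r * V = V"

lemma unit_columnD:
  assumes "unit_column m r V"
  shows "V \<in> full" "r \<in> A" "is_projection r" "V * munit m m = V"
    "madj V * V = scalar r * munit m m" "scalar r * V = V" "r * r = r" "r\<^sup>\<star> = r"
  using assms by (auto simp: unit_column_def is_projection_def)

lemma munit_corner:
  "munit m m * X * munit m m = scalar (ent X m m) * (munit m m :: 'r::{ring,monoid_mult} lfmat)"
  by (rule lfmat_eqI) auto

lemma unit_column_annihilate:
  assumes "unit_column m r V" "z \<in> A" "scalar z * V = 0" shows "z * r = 0"
proof -
  have "scalar (z * r) * munit m m = madj V * (scalar z * V)"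
    using unit_columnD[OF assms(1)] assms(2) scalar_left_comm[of "madj V" z V]
    by (simp add: scalar_mult mult.assoc)
  then have "ent (scalar (z * r) * munit m m) m m = 0" by (simp add: assms(3))
  then show ?thesis by simp
qed

text \<open>Let \<open>s = (\<Sum> \<xi>\<^sub>k\<^sup>\<star> \<xi>\<^sub>k)\<^sup>1\<^sup>/\<^sup>2\<close> be the length of \<open>\<xi>\<close>. Each entry can be divided by \<open>s\<close> since
  \<open>\<parallel>\<xi>\<^sub>k x\<parallel> \<le> \<parallel>s x\<parallel>\<close>, and cutting the quotients down to the support \<open>r\<close> of \<open>s\<close> makes their length \<open>r\<close>.\<close>

lemma normalize_column:
  assumes \<xi>: "\<xi> \<in> full" "\<xi> * munit m m = \<xi>"
  shows "\<exists>V r s. unit_column m r V \<and> s \<in> A \<and> pos s \<and> \<xi> = scalar s * V \<and>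
    (\<forall>Y\<in>full. Y * \<xi> = 0 \<longrightarrow> Y * V = 0)"
proof -
  define K where "K = {k. ent \<xi> k m \<noteq> 0}"
  have fin: "finite K" by (simp add: K_def finite_column)
  define h where "h = (\<Sum>k\<in>K. (ent \<xi> k m)\<^sup>\<star> * ent \<xi> k m)"
  have \<xi>_in: "ent \<xi> k j \<in> A" for k j using \<xi>(1) by (rule fullD)
  have h: "h \<in> A" by (simp add: h_def \<xi>_in)
  have "pos (\<Sum>k\<in>S. (ent \<xi> k m)\<^sup>\<star> * ent \<xi> k m)" for S
    by (induct S rule: infinite_finite_induct) (auto intro: pos_add pos_adj_mult_self)
  then obtain s where s: "s \<in> A" "pos s" "s * s = h" using positive_sqrt[OF h] h_def by metis
  have norm_s: "(norm (s \<rhd> x))\<^sup>2 = (\<Sum>k\<in>K. (norm (ent \<xi> k m \<rhd> x))\<^sup>2)" for x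
  proof -
    have "(norm (s \<rhd> x))\<^sup>2 = Re (cinner (h \<rhd> x) x)"
      using norm_apply_squared[of s x] by (simp only: pos_adj[OF s(2)] s(3))
    also have "cinner (h \<rhd> x) x = (\<Sum>k\<in>K. cinner (((ent \<xi> k m)\<^sup>\<star> * ent \<xi> k m) \<rhd> x) x)"
    proof -
      have "cinner (\<Sum>k\<in>S. f k) y = (\<Sum>k\<in>S. cinner (f k) y)" for S :: "nat set" and f and y :: 'a
        by (induct S rule: infinite_finite_induct) (auto simp: cinner_add_left)
      then show ?thesis by (simp add: h_def)
    qed
    finally show ?thesis by (simp only: Re_sum norm_apply_squared)
  qed
  have "\<exists>c\<in>A. ent \<xi> k m = c * s" for k
  proof (rule division[where K = 1])
    fix x
    have "(norm (ent \<xi> k m \<rhd> x))\<^sup>2 \<le> (norm (s \<rhd> x))\<^sup>2"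
    proof (cases "k \<in> K")
      case True
      then show ?thesis unfolding norm_s
        using sum_mono2[OF fin, of "{k}" "\<lambda>k. (norm (ent \<xi> k m \<rhd> x))\<^sup>2"] by simp
    qed (simp add: K_def)
    then show "norm (ent \<xi> k m \<rhd> x) \<le> 1 * norm (s \<rhd> x)"
      using power2_le_imp_le[OF _ norm_ge_zero] by simp
  qed (use s \<xi>_in in auto)
  then obtain c where c: "\<And>k. c k \<in> A" "\<And>k. ent \<xi> k m = c k * s" by metis
  obtain r where r: "r \<in> A" "is_projection r" "r * s = s" "\<And>z. z \<in> A \<Longrightarrow> z * s = 0 \<Longrightarrow> z * r = 0"
    using support_projection[OF s(1)] by blast
  have r': "r * r = r" "r\<^sup>\<star> = r" using r(2) by (auto simp: is_projection_def)
  define V where "V = (\<Sum>k\<in>K. scalar (c k * r) * munit k m)"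
  have V: "V \<in> full" "V * munit m m = V" "scalar r * V = V"
  proof -
    show "V \<in> full" using c r by (simp add: V_def)
    show "V * munit m m = V" by (simp add: V_def sum_distrib_right mult.assoc munit_times)
    have "r * (c k * r) = c k * r" for k using left_comm[OF r(1) c(1)] r'(1) by simp
    then show "scalar r * V = V" by (simp add: V_def sum_distrib_left scalar_mult[symmetric] flip: mult.assoc)
  qed
  have \<xi>V: "\<xi> = scalar s * V"
  proof (rule lfmat_eqI)
    fix i j
    have "ent V i j = (if j = m \<and> i \<in> K then c i * r else 0)"
      using fin by (cases "j = m")
        (auto simp: V_def if_distrib[of "\<lambda>x. _ * x"] sum.delta cong: if_cong)
    moreover have "s * (c i * r) = ent \<xi> i m" for i
      using left_comm[OF s(1) c(1)] comm[OF s(1) r(1)] r(3) c(2) by simp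
    moreover have "ent \<xi> i j = 0" if "j \<noteq> m"
      using arg_cong[OF \<xi>(2), of "\<lambda>X. ent X i j"] that by simp
    ultimately show "ent \<xi> i j = ent (scalar s * V) i j" by (auto simp: K_def)
  qed
  define g where "g = ent (madj V * V) m m"
  have g: "g \<in> A" using V(1) by (simp add: g_def fullD)
  have VV: "madj V * V = scalar g * munit m m"
  proof -
    have "munit m m * madj V = madj V" using arg_cong[OF V(2), of madj] by (simp add: madj_simps)
    moreover have "munit m m * (madj V * V) * munit m m = (munit m m * madj V) * (V * munit m m)"
      by (simp only: mult.assoc)
    ultimately have "madj V * V = munit m m * (madj V * V) * munit m m" by (simp add: V(2))
    also have "\<dots> = scalar g * munit m m" by (simp only: munit_corner g_def)
    finally show ?thesis .
  qed
  have "s * s = g * (s * s)"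
  proof -
    have "ent (madj \<xi> * \<xi>) m m = h"
      using fin by (subst ent_times[of K]) (auto simp: h_def K_def)
    moreover have "madj \<xi> * \<xi> = scalar (s * (s * g)) * munit m m"
    proof -
      have "madj V * (scalar s * V) = scalar s * (madj V * V)" by (rule scalar_left_comm) (use V s in auto)
      then show ?thesis
        using V(1) s scalar_comm[of "madj V" s]
        by (simp add: \<xi>V madj_simps pos_adj mult.assoc VV scalar_mult)
    qed
    ultimately have "s * s = s * (s * g)" by (simp add: s(3))
    also have "\<dots> = g * (s * s)" using comm[OF g, of "s * s"] s(1) by (simp add: mult.assoc)
    finally show ?thesis .
  qed
  then have "(g - r) * s * s = 0" using r(3) by (simp add: algebra_simps flip: mult.assoc)
  then have "(g - r) * s * r = 0" using r(4)[of "(g - r) * s"] g r(1) s(1) by simp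
  then have "(g - r) * s = 0" using comm[OF s(1) r(1)] r(3) by (simp add: mult.assoc)
  then have "(g - r) * r = 0" using r(4)[of "g - r"] g r(1) by simp
  then have "g * r = r" using r'(1) by (simp add: algebra_simps)
  moreover have "r * g = g"
  proof -
    have "scalar r * (madj V * V) = madj V * V"
      using scalar_left_comm[of "madj V" r V] V r by simp
    from arg_cong[OF this, of "\<lambda>X. ent X m m"] show ?thesis by (simp add: g_def)
  qed
  ultimately have "g = r" using comm[OF g r(1)] by simp
  then have "unit_column m r V" using V r VV by (simp add: unit_column_def)
  moreover have "Y * V = 0" if Y: "Y \<in> full" "Y * \<xi> = 0" for Y
  proof (rule lfmat_eqI)
    fix i j
    have in_A: "ent (Y * V) i j \<in> A" using Y V by (simp add: fullD)
    have "scalar s * (Y * V) = 0" using Y scalar_left_comm[OF Y(1) s(1)] by (simp add: \<xi>V)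
    from arg_cong[OF this, of "\<lambda>X. ent X i j"] have "ent (Y * V) i j * s = 0"
      using comm[OF in_A s(1)] by simp
    then have "ent (Y * V) i j * r = 0" by (rule r(4)[OF in_A])
    moreover have "scalar r * (Y * V) = Y * V" using scalar_left_comm[OF Y(1) r(1), of V] V(3) by simp
    from arg_cong[OF this, of "\<lambda>X. ent X i j"] have "ent (Y * V) i j * r = ent (Y * V) i j"
      using comm[OF in_A r(1)] by simp
    ultimately show "ent (Y * V) i j = ent 0 i j" by simp
  qed
  ultimately show ?thesis using s \<xi>V by blast
qed

lemma unit_column_zero: "unit_column m 0 0"
  by (simp add: unit_column_def is_projection_def)

lemma unit_column_restrict:
  assumes "unit_column m r V" "e \<in> A" "is_projection e"
  shows "unit_column m (r * e) (scalar e * V)"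
proof -
  note V = unit_columnD[OF assms(1)]
  have e: "e * e = e" "e\<^sup>\<star> = e" using assms(3) by (auto simp: is_projection_def)
  have e_er: "e * (e * r) = e * r" by (simp add: e(1) flip: mult.assoc)
  have "madj (scalar e * V) * (scalar e * V) = scalar (r * e) * munit m m"
  proof -
    have "madj (scalar e * V) * (scalar e * V) = madj V * (scalar e * (scalar e * V))"
      by (simp add: madj_simps e(2) mult.assoc)
    also have "\<dots> = scalar e * (scalar e * (madj V * V))"
      using V assms(2) scalar_left_comm[of "madj V" e V] scalar_left_comm[of "madj V" e "scalar e * V"]
      by simp
    also have "\<dots> = scalar (r * e) * munit m m"
      using V(5) e_er comm[OF V(2) assms(2)] by (simp flip: mult.assoc scalar_mult)
    finally show ?thesis .
  qed
  moreover have "scalar (r * e) * (scalar e * V) = scalar e * V"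
  proof -
    have "r * e * e = e * r" using comm[OF V(2) assms(2)] e e_er by (simp add: mult.assoc)
    then have "scalar (r * e) * (scalar e * V) = scalar (e * r) * V"
      by (simp flip: mult.assoc scalar_mult)
    then show ?thesis by (simp add: scalar_mult mult.assoc V(6))
  qed
  ultimately show ?thesis
    using V assms(2) is_projection_mult[OF V(2) assms(2) V(3) assms(3)]
    by (simp add: unit_column_def mult.assoc)
qed

lemma unit_column_add:
  assumes "unit_column m r V" "unit_column m r' V'" "r * r' = 0"
  shows "unit_column m (r + r') (V + V')"
proof -
  note V = unit_columnD[OF assms(1)]
  note V' = unit_columnD[OF assms(2)]
  have r'r: "r' * r = 0" using comm[OF V(2) V'(2)] assms(3) by simp
  have cross: "madj W * W' = 0" if "W \<in> full" "W' \<in> full" "scalar p * W = W" "scalar p' * W' = W'"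
     "p \<in> A" "p' \<in> A" "p\<^sup>\<star> = p" "p * p' = 0" for W W' p p'
  proof -
    have "madj W * scalar p = madj W" using arg_cong[OF that(3), of madj] that(7) by (simp add: madj_simps)
    then have "madj W * W' = madj W * (scalar p * (scalar p' * W'))"
      by (simp add: that(4) flip: mult.assoc)
    also have "scalar p * (scalar p' * W') = 0"
      by (simp add: that(8) flip: mult.assoc scalar_mult)
    finally show ?thesis by simp
  qed
  have "scalar r * (scalar r' * V') = 0" "scalar r' * (scalar r * V) = 0"
    by (simp_all add: assms(3) r'r flip: mult.assoc scalar_mult)
  then have "scalar r * V' = 0" "scalar r' * V = 0" by (simp_all add: V(6) V'(6))
  moreover have "madj V * V' = 0" "madj V' * V = 0"
    by (rule cross[of _ _ r r'], use V V' assms(3) in auto)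
      (rule cross[of _ _ r' r], use V V' r'r in auto)
  moreover have "is_projection (r + r')"
    using V V' assms(3) r'r by (simp add: is_projection_def adj_simps algebra_simps)
  ultimately show ?thesis
    using V V' by (simp add: unit_column_def madj_simps algebra_simps scalar_add)
qed

text \<open>The next column is normalised where the earlier ones vanish, and the results are added. The last
  conclusion says that the normalised column lies in every kernel that contains the given columns.\<close>

lemma normalize_columns:
  assumes "finite S" "\<And>i. i \<in> S \<Longrightarrow> \<xi> i \<in> full" "\<And>i. i \<in> S \<Longrightarrow> \<xi> i * munit m m = \<xi> i"
  shows "\<exists>V r. unit_column m r V \<and> (\<forall>i\<in>S. scalar r * \<xi> i = \<xi> i) \<and>
    (\<forall>Y\<in>full. (\<forall>i\<in>S. Y * \<xi> i = 0) \<longrightarrow> Y * V = 0)"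
  using assms
proof (induct S rule: finite_induct)
  case empty
  then show ?case using unit_column_zero by fastforce
next
  case (insert k S)
  then obtain V r where V: "unit_column m r V" "\<And>i. i \<in> S \<Longrightarrow> scalar r * \<xi> i = \<xi> i"
    "\<And>Y. Y \<in> full \<Longrightarrow> \<forall>i\<in>S. Y * \<xi> i = 0 \<Longrightarrow> Y * V = 0" by blast
  note V' = unit_columnD[OF V(1)]
  define \<eta> where "\<eta> = scalar (1 - r) * \<xi> k"
  have \<eta>: "\<eta> \<in> full" "\<eta> * munit m m = \<eta>"
    using insert.prems V' by (simp_all add: \<eta>_def mult.assoc)
  obtain W p s where W: "unit_column m p W" "s \<in> A" "\<eta> = scalar s * W"
    "\<And>Y. Y \<in> full \<Longrightarrow> Y * \<eta> = 0 \<Longrightarrow> Y * W = 0"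
    using normalize_column[OF \<eta>] by blast
  note W' = unit_columnD[OF W(1)]
  have "scalar r * \<eta> = 0"
    using V'(7) by (simp add: \<eta>_def algebra_simps flip: mult.assoc scalar_mult)
  then have "scalar r * W = 0" by (intro W(4)) (use V' in simp)
  then have rp: "r * p = 0" by (rule unit_column_annihilate[OF W(1) V'(2)])
  have p_\<eta>: "scalar p * \<eta> = \<eta>"
    using W'(6) scalar_left_comm[OF full_scalar[OF W'(2)] W(2), of W] by (simp add: W(3))
  have "scalar (r + p) * \<xi> i = \<xi> i" if "i \<in> insert k S" for i
  proof (cases "i = k")
    case True
    have "scalar p * \<eta> = scalar p * \<xi> k"
      using comm[OF V'(2) W'(2)] rp by (simp add: \<eta>_def algebra_simps flip: mult.assoc scalar_mult)
    then show ?thesis using p_\<eta> True by (simp add: \<eta>_def scalar_add scalar_diff algebra_simps)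
  next
    case False
    then have "scalar r * \<xi> i = \<xi> i" using that V(2) by simp
    moreover have "scalar p * (scalar r * \<xi> i) = 0"
      using comm[OF V'(2) W'(2)] rp by (simp flip: mult.assoc scalar_mult)
    ultimately show ?thesis by (simp add: scalar_add distrib_right)
  qed
  moreover have "Y * (V + W) = 0" if Y: "Y \<in> full" "\<And>i. i \<in> insert k S \<Longrightarrow> Y * \<xi> i = 0" for Y
  proof -
    have "Y * \<eta> = 0" using Y V' scalar_left_comm[OF Y(1), of "1 - r" "\<xi> k"] by (simp add: \<eta>_def)
    then show ?thesis using V(3)[OF Y(1)] W(4)[OF Y(1)] Y(2) by (simp add: distrib_left)
  qed
  ultimately show ?case using unit_column_add[OF V(1) W(1) rp] by blast
qed

text \<open>The kernel of a nilpotent matrix contains a column of length one: on the support of \<open>N^k\<close>,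
  where \<open>N^(k+1) = 0\<close>, it is made from the columns of \<open>N^k\<close>, and on the complement the exponent is
  smaller.\<close>

lemma kernel_column:
  assumes N: "N \<in> mats I" and fin: "finite I" and m: "m \<in> I"
    and e: "e \<in> A" "is_projection e" "scalar e * (index_proj I * N ^ k) = 0"
  shows "\<exists>V. unit_column m e V \<and> N * V = 0 \<and> index_proj I * V = V"
  using e
proof (induct k arbitrary: e)
  case 0
  from arg_cong[OF 0(3), of "\<lambda>X. ent X m m"] have "e = 0" using m by simp
  then show ?case using unit_column_zero by force
next
  case (Suc k)
  define \<xi> where "\<xi> i = scalar e * (index_proj I * N ^ k) * munit i m" for i
  have P: "index_proj I * N ^ k \<in> mats I" by (rule mats_power[OF N])
  have \<xi>: "\<xi> i \<in> full" "\<xi> i * munit m m = \<xi> i" for i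
    using matsD(1)[OF P] Suc.prems(1) by (simp_all add: \<xi>_def mult.assoc munit_times matsD[OF N])
  obtain V r where V: "unit_column m r V" "\<And>i. i \<in> I \<Longrightarrow> scalar r * \<xi> i = \<xi> i"
    "\<And>Y. Y \<in> full \<Longrightarrow> \<forall>i\<in>I. Y * \<xi> i = 0 \<Longrightarrow> Y * V = 0"
    using normalize_columns[OF fin, of \<xi> m] \<xi> by blast
  note V' = unit_columnD[OF V(1)]
  have "N * \<xi> i = 0" for i
  proof -
    have "N * (index_proj I * N ^ k) = index_proj I * N ^ Suc k"
      using N by (simp add: mats_left mats_right flip: mult.assoc)
    moreover have "scalar e * (index_proj I * N ^ Suc k) * munit i m = 0"
      by (simp only: Suc.prems(3) mult_zero_left)
    ultimately have "scalar e * ((N * (index_proj I * N ^ k)) * munit i m) = 0"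
      by (simp only: mult.assoc)
    then show ?thesis
      using scalar_left_comm[OF matsD(1)[OF N] Suc.prems(1)] by (simp add: \<xi>_def mult.assoc)
  qed
  then have NV: "N * V = 0" using V(3) matsD(1)[OF N] by blast
  have "index_proj I * (scalar e * (index_proj I * Y)) = scalar e * (index_proj I * Y)"
    for Y :: "'a bop lfmat" by (rule lfmat_eqI) simp
  then have "(1 - index_proj I) * \<xi> i = 0" for i
    by (simp add: \<xi>_def mult.assoc left_diff_distrib)
  then have "(1 - index_proj I) * V = 0" using V(3)[of "1 - index_proj I"] by simp
  then have PV: "index_proj I * V = V" by (simp add: algebra_simps)
  define f where "f = e * (1 - r)"
  have f: "f \<in> A" "is_projection f"
    using V' Suc.prems is_projection_mult[OF _ _ _ is_projection_complement[OF V'(3)]]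
    by (simp_all add: f_def)
  have "scalar f * (index_proj I * N ^ k) = 0"
  proof (rule lfmat_eqI)
    fix a b
    show "ent (scalar f * (index_proj I * N ^ k)) a b = ent 0 a b"
    proof (cases "b \<in> I")
      case True
      have "ent (\<xi> b) a m = e * ent (index_proj I * N ^ k) a b"
        by (simp add: \<xi>_def del: ent_index_proj_times)
      moreover have "r * ent (\<xi> b) a m = ent (\<xi> b) a m"
        using arg_cong[OF V(2)[OF True], of "\<lambda>X. ent X a m"] by simp
      ultimately have "(1 - r) * (e * ent (index_proj I * N ^ k) a b) = 0"
        by (simp add: algebra_simps)
      then show ?thesis
        using comm[of e "1 - r"] V'(2) Suc.prems(1) by (simp add: f_def mult.assoc del: ent_index_proj_times)
    next
      case False
      then show ?thesis using supported_ent[OF matsD(2)[OF P], of a b] by (simp del: ent_index_proj_times)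
    qed
  qed
  from Suc.hyps[OF f this] obtain W where W: "unit_column m f W" "N * W = 0" "index_proj I * W = W"
    by blast
  have "r * e * f = 0"
    using V' Suc.prems(1) left_comm[of r e] comm[of r e]
    by (simp add: f_def algebra_simps) 
  from unit_column_add[OF unit_column_restrict[OF V(1) Suc.prems(1,2)] W(1) this]
  have "unit_column m e (scalar e * V + W)"
    using comm[OF V'(2) Suc.prems(1)] by (simp add: f_def algebra_simps)
  moreover have "N * (scalar e * V + W) = 0"
    using NV W scalar_left_comm[OF matsD(1)[OF N] Suc.prems(1)] by (simp add: distrib_left)
  moreover have "index_proj I * (scalar e * V + W) = scalar e * V + W"
    using PV W scalar_left_comm[of "index_proj I" e] Suc.prems(1) by (simp add: distrib_left)
  ultimately show ?case by blast
qed

end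

context abelian_vna
begin

subsection \<open>Householder reflections\<close>

lemma polar_decomposition:
  assumes v: "v \<in> A"
  shows "\<exists>\<omega>\<in>A. \<exists>g\<in>A. \<omega>\<^sup>\<star> * \<omega> = 1 \<and> pos g \<and> v = \<omega> * g"
proof -
  obtain g where g: "g \<in> A" "pos g" "g * g = v\<^sup>\<star> * v"
    using positive_sqrt[OF _ pos_adj_mult_self[of v]] v by auto
  have "(norm (v \<rhd> x))\<^sup>2 = (norm (g \<rhd> x))\<^sup>2" for x
    by (simp only: norm_apply_squared pos_adj[OF g(2)] g(3))
  then have "norm (v \<rhd> x) \<le> 1 * norm (g \<rhd> x)" for x by (simp add: power2_eq_iff_nonneg)
  then obtain c where c: "c \<in> A" "v = c * g" using division[OF v g(1), of 1] by auto
  obtain p where p: "p \<in> A" "is_projection p" "p * g = g" "\<And>z. z \<in> A \<Longrightarrow> z * g = 0 \<Longrightarrow> z * p = 0"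
    using support_projection[OF g(1)] by blast
  have p': "p * p = p" "p\<^sup>\<star> = p" using p(2) by (simp_all add: is_projection_def)
  have pp: "p * (p * x) = p * x" for x by (simp add: p'(1) flip: mult.assoc)
  have in_A: "c\<^sup>\<star> \<in> A" "1 - p \<in> A" "c\<^sup>\<star> * c - 1 \<in> A" using c(1) p(1) by simp_all
  have "g * g = g * (c\<^sup>\<star> * (c * g))" using g(3) pos_adj[OF g(2)] by (simp add: c(2) adj_mult mult.assoc)
  also have "\<dots> = c\<^sup>\<star> * (c * (g * g))"
    using left_comm[OF g(1) in_A(1), of "c * g"] left_comm[OF g(1) c(1), of g] by simp
  finally have "(c\<^sup>\<star> * c - 1) * g * g = 0" by (simp add: algebra_simps)
  then have "(c\<^sup>\<star> * c - 1) * g * p = 0" using p(4)[of "(c\<^sup>\<star> * c - 1) * g"] in_A g(1) by simp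
  then have "(c\<^sup>\<star> * c - 1) * g = 0" using comm[OF g(1) p(1)] p(3) by (simp add: mult.assoc)
  then have "(c\<^sup>\<star> * c - 1) * p = 0" by (rule p(4)[OF in_A(3)])
  then have ccp: "c\<^sup>\<star> * (c * p) = p" by (simp add: algebra_simps)
  \<comment> \<open>The quotient \<open>c\<close> is unitary on the support \<open>p\<close> of \<open>g\<close> and is completed by \<open>1\<close>.\<close>
  define \<omega> where "\<omega> = c * p + (1 - p)"
  have cp: "c * p = p * c" "c\<^sup>\<star> * p = p * c\<^sup>\<star>" "c\<^sup>\<star> * (p * x) = p * (c\<^sup>\<star> * x)" for x
    using comm p(1) c(1) in_A(1) left_comm by auto
  have "\<omega>\<^sup>\<star> * \<omega> = 1"
  proof -
    have "\<omega>\<^sup>\<star> * \<omega> = (c\<^sup>\<star> * p + (1 - p)) * (c * p + (1 - p))"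
      by (simp add: \<omega>_def adj_simps p' cp)
    also have "\<dots> = c\<^sup>\<star> * (p * (c * p)) + (1 - p)"
      by (simp add: algebra_simps p' pp cp)
    also have "p * (c * p) = c * p" by (simp add: cp pp)
    finally show ?thesis by (simp add: ccp)
  qed
  moreover have "v = \<omega> * g" by (simp add: \<omega>_def c(2) distrib_right mult.assoc p(3) left_diff_distrib)
  moreover have "\<omega> \<in> A" using c p by (simp add: \<omega>_def)
  ultimately show ?thesis using g by blast
qed

text \<open>The reflection \<open>1 - 2 x x\<^sup>\<star> / (x\<^sup>\<star> x)\<close> in \<open>x = V + \<omega> e\<^sub>m\<close>, where \<open>\<omega>\<close> is the phase of the entry
  \<open>\<omega> g\<close> of \<open>V\<close> at \<open>m\<close>, exchanges \<open>V\<close> and \<open>- \<omega> e\<^sub>m\<close>. The choice of the sign makes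
  \<open>x\<^sup>\<star> x = 2 (1 + g)\<close> invertible.\<close>

lemma householder:
  assumes V: "unit_column m 1 V"
  shows "\<exists>H u. H \<in> full \<and> madj H = H \<and> H * H = 1 \<and> u \<in> A \<and> H * munit m m = scalar u * V \<and>
    (\<forall>I. m \<in> I \<longrightarrow> index_proj I * V = V \<longrightarrow> supported I (H - 1))"
proof -
  note V' = unit_columnD[OF V]
  define E where "E = (munit m m :: 'a bop lfmat)"
  define v where "v = ent V m m"
  have v: "v \<in> A" using V'(1) by (simp add: v_def fullD)
  have E: "E \<in> full" "E * E = E" "madj E = E" "V * E = V" "madj V * V = E"
    using V' by (simp_all add: E_def munit_times madj_simps)
  have Ea: "E * scalar a = scalar a * E" for a by (simp add: E_def munit_scalar)
  obtain \<omega> g where \<omega>: "\<omega> \<in> A" "\<omega>\<^sup>\<star> * \<omega> = 1" and g: "g \<in> A" "pos g" and v_eq: "v = \<omega> * g"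
    using polar_decomposition[OF v] by blast
  have g_adj: "g\<^sup>\<star> = g" by (rule pos_adj[OF g(2)])
  define s where "s = 1 + g"
  have s: "s \<in> A" "s\<^sup>\<star> = s" using g by (simp_all add: s_def adj_simps g_adj)
  have "norm (1 \<rhd> x) \<le> 1 * norm (s \<rhd> x)" for x
  proof -
    have "(norm (s \<rhd> x))\<^sup>2 = (norm x)\<^sup>2 + 2 * Re (cinner (g \<rhd> x) x) + (norm (g \<rhd> x))\<^sup>2"
      by (simp add: s_def norm_add_squared Re_cinner_commute[of x])
    then have "(norm x)\<^sup>2 \<le> (norm (s \<rhd> x))\<^sup>2" using posD[OF g(2), of x] by simp
    then show ?thesis using power2_le_imp_le[of "norm x" "norm (s \<rhd> x)"] by simp
  qed
  then obtain d where d: "d \<in> A" "d * s = 1" using division[OF one_in s(1)] by (metis zero_le_one)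
  have d_adj: "d\<^sup>\<star> = d"
  proof -
    have "s * d\<^sup>\<star> = 1" using arg_cong[OF d(2), of bop_adj] by (simp add: adj_mult s)
    then have "d * (s * d\<^sup>\<star>) = d" by simp
    then show ?thesis by (simp add: d(2) flip: mult.assoc)
  qed
  define X where "X = V + scalar \<omega> * E"
  have X: "X \<in> full" "X * E = X" using V'(1) E \<omega>(1) by (simp_all add: X_def distrib_right mult.assoc)
  have EV: "E * V = scalar v * E"
    using munit_corner[of m V] E(4) by (simp add: E_def v_def mult.assoc)
  have vs: "v + \<omega> = \<omega> * s" by (simp add: v_eq s_def distrib_left add.commute)
  have EX: "E * X = scalar (\<omega> * s) * E"
    by (simp add: X_def distrib_left EV E Ea vs[symmetric] scalar_add distrib_right flip: mult.assoc)
      (simp add: mult.assoc E)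
  have XE: "madj X * E = scalar (s * \<omega>\<^sup>\<star>) * E"
    using arg_cong[OF EX, of madj] by (simp add: madj_simps E Ea adj_simps s)
  have XV: "madj X * V = scalar s * E"
  proof -
    have "madj X * V = madj V * V + scalar (\<omega>\<^sup>\<star>) * (E * V)"
      by (simp add: X_def madj_simps E(3) distrib_right Ea mult.assoc)
    also have "\<dots> = E + scalar (\<omega>\<^sup>\<star> * v) * E" by (simp add: E EV scalar_mult mult.assoc)
    also have "\<omega>\<^sup>\<star> * v = g" by (simp add: v_eq \<omega>(2) flip: mult.assoc)
    finally show ?thesis by (simp add: s_def scalar_add distrib_right)
  qed
  have XX: "madj X * X = scalar (s + s) * E"
  proof -
    have "madj X * X = madj X * V + scalar \<omega> * (madj X * E)"
      using X(1) \<omega>(1) scalar_left_comm[of "madj X" \<omega> E] by (simp add: X_def[of] distrib_left)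
    also have "\<dots> = scalar s * E + scalar (\<omega> * (s * \<omega>\<^sup>\<star>)) * E"
      by (simp add: XV XE scalar_mult mult.assoc)
    also have "\<omega> * (s * \<omega>\<^sup>\<star>) = s"
      using left_comm[OF \<omega>(1) s(1), of "\<omega>\<^sup>\<star>"] comm[of \<omega> "\<omega>\<^sup>\<star>"] \<omega> by simp
    finally show ?thesis by (simp add: scalar_add distrib_right)
  qed
  define W where "W = X * madj X"
  have W: "W \<in> full" "madj W = W" using X by (simp_all add: W_def madj_simps)
  have WW: "W * W = scalar (s + s) * W"
  proof -
    have "W * W = X * (madj X * X) * madj X" by (simp add: W_def mult.assoc)
    also have "\<dots> = scalar (s + s) * (X * E * madj X)"
      using scalar_left_comm[OF X(1), of "s + s"] s(1) by (simp add: XX mult.assoc)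
    finally show ?thesis by (simp add: X(2) W_def)
  qed
  define H where "H = 1 - scalar d * W"
  have "H \<in> full" using W d by (simp add: H_def)
  moreover have "madj H = H"
    using scalar_comm[OF W(1) d(1)] by (simp add: H_def madj_simps W d_adj)
  moreover have "H * H = 1"
  proof -
    have "scalar d * W * (scalar d * W) = scalar (d * d) * (W * W)"
      using scalar_left_comm[OF W(1) d(1), of W] by (simp add: scalar_mult mult.assoc)
    also have "\<dots> = scalar (d * (d * (s + s))) * W" by (simp add: WW scalar_mult mult.assoc)
    also have "d * (d * (s + s)) = d + d" by (simp add: distrib_left d(2))
    finally show ?thesis by (simp add: H_def algebra_simps scalar_add)
  qed
  moreover have "H * munit m m = scalar (- \<omega>\<^sup>\<star>) * V"
  proof -
    have "scalar d * W * E = scalar (d * (s * \<omega>\<^sup>\<star>)) * X"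
      using scalar_left_comm[OF X(1), of "s * \<omega>\<^sup>\<star>" E] s(1) \<omega>(1)
      by (simp add: W_def mult.assoc XE X(2) scalar_mult)
    also have "d * (s * \<omega>\<^sup>\<star>) = \<omega>\<^sup>\<star>" by (simp add: d(2) flip: mult.assoc)
    also have "scalar (\<omega>\<^sup>\<star>) * X = scalar (\<omega>\<^sup>\<star>) * V + E"
      by (simp add: X_def distrib_left \<omega>(2) flip: mult.assoc scalar_mult)
    finally show ?thesis by (simp add: H_def E_def[symmetric] left_diff_distrib scalar_minus)
  qed
  moreover have "supported I (H - 1)" if I: "m \<in> I" "index_proj I * V = V" for I
  proof -
    have "index_proj I * E = E" using I(1) unfolding E_def by (intro lfmat_eqI) auto
    then have "index_proj I * X = X"
      using I(2) index_proj_scalar[of I \<omega>] by (simp add: X_def distrib_left) (simp flip: mult.assoc, simp add: mult.assoc)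
    then have "index_proj I * W = W" by (simp add: W_def flip: mult.assoc)
    then have "supported I W" using arg_cong[of _ _ madj] W(2) unfolding supported_iff
      by (metis madj_index_proj madj_mult)
    then have "supported I (- (scalar d * W))" by (intro supported_minus supported_scalar)
    then show ?thesis by (simp add: H_def)
  qed
  ultimately show ?thesis using \<omega>(1) by (intro exI[of _ H] exI[of _ "- \<omega>\<^sup>\<star>"]) simp
qed

subsection \<open>Schur's theorem for nilpotent matrices\<close>

text \<open>A column of length one in the kernel is moved to the first coordinate by a reflection. The
  first column then vanishes, and the remaining block is again nilpotent.\<close>

lemma nilpotent_triangularization:
  assumes "N \<in> mats {m..<n}" "N ^ Suc k = 0"
  shows "\<exists>U\<in>full. madj U * U = 1 \<and> U * madj U = 1 \<and> supported {m..<n} (U - 1) \<and>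
    (\<forall>i j. j \<le> i \<longrightarrow> ent (madj U * N * U) i j = 0)"
  using assms
proof (induct "n - m" arbitrary: m N)
  case 0
  then have "N = 0" using matsD(2)[OF "0.prems"(1)] by (intro lfmat_eqI) (auto simp: supported_ent)
  then show ?case by (intro bexI[of _ 1]) auto
next
  case (Suc l)
  define I where "I = {m..<n}"
  define J where "J = {Suc m..<n}"
  have m: "m \<in> I" using Suc.hyps(2) by (auto simp: I_def)
  have N: "N \<in> mats I" and fin: "finite I" using Suc.prems by (simp_all add: I_def)
  define E where "E = (munit m m :: 'a bop lfmat)"
  define q where "q = (index_proj J :: 'a bop lfmat)"
  have PEq: "index_proj I = E + q"
    using m by (intro lfmat_eqI) (auto simp: E_def q_def I_def J_def)
  have "scalar 1 * (index_proj I * N ^ Suc k) = 0" by (simp only: Suc.prems(2)) simp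
  then obtain V where V: "unit_column m 1 V" "N * V = 0" "index_proj I * V = V"
    using kernel_column[OF N fin m, of 1 "Suc k"] by (auto simp: is_projection_def)
  obtain H u where H: "H \<in> full" "madj H = H" "H * H = 1" "u \<in> A" "H * E = scalar u * V"
    "supported I (H - 1)"
    using householder[OF V(1)] V(3) m unfolding E_def by blast
  have HX: "supported I (H * X)" if "supported I X" for X
    using supported_add[OF supported_mult[OF H(6) that] that] by (simp add: left_diff_distrib)
  have XH: "supported I (X * H)" if "supported I X" for X
    using supported_add[OF supported_mult[OF that H(6)] that] by (simp add: right_diff_distrib)
  define M where "M = H * N * H"
  have M: "M \<in> mats I" using N H(1) by (auto simp: M_def mats_def intro: HX XH)
  have ME: "M * E = 0"
    using V(2) scalar_left_comm[OF matsD(1)[OF N] H(4), of V] by (simp add: M_def mult.assoc H(5))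
  have Mq: "M * q = M" using mats_right[OF M] ME by (simp add: PEq distrib_left)
  have M_pow: "M ^ Suc j = H * N ^ Suc j * H" for j
  proof (induct j)
    case (Suc j)
    have "M ^ Suc (Suc j) = (H * N ^ Suc j * H) * (H * N * H)"
      by (simp only: power_Suc2[of M "Suc j"] Suc) (simp add: M_def)
    also have "\<dots> = H * N ^ Suc j * (H * H) * N * H" by (simp add: mult.assoc)
    also have "\<dots> = H * (N ^ Suc j * N) * H" by (simp add: H(3) mult.assoc)
    finally show ?case by (simp only: power_Suc2[of N "Suc j"])
  qed (simp add: M_def)
  have qM_pow: "(q * M) ^ Suc j = q * M ^ Suc j" for j
  proof (induct j)
    case (Suc j)
    have "(q * M) ^ Suc (Suc j) = q * M ^ Suc j * (q * M)"
      by (simp only: power_Suc2[of "q * M" "Suc j"] Suc)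
    also have "M ^ Suc j * q = M ^ Suc j"
      by (simp only: power_Suc2 mult.assoc Mq)
    then have "q * M ^ Suc j * (q * M) = q * (M ^ Suc j * M)" by (metis mult.assoc)
    finally show ?case by (simp only: power_Suc2[of M "Suc j"])
  qed simp
  have "supported J (q * M)"
    unfolding supported_iff using Mq by (simp add: q_def mult.assoc flip: mult.assoc[of "index_proj J"])
  then have "q * M \<in> mats J" using M by (simp add: mats_def q_def)
  moreover have "(q * M) ^ Suc k = 0" unfolding qM_pow M_pow Suc.prems(2) by simp
  moreover have "l = n - Suc m" using Suc.hyps(2) by simp
  ultimately obtain U where U: "U \<in> full" "madj U * U = 1" "U * madj U = 1" "supported J (U - 1)"
    "\<And>i j. j \<le> i \<Longrightarrow> ent (madj U * (q * M) * U) i j = 0"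
    using Suc.hyps(1)[of "Suc m" "q * M"] unfolding J_def by blast
  have U_ent: "ent U i j = (if i = j then 1 else 0)" if "i \<notin> J \<or> j \<notin> J" for i j
    using supported_ent[OF U(4) that] by (auto split: if_splits)
  define W where "W = H * U"
  have "W \<in> full" using H U by (simp add: W_def)
  moreover have "madj W * W = 1"
  proof -
    have "madj W * W = madj U * (H * H) * U" by (simp add: W_def madj_simps H(2) mult.assoc)
    then show ?thesis by (simp add: H(3) U(2))
  qed
  moreover have "W * madj W = 1"
  proof -
    have "W * madj W = H * (U * madj U) * H" by (simp add: W_def madj_simps H(2) mult.assoc)
    then show ?thesis by (simp add: H(3) U(3))
  qed
  moreover have "supported I (W - 1)"
  proof -
    have W1: "W - 1 = H * (U - 1) + (H - 1)" by (simp add: W_def algebra_simps)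
    have "supported I (U - 1)" by (rule supported_mono[OF U(4)]) (auto simp: I_def J_def)
    then show ?thesis unfolding W1 by (intro supported_add HX H(6))
  qed
  moreover have "ent (madj W * N * W) i j = 0" if "j \<le> i" for i j
  proof -
    have "madj U * E = E"
      by (rule lfmat_eqI) (auto simp: E_def U_ent J_def)
    have "madj W * N * W = madj U * M * U" by (simp add: W_def M_def madj_simps H(2) mult.assoc)
    also have "M = E * M + q * M" using mats_left[OF M] by (simp add: PEq distrib_right)
    also have "madj U * (E * M + q * M) * U = E * (M * U) + madj U * (q * M) * U"
      using \<open>madj U * E = E\<close> by (simp add: distrib_left distrib_right flip: mult.assoc)
    finally have "ent (madj W * N * W) i j = (if i = m then ent (M * U) m j else 0)"
      using U(5)[OF that] by (simp add: E_def)
    also have "\<dots> = 0"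
    proof (cases "i = m")
      case True
      have "ent (M * U) m j = ent M m j"
        using that True by (subst ent_times[of "{j}"]) (auto simp: U_ent J_def)
      also have "\<dots> = 0"
      proof (cases "j = m")
        case True
        then show ?thesis using arg_cong[OF ME, of "\<lambda>X. ent X m m"] by (simp add: E_def)
      next
        case False
        then show ?thesis using supported_ent[OF matsD(2)[OF M], of m j] that \<open>i = m\<close> by (simp add: I_def)
      qed
      finally show ?thesis by simp
    qed simp
    finally show ?thesis .
  qed
  ultimately show ?case unfolding I_def by blast
qed

end

subsection \<open>Strictly upper triangular matrices\<close>

lemma strictly_upper_power_ent:
  fixes t :: "'r::{ring,monoid_mult} lfmat"
  assumes "\<And>i j. j \<le> i \<Longrightarrow> ent t i j = 0" "j < i + k"
  shows "ent (t ^ k) i j = 0"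
  using assms(2)
proof (induct k arbitrary: j)
  case (Suc k)
  define K where "K = {l. ent t l j \<noteq> 0}"
  have "ent (t ^ k) i l * ent t l j = 0" for l
    using Suc assms(1)[of j l] by (cases "l < i + k") auto
  then have "(\<Sum>l\<in>K. ent (t ^ k) i l * ent t l j) = 0" by (simp add: sum.neutral)
  then show ?case unfolding power_Suc2
    by (subst ent_times[of K]) (auto simp: K_def finite_column)
qed simp

lemma strictly_upper_power_superdiagonal:
  fixes t :: "'r::{ring,monoid_mult} lfmat"
  assumes "\<And>i j. j \<le> i \<Longrightarrow> ent t i j = 0"
  shows "ent (t ^ Suc d) i (i + Suc d) = ent (t ^ d) i (i + d) * ent t (i + d) (Suc (i + d))"
  unfolding power_Suc2
proof (subst ent_times[of "{i + d}"])
  fix k assume "k \<notin> {i + d}"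
  then show "ent (t ^ d) i k = 0 \<or> ent t k (i + Suc d) = 0"
    using strictly_upper_power_ent[OF assms, of k i d] assms[of "i + Suc d" k]
    by (cases "k < i + d") auto
qed auto

lemma strictly_upper_nilpotent:
  fixes t :: "'r::{ring,monoid_mult} lfmat"
  assumes "\<And>i j. j \<le> i \<Longrightarrow> ent t i j = 0" "supported {..<n} t" "n > 0"
  shows "t ^ n = 0"
proof (rule lfmat_eqI)
  fix i j
  have "supported {..<n} (t ^ Suc k)" for k
    by (induct k) (use assms(2) in \<open>auto intro: supported_mult\<close>)
  from this[of "n - 1"] have "supported {..<n} (t ^ n)" using assms(3) by simp
  then show "ent (t ^ n) i j = ent 0 i j"
    using strictly_upper_power_ent[OF assms(1), of j i n] supported_ent[of "{..<n}" "t ^ n" i j]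
    by (cases "j < n") auto
qed

section \<open>Strongly irreducible nilpotent matrices\<close>

lemma power_right_commutes:
  fixes x y :: "'r::{ring,monoid_mult}"
  assumes "x * y = y * x" shows "x * y ^ k = y ^ k * x"
proof (induct k)
  case (Suc k)
  have "x * (y * y ^ k) = y * (x * y ^ k)" by (simp add: assms flip: mult.assoc)
  then show ?case by (simp add: Suc mult.assoc)
qed simp

lemma nilpotent_inverse:
  fixes \<nu> :: "'r::{ring,monoid_mult}"
  assumes "\<nu> ^ k = 0"
  defines "w \<equiv> \<Sum>s<k. (- \<nu>) ^ s"
  shows "(1 + \<nu>) * w = 1" "w * (1 + \<nu>) = 1"
proof -
  have *: "(1 + \<nu>) * (\<Sum>s<j. (- \<nu>) ^ s) = 1 - (- \<nu>) ^ j" "(\<Sum>s<j. (- \<nu>) ^ s) * (1 + \<nu>) = 1 - (- \<nu>) ^ j" for j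
    by (induct j) (simp_all add: algebra_simps power_right_commutes[of \<nu> "- \<nu>"])
  have "(- \<nu>) ^ j = \<nu> ^ j \<or> (- \<nu>) ^ j = - (\<nu> ^ j)" for j by (induct j) auto
  then have "(- \<nu>) ^ k = 0" using assms(1) by (metis minus_zero)
  then show "(1 + \<nu>) * w = 1" "w * (1 + \<nu>) = 1" by (simp_all add: * w_def)
qed

text \<open>Both sides are equal to \<open>S (k + 1)\<close>. If \<open>N^(k+1) = 0\<close>, it follows that \<open>S k\<close> commutes with \<open>N\<close>.\<close>

lemma shifted_sum_commutes:
  fixes N E :: "'r::{ring,monoid_mult}"
  defines "S \<equiv> \<lambda>k. \<Sum>l\<le>k. N ^ l * E * N ^ (k - l)"
  shows "N * S k + E * N ^ Suc k = S k * N + N ^ Suc k * E"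
proof -
  have "S (Suc k) = E * N ^ Suc k + (\<Sum>l\<le>k. N ^ Suc l * E * N ^ (k - l))"
    unfolding S_def by (subst sum.atMost_Suc_shift) simp
  also have "(\<Sum>l\<le>k. N ^ Suc l * E * N ^ (k - l)) = N * S k"
    by (simp add: S_def sum_distrib_left mult.assoc)
  finally have 1: "S (Suc k) = E * N ^ Suc k + N * S k" .
  have "S (Suc k) = (\<Sum>l\<le>k. N ^ l * E * N ^ (Suc k - l)) + N ^ Suc k * E"
    by (simp add: S_def)
  also have "(\<Sum>l\<le>k. N ^ l * E * N ^ (Suc k - l)) = S k * N"
    unfolding S_def sum_distrib_right
    by (rule sum.cong) (simp_all add: Suc_diff_le power_Suc2 mult.assoc del: power_Suc)
  finally show ?thesis using 1 by (simp add: add.commute)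
qed

lemma scale_eq_zero: "bop_scale c a = 0 \<Longrightarrow> c \<noteq> 0 \<Longrightarrow> a = 0"
  using scale_scale[of "1 / c" c a] by simp

lemma sum_const_scale: "(\<Sum>i\<in>I. a) = bop_scale (of_nat (card I)) a"
  by (induct I rule: infinite_finite_induct) (auto simp: scale_add_left)

context abelian_vna
begin

definition strongly_irreducible :: "nat set \<Rightarrow> 'a bop lfmat \<Rightarrow> bool" where
  "strongly_irreducible I N \<longleftrightarrow> (\<forall>Q\<in>mats I. Q * Q = Q \<longrightarrow> Q * N = N * Q \<longrightarrow>
     (\<exists>p\<in>A. Q = scalar p * index_proj I))"

lemma full_commutes_scalar_sum:
  assumes "X \<in> full" "X * N = N * X" "\<And>m. b m \<in> A"
  shows "X * (\<Sum>m\<in>S. scalar (b m) * N ^ g m) = (\<Sum>m\<in>S. scalar (b m) * N ^ g m) * X"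
  unfolding sum_distrib_left sum_distrib_right
proof (rule sum.cong)
  fix m
  have "X * (scalar (b m) * N ^ g m) = scalar (b m) * (X * N ^ g m)"
    by (rule scalar_left_comm) (use assms in auto)
  then show "X * (scalar (b m) * N ^ g m) = scalar (b m) * N ^ g m * X"
    by (simp add: power_right_commutes[OF assms(2)] mult.assoc)
qed simp

text \<open>If \<open>N^(n-1)\<close> vanished on a projection, then \<open>N\<close> would have there a Jordan chain of length
  \<open>k + 1 < n\<close>, where \<open>k\<close> is the largest exponent with \<open>N^k \<noteq> 0\<close>, and this chain would split off.
  The chain is \<open>N^l e\<^sub>j\<close> for an invertible entry \<open>\<beta>\<close> of \<open>N^k\<close> in position \<open>(i, j)\<close>. The operator
  \<open>P\<^sub>0 = \<beta>\<^sup>-\<^sup>1 \<Sum> N^l e\<^sub>j\<^sub>i N^(k-l)\<close> commutes with \<open>N\<close>, and \<open>P\<^sub>0 P\<^sub>0 = (1 + \<nu>) P\<^sub>0\<close> with a nilpotent \<open>\<nu>\<close>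
  that is a polynomial in \<open>N\<close>, so \<open>(1 + \<nu>)\<^sup>-\<^sup>1 P\<^sub>0\<close> is an idempotent. Its trace \<open>k + 1\<close> is not a
  multiple of \<open>n\<close>, so it is not central.\<close>

lemma strongly_irreducible_power_regular:
  assumes N: "N \<in> mats I" and fin: "finite I" and irr: "strongly_irreducible I N"
    and n: "card I = Suc n'" and z: "z \<in> A" "scalar z * (index_proj I * N ^ n') = 0"
  shows "z = 0"
proof (rule ccontr)
  assume "z \<noteq> 0"
  obtain e c0 where e: "e \<in> A" "c0 \<in> A" "is_projection e" "e \<noteq> 0" "c0 * z = e"
    using invertible_on_projection[OF z(1) \<open>z \<noteq> 0\<close>] by blast
  have ee: "e * e = e" using e(3) by (simp add: is_projection_def)
  have Nfull: "N \<in> full" using N by (rule matsD)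
  let ?P = "index_proj I :: 'a bop lfmat"
  define vanish where "vanish j \<longleftrightarrow> scalar e * (?P * N ^ j) = 0" for j
  have "vanish n'"
    using arg_cong[OF z(2), of "\<lambda>X. scalar c0 * X"] e(5)
    by (simp add: vanish_def flip: mult.assoc scalar_mult)
  moreover have "\<not> vanish 0"
  proof
    obtain i where i: "i \<in> I" using n by fastforce
    assume "vanish 0"
    from arg_cong[OF this[unfolded vanish_def], of "\<lambda>X. ent X i i"] show False using i e(4) by simp
  qed
  ultimately obtain k where k: "\<not> vanish k" "vanish (Suc k)" "k < n'"
    using ex_least_nat_less[of vanish n'] by blast
  obtain i j where ij: "ent (scalar e * (?P * N ^ k)) i j \<noteq> 0"
  proof -
    have "\<exists>i j. ent (scalar e * (?P * N ^ k)) i j \<noteq> 0"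
    proof (rule ccontr)
      assume "\<not> ?thesis"
      then have "scalar e * (?P * N ^ k) = 0" by (intro lfmat_eqI) (simp only: ent_zero not_ex not_not)
      with k(1) show False unfolding vanish_def by (rule notE)
    qed
    then show ?thesis using that by blast
  qed
  have "scalar e * (?P * N ^ k) \<in> mats I" using e(1) N by simp
  then have iI: "i \<in> I" and jI: "j \<in> I" using ij supported_ent[OF matsD(2)] by blast+
  define \<beta> where "\<beta> d = ent (N ^ d) i j" for d
  have \<beta>_in: "\<beta> d \<in> A" for d using Nfull by (simp add: \<beta>_def fullD)
  have "e * \<beta> k \<noteq> 0" using ij iI by (simp add: \<beta>_def)
  then obtain f c1 where f: "f \<in> A" "c1 \<in> A" "is_projection f" "f \<noteq> 0" "c1 * (e * \<beta> k) = f"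
    using invertible_on_projection[of "e * \<beta> k"] \<beta>_in e(1) by auto
  have ff: "f * f = f" using f(3) by (simp add: is_projection_def)
  define c where "c = f * (c1 * e)"
  have c: "c \<in> A" using f e by (simp add: c_def)
  have c\<beta>: "c * \<beta> k = f" using f(5) ff by (simp add: c_def mult.assoc)
  have fc: "f * c = c" by (simp add: c_def ff flip: mult.assoc)
  have ce: "c * e = c" by (simp add: c_def ee mult.assoc)
  have fe: "f * e = f"
  proof -
    have "e * (e * \<beta> k) = e * \<beta> k" by (simp add: ee flip: mult.assoc)
    then show ?thesis using comm[OF \<beta>_in[of k] e(1)] by (simp add: f(5)[symmetric] mult.assoc)
  qed
  have N_Suc: "N ^ Suc k = ?P * N ^ Suc k" using index_proj_power_Suc[OF N] by simp
  have cN: "scalar c * N ^ Suc k = 0" and fN: "scalar f * N ^ Suc k = 0"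
  proof -
    have "scalar (c * e) * (?P * N ^ Suc k) = 0" "scalar (f * e) * (?P * N ^ Suc k) = 0"
      using k(2) unfolding vanish_def scalar_mult mult.assoc by simp_all
    then show "scalar c * N ^ Suc k = 0" "scalar f * N ^ Suc k = 0"
      unfolding ce fe N_Suc[symmetric] by simp_all
  qed
  define E where "E = (munit j i :: 'a bop lfmat)"
  have E: "E \<in> mats I" using iI jI by (simp add: E_def mats_munit)
  have corner: "E * X * E = scalar (ent X i j) * E" for X
    by (rule lfmat_eqI) (simp add: E_def)
  define S where "S = (\<Sum>l\<le>k. N ^ l * E * N ^ (k - l))"
  have S_full: "S \<in> full" using E Nfull by (simp add: S_def matsD)
  define P0 where "P0 = scalar c * S"
  have P0_full: "P0 \<in> full" using S_full c by (simp add: P0_def)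
  have P0N: "P0 * N = N * P0"
  proof -
    have "N * S + E * N ^ Suc k = S * N + N ^ Suc k * E"
      unfolding S_def by (rule shifted_sum_commutes)
    then have "scalar c * (N * S + E * N ^ Suc k) = scalar c * (S * N + N ^ Suc k * E)" by (simp only:)
    moreover have "scalar c * (E * N ^ Suc k) = 0"
      using scalar_left_comm[OF matsD(1)[OF E] c, of "N ^ Suc k"] cN by simp
    moreover have "scalar c * (N ^ Suc k * E) = 0"
      using cN by (simp only: mult.assoc[symmetric] mult_zero_left)
    ultimately have "scalar c * (N * S) = scalar c * (S * N)" by (simp only: distrib_left add_0_right)
    then show ?thesis using scalar_left_comm[OF Nfull c, of S] by (simp add: P0_def mult.assoc)
  qed
  define \<rho> where "\<rho> = scalar c * (\<Sum>m<k. scalar (\<beta> (k - Suc m)) * N ^ m)"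
  define \<nu> where "\<nu> = N * \<rho>"
  have \<rho>: "\<rho> \<in> full" using c \<beta>_in Nfull by (simp add: \<rho>_def)
  have \<rho>_comm: "X * \<rho> = \<rho> * X" if "X \<in> full" "X * N = N * X" for X
    using full_commutes_scalar_sum[OF that, where b = "\<lambda>m. \<beta> (k - Suc m)" and S = "{..<k}" and g = "\<lambda>m. m"] \<beta>_in
      scalar_left_comm[OF that(1) c]
    by (simp add: \<rho>_def mult.assoc)
  have \<nu>: "\<nu> \<in> full" using \<rho> Nfull by (simp add: \<nu>_def)
  have \<nu>_comm: "X * \<nu> = \<nu> * X" if "X \<in> full" "X * N = N * X" for X
  proof -
    have "X * (N * \<rho>) = N * (X * \<rho>)" using that(2) by (simp flip: mult.assoc)
    then show ?thesis using \<rho>_comm[OF that] by (simp add: \<nu>_def mult.assoc)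
  qed
  have f\<rho>: "scalar f * \<rho> = \<rho>" by (simp add: \<rho>_def fc flip: mult.assoc scalar_mult)
  have N\<rho>: "N * \<rho> = \<rho> * N" by (rule \<rho>_comm[OF Nfull refl])
  have \<nu>_pow: "\<nu> ^ j = N ^ j * \<rho> ^ j" for j
  proof (induct j)
    case (Suc j)
    have "\<rho> * N ^ j = N ^ j * \<rho>" by (rule power_right_commutes) (simp add: N\<rho>)
    then have "\<rho> * (N ^ j * \<rho> ^ j) = N ^ j * (\<rho> * \<rho> ^ j)" by (simp flip: mult.assoc)
    then have "N * \<rho> * (N ^ j * \<rho> ^ j) = N * N ^ j * (\<rho> * \<rho> ^ j)" by (simp only: mult.assoc)
    then show ?case by (simp only: power_Suc[of \<nu>] Suc) (simp add: \<nu>_def)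
  qed simp
  have "\<nu> ^ Suc k = N ^ Suc k * ((scalar f * \<rho>) * \<rho> ^ k)"
    unfolding f\<rho> using \<nu>_pow[of "Suc k"] by (simp only: power_Suc[of \<rho>])
  also have "\<dots> = (scalar f * N ^ Suc k) * (\<rho> * \<rho> ^ k)"
    using scalar_comm[OF full_power[OF Nfull, of "Suc k"] f(1)] by (simp only: mult.assoc[symmetric])
  finally have nil: "\<nu> ^ Suc k = 0" by (simp only: fN mult_zero_left)
  define w where "w = (\<Sum>s<Suc k. (- \<nu>) ^ s)"
  have w: "(1 + \<nu>) * w = 1" "w * (1 + \<nu>) = 1" using nilpotent_inverse[OF nil] by (simp_all add: w_def)
  have w_full: "w \<in> full" using \<nu> by (simp add: w_def)
  have w_comm: "X * w = w * X" if "X \<in> full" "X * N = N * X" for X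
  proof -
    have "X * w = w * (1 + \<nu>) * (X * w)" by (simp add: w)
    also have "\<dots> = w * (X * ((1 + \<nu>) * w))" using \<nu>_comm[OF that] by (simp add: algebra_simps flip: mult.assoc)
    finally show ?thesis by (simp add: w)
  qed
  have fP0: "scalar f * P0 = P0" by (simp add: P0_def fc flip: mult.assoc scalar_mult)
  have P0E: "P0 * E = (scalar f + \<nu>) * E"
  proof -
    have "S * E = (\<Sum>l\<le>k. scalar (\<beta> (k - l)) * N ^ l * E)"
      unfolding S_def sum_distrib_right
    proof (rule sum.cong)
      fix l
      have "N ^ l * E * N ^ (k - l) * E = N ^ l * (E * N ^ (k - l) * E)" by (simp add: mult.assoc)
      also have "\<dots> = scalar (\<beta> (k - l)) * (N ^ l * E)"
        using scalar_left_comm[OF full_power[OF Nfull] \<beta>_in] by (simp add: corner \<beta>_def)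
      finally show "N ^ l * E * N ^ (k - l) * E = scalar (\<beta> (k - l)) * N ^ l * E" by (simp add: mult.assoc)
    qed simp
    also have "\<dots> = (scalar (\<beta> k) + N * (\<Sum>m<k. scalar (\<beta> (k - Suc m)) * N ^ m)) * E"
    proof -
      have "(\<Sum>l\<le>k. scalar (\<beta> (k - l)) * N ^ l) = scalar (\<beta> k) + (\<Sum>m<k. scalar (\<beta> (k - Suc m)) * N ^ Suc m)"
        by (simp add: sum.atMost_shift)
      also have "(\<Sum>m<k. scalar (\<beta> (k - Suc m)) * N ^ Suc m) = N * (\<Sum>m<k. scalar (\<beta> (k - Suc m)) * N ^ m)"
        using scalar_left_comm[OF Nfull \<beta>_in] by (simp add: sum_distrib_left)
      finally show ?thesis by (simp flip: sum_distrib_right)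
    qed
    finally have "P0 * E = scalar c * ((scalar (\<beta> k) + N * (\<Sum>m<k. scalar (\<beta> (k - Suc m)) * N ^ m)) * E)"
      by (simp add: P0_def mult.assoc)
    also have "\<dots> = (scalar (c * \<beta> k) + \<nu>) * E"
      using scalar_left_comm[OF Nfull c]
      by (simp add: \<nu>_def \<rho>_def scalar_mult distrib_left distrib_right mult.assoc)
    finally show ?thesis by (simp add: c\<beta>)
  qed
  have sf\<nu>: "X * (scalar f + \<nu>) = (scalar f + \<nu>) * X" if "X \<in> full" "X * N = N * X" for X
    using \<nu>_comm[OF that] scalar_comm[OF that(1) f(1)] by (simp add: algebra_simps)
  have "P0 * S = (scalar f + \<nu>) * S"
    unfolding S_def sum_distrib_left
  proof (rule sum.cong)
    fix l
    have Nl: "N ^ l \<in> full" "N ^ l * N = N * N ^ l" using Nfull by (simp_all add: power_commutes)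
    have "P0 * (N ^ l * E * N ^ (k - l)) = (P0 * N ^ l) * E * N ^ (k - l)" by (simp only: mult.assoc)
    also have "\<dots> = N ^ l * (P0 * E) * N ^ (k - l)"
      by (simp only: power_right_commutes[OF P0N] mult.assoc)
    also have "\<dots> = (N ^ l * (scalar f + \<nu>)) * E * N ^ (k - l)" by (simp only: P0E mult.assoc)
    also have "\<dots> = (scalar f + \<nu>) * (N ^ l * E * N ^ (k - l))"
      by (simp only: sf\<nu>[OF Nl] mult.assoc)
    finally show "P0 * (N ^ l * E * N ^ (k - l)) = (scalar f + \<nu>) * (N ^ l * E * N ^ (k - l))" .
  qed simp
  then have "P0 * P0 = (scalar f + \<nu>) * P0"
    using scalar_left_comm[OF P0_full c, of S] scalar_left_comm[of "scalar f + \<nu>" c S] \<nu> f(1) c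
    by (simp add: P0_def)
  then have P0P0: "P0 * P0 = (1 + \<nu>) * P0" by (simp add: distrib_right fP0)
  have P0w: "P0 * w = w * P0" by (rule w_comm[OF P0_full P0N])
  define Q where "Q = w * P0"
  have "Q * Q = w * (P0 * w) * P0" by (simp add: Q_def mult.assoc)
  also have "\<dots> = w * (w * (P0 * P0))" unfolding P0w by (simp add: mult.assoc)
  also have "\<dots> = w * (w * (1 + \<nu>) * P0)" by (simp add: P0P0 mult.assoc)
  finally have QQ: "Q * Q = Q" by (simp add: w Q_def)
  have Nw: "N * w = w * N" by (rule w_comm[OF Nfull refl])
  have QN: "Q * N = N * Q"
  proof -
    have "Q * N = w * N * P0" by (simp add: Q_def P0N mult.assoc)
    then show ?thesis by (simp add: Q_def Nw[symmetric] mult.assoc)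
  qed
  have PN: "?P * N = N * ?P" using N by (simp add: mats_left mats_right)
  have P_E: "?P * E = E" "E * ?P = E" using E by (simp_all add: mats_left mats_right)
  have PS: "?P * S = S" "S * ?P = S"
    unfolding S_def sum_distrib_left sum_distrib_right
  proof (auto intro!: sum.cong)
    fix l
    note P_pow = index_proj_power_comm[OF N]
    have "?P * (N ^ l * E * N ^ (k - l)) = (?P * N ^ l) * E * N ^ (k - l)" by (simp only: mult.assoc)
    also have "\<dots> = N ^ l * (?P * E) * N ^ (k - l)" by (simp only: P_pow[symmetric] mult.assoc)
    finally show "?P * (N ^ l * E * N ^ (k - l)) = N ^ l * E * N ^ (k - l)" by (simp only: P_E)
    have "N ^ l * E * N ^ (k - l) * ?P = N ^ l * (E * ?P) * N ^ (k - l)" by (simp only: P_pow mult.assoc)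
    then show "N ^ l * E * N ^ (k - l) * ?P = N ^ l * E * N ^ (k - l)" by (simp only: P_E)
  qed
  have "Q \<in> mats I"
  proof -
    have Pw: "?P * w = w * ?P" by (rule w_comm[OF full_index_proj PN])
    have "?P * P0 = P0" "P0 * ?P = P0"
      using PS scalar_left_comm[OF full_index_proj c, of I S] by (simp_all add: P0_def mult.assoc)
    moreover have "?P * Q = w * (?P * P0)" by (simp add: Q_def Pw flip: mult.assoc)
    ultimately have "?P * Q = Q" "Q * ?P = Q" by (simp_all add: Q_def mult.assoc)
    then show ?thesis using w_full P0_full by (simp add: mats_def supported_iff Q_def)
  qed
  then obtain p where p: "p \<in> A" "Q = scalar p * ?P"
    using irr QQ QN unfolding strongly_irreducible_def by blast
  have "tr I Q = (\<Sum>l\<le>k. f)"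
  proof -
    have wN: "scalar c * (w * N ^ k) = scalar c * N ^ k"
    proof -
      have "\<rho> * N ^ k = N ^ k * \<rho>" by (rule power_right_commutes) (simp add: N\<rho>)
      then have "scalar f * (\<nu> * N ^ k) = scalar f * N ^ Suc k * \<rho>" by (simp add: \<nu>_def mult.assoc)
      then have "scalar c * (scalar f * (\<nu> * N ^ k)) = 0" by (simp only: fN mult_zero_left mult_zero_right)
      moreover have "c * f = c" using fc comm[OF f(1) c] by simp
      ultimately have "scalar c * (\<nu> * N ^ k) = 0" by (simp flip: mult.assoc scalar_mult)
      then have "w * (scalar c * (\<nu> * N ^ k)) = 0" by simp
      then have "scalar c * (w * (\<nu> * N ^ k)) = 0" using scalar_left_comm[OF w_full c] by simp
      moreover have "w * N ^ k + w * (\<nu> * N ^ k) = N ^ k"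
      proof -
        have "w * N ^ k + w * (\<nu> * N ^ k) = w * (1 + \<nu>) * N ^ k" by (simp add: algebra_simps)
        then show ?thesis by (simp add: w)
      qed
      ultimately show ?thesis by (metis add.right_neutral distrib_left)
    qed
    have "tr I (w * (N ^ l * E * N ^ (k - l))) = ent (w * N ^ k) i j" if "l \<le> k" for l
    proof -
      have "E * N ^ (k - l) \<in> mats I" by (rule mats_times_power[OF E N])
      then have "tr I ((w * N ^ l) * (E * N ^ (k - l))) = tr I ((E * N ^ (k - l)) * (w * N ^ l))"
        using w_full Nfull by (intro tr_commute[OF fin, symmetric]) auto
      also have "(E * N ^ (k - l)) * (w * N ^ l) = E * (w * N ^ k)"
      proof -
        have "N ^ (k - l) * w = w * N ^ (k - l)" using power_right_commutes[of w N "k - l"] Nw by simp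
        moreover have "N ^ (k - l) * N ^ l = N ^ k" using that by (simp flip: power_add)
        ultimately show ?thesis by (metis mult.assoc)
      qed
      also have "tr I (E * (w * N ^ k)) = ent (w * N ^ k) i j"
        using jI fin unfolding tr_def E_def by (simp add: sum.delta)
      finally show ?thesis by (simp add: mult.assoc)
    qed
    then have "tr I (w * S) = (\<Sum>l\<le>k. ent (w * N ^ k) i j)"
      by (simp add: S_def sum_distrib_left tr_sum)
    then have "tr I Q = (\<Sum>l\<le>k. c * ent (w * N ^ k) i j)"
      using scalar_left_comm[OF w_full c, of S] by (simp add: Q_def P0_def tr_scalar sum_distrib_left)
    also have "c * ent (w * N ^ k) i j = f"
      using arg_cong[OF wN, of "\<lambda>X. ent X i j"] by (simp add: c\<beta>[symmetric] \<beta>_def)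
    finally show ?thesis .
  qed
  moreover have "tr I Q = (\<Sum>l\<in>I. p)" by (simp add: p(2) tr_def)
  ultimately have eq: "bop_scale (of_nat (Suc n')) p = bop_scale (of_nat (Suc k)) f"
    by (simp add: sum_const_scale n)
  define t where "t = (of_nat (Suc k) / of_nat (Suc n') :: complex)"
  have p_eq: "p = bop_scale t f"
    using arg_cong[OF eq, of "bop_scale (1 / of_nat (Suc n'))"] by (simp add: t_def del: of_nat_Suc)
  have "p * p = p"
    using arg_cong[OF QQ, of "\<lambda>X. ent X i i"] iI
    by (simp add: p(2) mult.assoc index_proj_scalar flip: mult.assoc[of "index_proj I"])
  then have "bop_scale (t * t - t) f = 0" by (simp add: p_eq scale_simps ff)
  moreover have "t * t - t \<noteq> 0"
  proof -
    have "t \<noteq> 0" by (simp add: t_def del: of_nat_Suc)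
    moreover have "t \<noteq> 1" using k(3) by (simp add: t_def del: of_nat_Suc)
    ultimately show ?thesis by (simp add: algebra_simps)
  qed
  ultimately show False using scale_eq_zero f(4) by blast
qed

end

section \<open>The commutant of a triangular matrix with regular superdiagonal\<close>

text \<open>At the points of the spectrum where no entry of the superdiagonal vanishes, \<open>M\<close> is similar to a
  single Jordan block of size \<open>n\<close>.\<close>

locale jordan_type = abelian_vna +
  fixes n :: nat and M :: "'a bop lfmat"
  assumes M_mats: "M \<in> mats {..<n}"
    and M_upper: "j \<le> i \<Longrightarrow> ent M i j = 0"
    and M_regular: "Suc j < n \<Longrightarrow> regular (ent M j (Suc j))"
begin

lemma M_full: "M \<in> full"
  using M_mats by (rule matsD)

text \<open>Below the diagonal, compare the entries \<open>(i, j + 1)\<close> of \<open>X M\<close> and \<open>M X\<close>, with the lower rows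
  and the columns further left already treated.\<close>

lemma commutant_upper:
  assumes X: "X \<in> mats {..<n}" "X * M = M * X" and "j < i"
  shows "ent X i j = 0"
  using assms(3)
proof (induct "n - i" arbitrary: i j rule: less_induct)
  case (less i)
  note rows = less.hyps
  from less.prems show ?case
  proof (induct j rule: less_induct)
    case (less j)
    show ?case
    proof (cases "i < n")
      case True
      have below: "ent X k (Suc j) = 0" if "i < k" for k
        by (rule rows) (use that True less.prems in auto)
      have "ent (X * M) i (Suc j) = ent X i j * ent M j (Suc j)"
      proof (subst ent_times[of "{j}"])
        fix k assume "k \<notin> {j}"
        then show "ent X i k = 0 \<or> ent M k (Suc j) = 0"
          using less.hyps[of k] less.prems M_upper[of "Suc j" k] by (cases "k < j") auto
      qed auto
      moreover have "ent (M * X) i (Suc j) = 0"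
      proof (subst ent_times[of "{}"])
        fix k
        show "ent M i k = 0 \<or> ent X k (Suc j) = 0"
          using below[of k] M_upper[of k i] by (cases "i < k") auto
      qed auto
      ultimately have "ent X i j * ent M j (Suc j) = 0" using X(2) by simp
      moreover have "Suc j < n" using True less.prems by simp
      ultimately show ?thesis using regularD[OF M_regular mats_ent[OF X(1)]] by blast
    next
      case False
      then show ?thesis using supported_ent[OF matsD(2)[OF X(1)], of i j] by simp
    qed
  qed
qed

lemma commutant_diagonal:
  assumes X: "X * M = M * X" and zero: "\<And>i j. j < i + d \<Longrightarrow> ent X i j = 0"
  shows "ent X i (i + d) * ent M (i + d) (Suc (i + d)) = ent M i (Suc i) * ent X (Suc i) (Suc i + d)"
proof -
  have "ent (X * M) i (Suc (i + d)) = ent X i (i + d) * ent M (i + d) (Suc (i + d))"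
  proof (subst ent_times[of "{i + d}"])
    fix k assume "k \<notin> {i + d}"
    then show "ent X i k = 0 \<or> ent M k (Suc (i + d)) = 0"
      using zero[of k i] M_upper[of "Suc (i + d)" k] by (cases "k < i + d") auto
  qed auto
  moreover have "ent (M * X) i (Suc (i + d)) = ent M i (Suc i) * ent X (Suc i) (Suc (i + d))"
  proof (subst ent_times[of "{Suc i}"])
    fix k assume "k \<notin> {Suc i}"
    then show "ent M i k = 0 \<or> ent X k (Suc (i + d)) = 0"
      using zero[of "Suc (i + d)" k] M_upper[of k i] by (cases "k \<le> i") auto
  qed auto
  ultimately show ?thesis using X by simp
qed

lemma power_superdiagonal_regular:
  "i + d < n \<Longrightarrow> regular (ent (M ^ d) i (i + d))"
proof (induct d)
  case 0
  then show ?case by (simp add: regular_one)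
next
  case (Suc d)
  have "ent (M ^ Suc d) i (i + Suc d) = ent (M ^ d) i (i + d) * ent M (i + d) (Suc (i + d))"
    by (rule strictly_upper_power_superdiagonal[OF M_upper])
  then show ?case
    using Suc M_regular[of "i + d"] M_full by (auto intro!: regular_mult fullD[of "M ^ d"])
qed

text \<open>Up to a regular factor, a matrix \<open>X\<close> in the commutant is a polynomial in \<open>M\<close>: the first
  nonvanishing diagonal of \<open>X\<close> is determined by its first entry, and is removed by subtracting a
  multiple of the corresponding power of \<open>M\<close>.\<close>

lemma commutant_polynomial_aux:
  assumes "X \<in> mats {..<n}" "X * M = M * X" "\<And>i j. j < i + d \<Longrightarrow> ent X i j = 0"
  shows "\<exists>c b. c \<in> A \<and> regular c \<and> (\<forall>l. b l \<in> A) \<and>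
    scalar c * X = (\<Sum>l<n. scalar (b l) * (index_proj {..<n} * M ^ l))"
  using assms
proof (induct "n - d" arbitrary: d X)
  case 0
  have "X = 0"
  proof (rule lfmat_eqI)
    fix i j
    show "ent X i j = ent 0 i j"
      using "0.prems"(3)[of j i] "0.hyps" supported_ent[OF matsD(2)[OF "0.prems"(1)], of i j]
      by (cases "j < i + d") auto
  qed
  then show ?case by (intro exI[of _ 1] exI[of _ "\<lambda>_. 0"]) (simp add: regular_one)
next
  case (Suc m)
  then have d: "d < n" by simp
  note X = Suc.prems
  let ?P = "index_proj {..<n} :: 'a bop lfmat"
  define g where "g = ent (M ^ d) 0 d"
  define x where "x = ent X 0 d"
  have g: "g \<in> A" "regular g" using power_superdiagonal_regular[of 0 d] d M_full by (auto simp: g_def fullD)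
  have x: "x \<in> A" using X(1) by (simp add: x_def)
  define Y where "Y = scalar g * X - scalar x * (?P * M ^ d)"
  have Y: "Y \<in> mats {..<n}" using X(1) g x M_mats by (simp add: Y_def)
  have "Y * M = M * Y"
  proof -
    have "M * (scalar g * X) = scalar g * X * M"
      using scalar_left_comm[OF M_full g(1)] X(2) by (simp add: mult.assoc)
    moreover have "M * (scalar x * (?P * M ^ d)) = scalar x * (?P * M ^ d) * M"
    proof -
      have "M * (?P * M ^ d) = ?P * M ^ d * M"
        using M_mats by (simp add: mats_left mats_right mult.assoc power_commutes flip: mult.assoc[of M] mult.assoc[of ?P M])
      then show ?thesis using scalar_left_comm[OF M_full x] by (simp add: mult.assoc)
    qed
    ultimately show ?thesis by (simp add: Y_def left_diff_distrib right_diff_distrib)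
  qed
  have Y_below: "ent Y i j = 0" if "j < i + d" for i j
    using X(3)[OF that] strictly_upper_power_ent[OF M_upper that] by (simp add: Y_def)
  have Y_diag: "ent Y i (i + d) = 0" for i
  proof (induct i)
    case 0
    then show ?case using d comm[OF g(1) x] by (simp add: Y_def g_def x_def)
  next
    case (Suc i)
    show ?case
    proof (cases "Suc i < n")
      case True
      have "ent M i (Suc i) * ent Y (Suc i) (Suc i + d) = 0"
        using commutant_diagonal[of Y d i, OF \<open>Y * M = M * Y\<close> Y_below] Suc by simp
      then have "ent Y (Suc i) (Suc i + d) * ent M i (Suc i) = 0"
        using comm[of "ent M i (Suc i)" "ent Y (Suc i) (Suc i + d)"] M_mats Y by simp
      then show ?thesis by (rule regularD[OF M_regular[OF True] mats_ent[OF Y]])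
    next
      case False
      then show ?thesis using supported_ent[OF matsD(2)[OF Y], of "Suc i"] by simp
    qed
  qed
  have "ent Y i j = 0" if "j < i + Suc d" for i j
    using Y_below[of j i] Y_diag[of i] that by (cases "j = i + d") auto
  moreover have "m = n - Suc d" using Suc.hyps(2) by simp
  ultimately obtain c b where c: "c \<in> A" "regular c" "\<And>l. b l \<in> A"
    "scalar c * Y = (\<Sum>l<n. scalar (b l) * (?P * M ^ l))"
    using Suc.hyps(1)[of "Suc d" Y] Y \<open>Y * M = M * Y\<close> by blast
  define b' where "b' l = b l + (if l = d then c * x else 0)" for l
  have "scalar (c * g) * X = scalar c * Y + scalar (c * x) * (?P * M ^ d)"
    by (simp add: Y_def scalar_mult right_diff_distrib mult.assoc)
  also have "\<dots> = (\<Sum>l<n. scalar (b' l) * (?P * M ^ l))"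
  proof -
    have "(\<Sum>l<n. scalar (b' l) * (?P * M ^ l))
        = (\<Sum>l<n. scalar (b l) * (?P * M ^ l)) + (\<Sum>l<n. if l = d then scalar (c * x) * (?P * M ^ l) else 0)"
      unfolding sum.distrib[symmetric] by (rule sum.cong) (auto simp: b'_def scalar_add distrib_right)
    then show ?thesis using d by (simp add: c(4) sum.delta)
  qed
  finally have "scalar (c * g) * X = (\<Sum>l<n. scalar (b' l) * (?P * M ^ l))" .
  moreover have "b' l \<in> A" for l using c(1,3) x by (simp add: b'_def)
  moreover have "c * g \<in> A" "regular (c * g)" using c g by (auto intro: regular_mult)
  ultimately show ?case by blast
qed

lemma commutant_polynomial:
  assumes "X \<in> mats {..<n}" "X * M = M * X"
  shows "\<exists>c b. c \<in> A \<and> regular c \<and> (\<forall>l. b l \<in> A) \<and>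
    scalar c * X = (\<Sum>l<n. scalar (b l) * (index_proj {..<n} * M ^ l))"
  by (rule commutant_polynomial_aux[where d = 0]) (use assms commutant_upper[OF assms] in auto)

lemma commutant_scalar_plus_nilpotent:
  assumes X: "X \<in> mats {..<n}" "X * M = M * X" and n: "n > 0"
  shows "\<And>i. i < n \<Longrightarrow> ent X i i = ent X 0 0"
    and "(X - scalar (ent X 0 0) * index_proj {..<n}) ^ n = 0"
proof -
  have upper: "ent X i j = 0" if "j < i" for i j by (rule commutant_upper[OF X that])
  show diag: "ent X i i = ent X 0 0" if "i < n" for i
    using that
  proof (induct i)
    case (Suc i)
    define s where "s = ent M i (Suc i)"
    have s: "s \<in> A" "regular s" using M_mats M_regular Suc.prems by (simp_all add: s_def)
    have "ent X i i * s = s * ent X (Suc i) (Suc i)"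
      using commutant_diagonal[of X 0 i] X(2) upper by (simp add: s_def)
    then have "(ent X i i - ent X (Suc i) (Suc i)) * s = 0"
      using comm[OF s(1), of "ent X (Suc i) (Suc i)"] X(1) by (simp add: algebra_simps)
    then have "ent X i i - ent X (Suc i) (Suc i) = 0"
      by (rule regularD[OF s(2) diff_in[OF mats_ent[OF X(1)] mats_ent[OF X(1)]]])
    then show ?case using Suc by simp
  qed simp
  show "(X - scalar (ent X 0 0) * index_proj {..<n}) ^ n = 0"
  proof (rule strictly_upper_nilpotent[OF _ _ n])
    show "supported {..<n} (X - scalar (ent X 0 0) * index_proj {..<n})"
      using X(1) by (intro supported_diff supported_scalar) (auto simp: mats_def)
    fix i j :: nat assume "j \<le> i"
    then show "ent (X - scalar (ent X 0 0) * index_proj {..<n}) i j = 0"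
      using upper[of j i] diag[of i] supported_ent[OF matsD(2)[OF X(1)], of i j]
      by (cases "j = i"; cases "i < n") auto
  qed
qed

text \<open>The idempotent \<open>X\<close> commutes with its diagonal part, which is a central idempotent, so the difference
  \<open>D\<close> satisfies \<open>D\<^sup>3 = D\<close>. But \<open>D\<close> is nilpotent.\<close>

lemma commutant_idempotent_scalar:
  assumes X: "X \<in> mats {..<n}" "X * M = M * X" "X * X = X" and n: "n > 0"
  shows "X = scalar (ent X 0 0) * index_proj {..<n}"
proof -
  define x where "x = ent X 0 0"
  define Z where "Z = scalar x * (index_proj {..<n} :: 'a bop lfmat)"
  define D where "D = X - Z"
  have x: "x \<in> A" using X(1) by (simp add: x_def)
  have "ent (X * X) 0 0 = x * x"
  proof (subst ent_times[of "{0}"])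
    fix k :: nat assume "k \<notin> {0}"
    then show "ent X 0 k = 0 \<or> ent X k 0 = 0" using commutant_upper[OF X(1,2), of 0 k] by simp
  qed (auto simp: x_def)
  then have xx: "x * x = x" using X(3) by (simp add: x_def)
  have ZZ: "Z * Z = Z"
    by (rule lfmat_eqI) (simp add: Z_def mult.assoc xx)
  have XZ: "X * Z = Z * X"
    using scalar_left_comm[OF matsD(1)[OF X(1)] x] by (simp add: Z_def mult.assoc mats_left[OF X(1)] mats_right[OF X(1)])
  have XXY: "X * (X * Y) = X * Y" "Z * (Z * Y) = Z * Y" "X * (Z * Y) = Z * (X * Y)" for Y
    using X(3) ZZ XZ by (simp_all flip: mult.assoc)
  have D3: "D * D * D = D"
    by (simp add: D_def algebra_simps X(3) ZZ XZ XXY)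
  have "D ^ (2 * k + 1) = D" for k
  proof (induct k)
    case (Suc k)
    have "D ^ (2 * Suc k + 1) = D * D * D ^ (2 * k + 1)" by (simp add: mult.assoc)
    then show ?case using D3 Suc by (simp add: mult.assoc)
  qed simp
  then have "D = D ^ (n + (n + 1))" by (metis add.assoc mult_2)
  also have "\<dots> = D ^ n * D ^ (n + 1)" by (rule power_add)
  also have "D ^ n = 0"
    using commutant_scalar_plus_nilpotent(2)[OF X(1,2) n] by (simp add: D_def Z_def x_def)
  finally show ?thesis by (simp add: D_def Z_def x_def)
qed

end

section \<open>Splitting complex matrices\<close>

subsection \<open>Polynomials in a matrix\<close>

locale poly_eval =
  fixes \<phi> :: "complex \<Rightarrow> 'r::{ring,monoid_mult}" and x :: 'r
  assumes \<phi>_add: "\<phi> (a + b) = \<phi> a + \<phi> b" and \<phi>_mult: "\<phi> (a * b) = \<phi> a * \<phi> b"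
    and \<phi>_one: "\<phi> 1 = 1" and \<phi>_comm: "\<phi> a * x = x * \<phi> a"
begin

lemma \<phi>_zero [simp]: "\<phi> 0 = 0"
  using \<phi>_add[of 0 0] by simp

definition peval :: "complex poly \<Rightarrow> 'r" where
  "peval p = (\<Sum>i\<le>degree p. \<phi> (coeff p i) * x ^ i)"

lemma peval_upto: "degree p \<le> N \<Longrightarrow> peval p = (\<Sum>i\<le>N. \<phi> (coeff p i) * x ^ i)"
  unfolding peval_def by (rule sum.mono_neutral_left) (auto simp: coeff_eq_0)

lemma peval_0 [simp]: "peval 0 = 0"
  by (simp add: peval_def)

lemma peval_pCons: "peval (pCons a p) = \<phi> a + x * peval p"
proof -
  have "peval (pCons a p) = (\<Sum>i\<le>Suc (degree p). \<phi> (coeff (pCons a p) i) * x ^ i)"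
    by (rule peval_upto) (simp add: degree_pCons_le)
  also have "\<dots> = \<phi> a + (\<Sum>i\<le>degree p. \<phi> (coeff p i) * x ^ Suc i)"
    by (subst sum.atMost_Suc_shift) simp
  also have "(\<Sum>i\<le>degree p. \<phi> (coeff p i) * x ^ Suc i) = x * peval p"
    unfolding peval_def sum_distrib_left
    by (rule sum.cong) (simp_all add: \<phi>_comm flip: mult.assoc)
  finally show ?thesis .
qed

lemma peval_one [simp]: "peval 1 = 1"
  by (simp add: one_pCons peval_pCons \<phi>_one)

lemma peval_add: "peval (p + q) = peval p + peval q"
  by (induct p q rule: poly_induct2) (simp_all add: peval_pCons \<phi>_add algebra_simps)

lemma \<phi>_left_comm: "\<phi> a * (x * y) = x * (\<phi> a * y)"
  by (simp add: \<phi>_comm flip: mult.assoc)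

lemma peval_smult: "peval (Polynomial.smult a p) = \<phi> a * peval p"
  by (induct p) (simp_all add: peval_pCons \<phi>_mult distrib_left \<phi>_left_comm)

lemma peval_mult: "peval (p * q) = peval p * peval q"
  by (induct p) (simp_all add: peval_pCons peval_add peval_smult distrib_right mult.assoc)

lemma peval_diff: "peval (p - q) = peval p - peval q"
  using peval_add[of "p - q" q] by simp

lemma peval_commutes:
  assumes "\<And>a. y * \<phi> a = \<phi> a * y" "y * x = x * y"
  shows "y * peval p = peval p * y"
proof (induct p)
  case (pCons a p)
  have "y * (x * peval p) = x * (y * peval p)" by (simp add: assms(2) flip: mult.assoc)
  then show ?case using assms(1) pCons by (simp add: peval_pCons distrib_left distrib_right mult.assoc)
qed simp

end

lemma scalar_complex_comm: "scalar a * X = X * scalar (a :: complex)"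
  by (rule lfmat_eqI) simp

lemma scalar_complex_left_comm: "X * (scalar a * Y) = scalar (a :: complex) * (X * Y)"
  by (simp only: scalar_complex_comm[of a X] mult.assoc[symmetric])

interpretation complex_mat: poly_eval "scalar :: complex \<Rightarrow> complex lfmat" C for C
  by standard (auto simp: scalar_add scalar_mult intro: scalar_complex_comm)

lemma complex_tr_commute:
  fixes X Y :: "complex lfmat"
  assumes "finite I" "supported I X" shows "tr I (X * Y) = tr I (Y * X)"
proof -
  have "tr I (X * Y) = (\<Sum>i\<in>I. \<Sum>k\<in>I. ent X i k * ent Y k i)"
    using assms by (simp add: tr_def ent_times_supported)
  also have "\<dots> = (\<Sum>k\<in>I. \<Sum>i\<in>I. ent X i k * ent Y k i)" by (rule sum.swap)
  also have "\<dots> = tr I (Y * X)" using assms by (simp add: tr_def ent_times_supported mult.commute)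
  finally show ?thesis .
qed

lemma upper_peval:
  fixes t :: "complex lfmat"
  assumes "\<And>i j. j < i \<Longrightarrow> ent t i j = 0"
  shows "j < i \<Longrightarrow> ent (complex_mat.peval t p) i j = 0"
    and "ent (complex_mat.peval t p) i i = poly p (ent t i i)"
proof (induct p arbitrary: i j)
  case (pCons a p)
  {
    case 1
    have "ent (t * complex_mat.peval t p) i j = 0"
    proof (subst ent_times[of "{}"])
      fix k
      show "ent t i k = 0 \<or> ent (complex_mat.peval t p) k j = 0"
        using assms[of k i] pCons(2)[of j k] 1 by (cases "k < i") auto
    qed auto
    then show ?case using 1 by (simp add: complex_mat.peval_pCons)
  next
    case 2
    have "ent (t * complex_mat.peval t p) i i = ent t i i * ent (complex_mat.peval t p) i i"
    proof (subst ent_times[of "{i}"])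
      fix k assume "k \<notin> {i}"
      then show "ent t i k = 0 \<or> ent (complex_mat.peval t p) k i = 0"
        using assms[of k i] pCons(2)[of i k] by (cases "k < i") auto
    qed auto
    then show ?case using pCons(3)[of i] by (simp add: complex_mat.peval_pCons)
  }
qed simp_all

text \<open>Write \<open>f = (x - a)^k r\<close> with \<open>r(a) \<noteq> 0\<close>. Since \<open>w = r / r(a)\<close> is \<open>1\<close> modulo \<open>x - a\<close>, the polynomial
  \<open>1 - (1 - w)^k\<close> is \<open>1\<close> modulo \<open>(x - a)^k\<close>, and it is \<open>0\<close> modulo \<open>r\<close>.\<close>

lemma idempotent_polynomial:
  fixes f :: "complex poly"
  assumes f: "f \<noteq> 0" "poly f a = 0" "poly f b = 0" "a \<noteq> b"
  shows "\<exists>q. f dvd q * q - q \<and> poly q a = 1 \<and> poly q b = 0"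
proof -
  define k where "k = Polynomial.order a f"
  obtain r where r: "f = [:-a, 1:] ^ k * r" "\<not> [:-a, 1:] dvd r"
    using order_decomp[OF f(1)] by (auto simp: k_def)
  have k: "k > 0" using f(1,2) order_root[of f a] by (auto simp: k_def)
  define c where "c = poly r a"
  have c: "c \<noteq> 0" using r(2) by (simp add: c_def poly_eq_0_iff_dvd)
  define w where "w = Polynomial.smult (1 / c) r"
  have wa: "poly w a = 1" using c by (simp add: w_def c_def)
  have wb: "poly w b = 0"
  proof -
    have "(b - a) ^ k * poly r b = 0" using f(3) by (simp add: r(1) poly_power)
    then show ?thesis using f(4) by (simp add: w_def)
  qed
  have "[:-a, 1:] dvd 1 - w" using wa by (simp flip: poly_eq_0_iff_dvd)
  then have 1: "[:-a, 1:] ^ k dvd (1 - w) ^ k" by (rule dvd_power_same)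
  have "w dvd 1 - (1 - w) ^ j" for j
  proof (induct j)
    case (Suc j)
    have eq: "1 - (1 - w) ^ Suc j = (1 - (1 - w) ^ j) + w * (1 - w) ^ j" by (simp add: algebra_simps)
    show ?case unfolding eq using Suc by (rule dvd_add) simp
  qed simp
  then have 2: "r dvd 1 - (1 - w) ^ k" using c by (metis w_def smult_dvd_cancel)
  define q where "q = 1 - (1 - w) ^ k"
  have "f dvd (1 - w) ^ k * q" unfolding r(1) q_def by (rule mult_dvd_mono[OF 1 2])
  moreover have "q * q - q = - ((1 - w) ^ k * q)" by (simp add: q_def algebra_simps)
  ultimately have "f dvd q * q - q" by simp
  moreover have "poly q a = 1" "poly q b = 0" using k wa wb by (simp_all add: q_def poly_power)
  ultimately show ?thesis by blast
qed

subsection \<open>Matrices of fixed size\<close>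

lift_definition of_mat :: "'r::zero mat \<Rightarrow> 'r lfmat"
  is "\<lambda>M i j. if i < dim_row M \<and> j < dim_col M then M $$ (i, j) else 0"
proof (intro conjI allI)
  fix M :: "'r mat" and i
  show "finite {j. (if i < dim_row M \<and> j < dim_col M then M $$ (i, j) else 0) \<noteq> 0}"
    by (rule finite_subset[of _ "{..<dim_col M}"]) auto
  show "finite {j. (if j < dim_row M \<and> i < dim_col M then M $$ (j, i) else 0) \<noteq> 0}"
    by (rule finite_subset[of _ "{..<dim_row M}"]) auto
qed

definition to_mat :: "nat \<Rightarrow> 'r::zero lfmat \<Rightarrow> 'r mat" where
  "to_mat n X = mat n n (\<lambda>(i, j). ent X i j)"

lemma ent_of_mat: "M \<in> carrier_mat n n \<Longrightarrow> ent (of_mat M) i j = (if i < n \<and> j < n then M $$ (i, j) else 0)"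
  by (simp add: of_mat.rep_eq)

lemma to_mat_carrier [simp]: "to_mat n X \<in> carrier_mat n n"
  by (simp add: to_mat_def)

lemma to_mat_of_mat: "M \<in> carrier_mat n n \<Longrightarrow> to_mat n (of_mat M) = M"
  by (auto simp: to_mat_def ent_of_mat)

lemma of_mat_to_mat: "supported {..<n} X \<Longrightarrow> of_mat (to_mat n X) = X"
  by (rule lfmat_eqI, subst ent_of_mat[OF to_mat_carrier]) (auto simp: to_mat_def supported_ent)

lemma supported_of_mat: "M \<in> carrier_mat n n \<Longrightarrow> supported {..<n} (of_mat M)"
  by (simp add: supported_def ent_of_mat)

lemma of_mat_inject: "M \<in> carrier_mat n n \<Longrightarrow> N \<in> carrier_mat n n \<Longrightarrow> of_mat M = of_mat N \<longleftrightarrow> M = N"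
  by (metis to_mat_of_mat)

lemma of_mat_mult:
  fixes M N :: "'r::ring mat"
  assumes "M \<in> carrier_mat n n" "N \<in> carrier_mat n n"
  shows "of_mat (M * N) = of_mat M * of_mat N"
proof (rule lfmat_eqI)
  fix i j
  have "ent (of_mat M * of_mat N) i j = (\<Sum>k<n. ent (of_mat M) i k * ent (of_mat N) k j)"
    using supported_of_mat[OF assms(1)] by (subst ent_times_supported[of "{..<n}"]) auto
  also have "\<dots> = (if i < n \<and> j < n then (\<Sum>k<n. M $$ (i, k) * N $$ (k, j)) else 0)"
    using assms by (cases "i < n \<and> j < n") (auto simp: ent_of_mat intro: sum.neutral)
  also have "\<dots> = ent (of_mat (M * N)) i j"
    using assms by (subst ent_of_mat[of _ n]) (auto simp: scalar_prod_def lessThan_atLeast0 intro!: sum.cong)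
  finally show "ent (of_mat (M * N)) i j = ent (of_mat M * of_mat N) i j" by simp
qed

lemma of_mat_one: "of_mat (1\<^sub>m n) = (index_proj {..<n} :: 'r::{ring,monoid_mult} lfmat)"
  by (rule lfmat_eqI) (simp add: ent_of_mat[of _ n])

lemma of_mat_zero: "of_mat (0\<^sub>m n n) = 0"
  by (rule lfmat_eqI) (simp add: ent_of_mat[of _ n])

lemma complex_schur:
  fixes C :: "complex lfmat"
  assumes "supported {..<n} C"
  shows "\<exists>S S' t. supported {..<n} S \<and> supported {..<n} S' \<and> supported {..<n} t \<and>
    S * S' = index_proj {..<n} \<and> S' * S = index_proj {..<n} \<and> C = S * t * S' \<and>
    (\<forall>i j. j < i \<longrightarrow> ent t i j = 0)"
proof -
  define C' where "C' = to_mat n C"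
  have C': "C' \<in> carrier_mat n n" by (simp add: C'_def)
  obtain es where "char_poly C' = (\<Prod>a\<leftarrow>es. [:- a, 1:])"
    using char_poly_factorized[OF C'] by blast
  from schur_decomposition_exists[OF C' this] obtain B where
    B: "B \<in> carrier_mat n n" "upper_triangular B" "similar_mat C' B" by blast
  then obtain S S' where "similar_mat_wit C' B S S'" by (auto simp: similar_mat_def)
  note w = similar_mat_witD2[OF C' this]
  have "of_mat S * of_mat S' = index_proj {..<n}" "of_mat S' * of_mat S = index_proj {..<n}"
    using w by (simp_all add: of_mat_one flip: of_mat_mult)
  moreover have "C = of_mat S * of_mat B * of_mat S'"
  proof -
    have "C = of_mat C'" using of_mat_to_mat[OF assms] by (simp add: C'_def)
    also have "C' = S * B * S'" by (rule w(3))
    also have "of_mat (S * B * S') = of_mat S * of_mat B * of_mat S'"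
      using w by (simp add: of_mat_mult[of _ n] mult.assoc)
    finally show ?thesis .
  qed
  moreover have "ent (of_mat B) i j = 0" if "j < i" for i j
    using B(1,2) that by (auto simp: ent_of_mat upper_triangular_def)
  ultimately show ?thesis using w by (blast intro: supported_of_mat)
qed

text \<open>A complex matrix of trace \<open>0\<close> that is not nilpotent has two distinct eigenvalues, and a
  polynomial in it is an idempotent which is not scalar. In triangular form with diagonal \<open>d\<close> the
  polynomial \<open>h = \<Prod> (x - d i)\<close> is strictly upper triangular, so \<open>h^n\<close> annihilates the matrix; the
  coprime factors of \<open>h^n\<close> give the idempotent.\<close>

lemma complex_splitting:
  fixes C :: "complex lfmat"
  assumes C: "supported {..<n} C" "tr {..<n} C = 0" "C ^ n \<noteq> 0" and n: "n > 0"
  shows "\<exists>q Q. Q = index_proj {..<n} * complex_mat.peval C q \<and> Q * Q = Q \<and>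
    (\<forall>c. Q \<noteq> scalar c * index_proj {..<n})"
proof -
  let ?P = "index_proj {..<n} :: complex lfmat"
  obtain S S' t where S: "supported {..<n} S" "supported {..<n} S'" "supported {..<n} t"
    "S * S' = ?P" "S' * S = ?P" "C = S * t * S'" and upper: "\<And>i j. j < i \<Longrightarrow> ent t i j = 0"
    using complex_schur[OF C(1)] by blast
  note PS = supported_left[OF S(1)] supported_right[OF S(1)] supported_left[OF S(2)]
    supported_right[OF S(2)] supported_left[OF S(3)] supported_right[OF S(3)]
  define d where "d i = ent t i i" for i
  have conj: "?P * complex_mat.peval C p = S * (?P * complex_mat.peval t p) * S'" for p
  proof (induct p)
    case (pCons a p)
    have PC: "?P * C = C * ?P" using C(1) by (simp add: supported_left supported_right)
    have "?P * complex_mat.peval C (pCons a p) = scalar a * ?P + C * (?P * complex_mat.peval C p)"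
      by (simp add: complex_mat.peval_pCons distrib_left index_proj_scalar PC flip: mult.assoc)
    also have "C * (?P * complex_mat.peval C p) = C * (S * (?P * complex_mat.peval t p) * S')"
      by (simp only: pCons)
    also have "\<dots> = S * t * (S' * S) * (?P * complex_mat.peval t p) * S'"
      by (simp only: S(6) mult.assoc)
    also have "\<dots> = S * (?P * (t * complex_mat.peval t p)) * S'"
      by (simp add: S(5) PS mult.assoc) (simp add: PS flip: mult.assoc)
    also have "scalar a * ?P = S * (?P * scalar a) * S'"
      by (simp add: index_proj_scalar mult.assoc scalar_complex_left_comm[of S] PS S(4))
    finally show ?case by (simp add: complex_mat.peval_pCons distrib_left distrib_right)
  qed simp
  have "\<exists>i<n. d i \<noteq> d 0"
  proof (rule ccontr)
    assume "\<not> ?thesis"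
    then have d: "d i = d 0" if "i < n" for i using that by blast
    have "tr {..<n} C = tr {..<n} (t * S' * S)"
      using complex_tr_commute[of "{..<n}" S "t * S'"] S(1) by (simp add: S(6) mult.assoc)
    also have "\<dots> = (\<Sum>i<n. d i)" by (simp add: mult.assoc S(5) PS tr_def d_def)
    also have "\<dots> = (\<Sum>i<n. d 0)" by (intro sum.cong refl d) auto
    also have "\<dots> = of_nat n * d 0" by simp
    finally have "d 0 = 0" using C(2) n by simp
    have "ent t i j = 0" if "j \<le> i" for i j
      using upper[of j i] d[of i] \<open>d 0 = 0\<close> supported_ent[OF S(3), of i j] that
      by (cases "j = i"; cases "i < n") (auto simp: d_def)
    then have "t ^ n = 0" by (rule strictly_upper_nilpotent[OF _ S(3) n])
    have "C ^ Suc k = S * t ^ Suc k * S'" for k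
    proof (induct k)
      case (Suc k)
      have "C ^ Suc (Suc k) = S * t ^ Suc k * (S' * S) * t * S'"
        by (simp only: power_Suc2[of C "Suc k"] Suc) (simp add: S(6) mult.assoc)
      also have "\<dots> = S * (t ^ Suc k * (?P * t)) * S'" by (simp only: S(5) mult.assoc)
      also have "\<dots> = S * (t ^ Suc k * t) * S'" by (simp only: PS)
      finally show ?case by (simp only: power_Suc2[of t "Suc k"])
    qed (simp add: S(6))
    from this[of "n - 1"] have "C ^ n = 0" using n \<open>t ^ n = 0\<close> by simp
    with C(3) show False by simp
  qed
  then obtain i1 where i1: "i1 < n" "d i1 \<noteq> d 0" by blast
  define h where "h = (\<Prod>i<n. [:- d i, 1:])"
  have h0: "h \<noteq> 0" by (simp add: h_def)
  have h_root: "poly h (d i) = 0" if "i < n" for i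
    unfolding h_def poly_prod using that by (intro prod_zero) auto
  define Y where "Y = ?P * complex_mat.peval t h"
  have P_comm: "?P * complex_mat.peval t p = complex_mat.peval t p * ?P" for p
    by (rule complex_mat.peval_commutes) (simp_all add: index_proj_scalar PS)
  have P_P: "?P * (?P * Z) = ?P * Z" for Z by (simp flip: mult.assoc)
  have Y_supp: "supported {..<n} Y"
    unfolding supported_iff Y_def by (simp add: P_comm[symmetric] P_P mult.assoc)
  have "ent Y i j = 0" if "j \<le> i" for i j
    using upper_peval[OF upper, where p = h] h_root[of i] that
    by (cases "j = i") (auto simp: Y_def d_def)
  then have "Y ^ n = 0" by (rule strictly_upper_nilpotent[OF _ Y_supp n])
  have "Y ^ k * ?P = ?P * complex_mat.peval t (h ^ k)" for k
  proof (induct k)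
    case (Suc k)
    have "Y ^ Suc k * ?P = Y * (?P * complex_mat.peval t (h ^ k))" using Suc by (simp add: mult.assoc)
    also have "\<dots> = Y * ?P * complex_mat.peval t (h ^ k)" by (simp only: mult.assoc)
    also have "Y * ?P = Y" by (rule supported_right[OF Y_supp])
    finally show ?case by (simp add: Y_def complex_mat.peval_mult mult.assoc)
  qed simp
  then have ann: "?P * complex_mat.peval t (h ^ n) = 0" using \<open>Y ^ n = 0\<close> by (metis mult_zero_left)
  obtain q where q: "h ^ n dvd q * q - q" "poly q (d 0) = 1" "poly q (d i1) = 0"
    using idempotent_polynomial[of "h ^ n" "d 0" "d i1"] h0 h_root[OF n] h_root[OF i1(1)] i1(2) n
    by (auto simp: poly_power)
  define Q where "Q = ?P * complex_mat.peval C q"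
  define R where "R = ?P * complex_mat.peval t q"
  have QR: "Q = S * R * S'" unfolding Q_def R_def by (rule conj)
  have R_P: "R * ?P = R" "?P * R = R"
    by (simp_all add: R_def P_comm[symmetric] P_P mult.assoc)
  have "R * R = R"
  proof -
    obtain g where "q * q - q = h ^ n * g" using q(1) by (auto elim: dvdE)
    then have "?P * (complex_mat.peval t q * complex_mat.peval t q - complex_mat.peval t q)
        = ?P * complex_mat.peval t (h ^ n) * complex_mat.peval t g"
      by (simp add: mult.assoc flip: complex_mat.peval_mult complex_mat.peval_diff)
    then have "?P * (complex_mat.peval t q * complex_mat.peval t q) = R"
      by (simp add: ann right_diff_distrib R_def)
    moreover have "R * R = R * ?P * complex_mat.peval t q" by (simp add: R_def mult.assoc)
    ultimately show ?thesis by (simp add: R_P(1)) (simp add: R_def mult.assoc)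
  qed
  have "Q * Q = S * R * (S' * S) * R * S'" by (simp add: QR mult.assoc)
  also have "\<dots> = S * (R * ?P * R) * S'" by (simp add: S(5) mult.assoc)
  also have "\<dots> = Q" by (simp add: R_P \<open>R * R = R\<close> QR)
  finally have "Q * Q = Q" .
  moreover have "Q \<noteq> scalar c * ?P" for c
  proof
    assume Q: "Q = scalar c * ?P"
    have "S' * Q * S = (S' * S) * R * (S' * S)" by (simp add: QR mult.assoc)
    also have "\<dots> = R" by (simp add: S(5) R_P)
    also have "S' * Q * S = scalar c * (S' * ?P * S)"
      by (simp add: Q mult.assoc scalar_complex_left_comm[of S'])
    finally have "R = scalar c * ?P" by (simp add: PS S(5) mult.assoc)
    then have "ent R i i = c" if "i < n" for i using that by simp
    moreover have "ent R i i = poly q (d i)" if "i < n" for i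
      using that upper_peval(2)[OF upper] by (simp add: R_def d_def)
    ultimately have "poly q (d 0) = c" "poly q (d i1) = c" using n i1(1) by metis+
    then show False using q by simp
  qed
  ultimately show ?thesis using Q_def by blast
qed

section \<open>Strong irreducibility implies nilpotency\<close>

lift_definition map_lfmat :: "('a::zero \<Rightarrow> 'b::zero) \<Rightarrow> 'a lfmat \<Rightarrow> 'b lfmat"
  is "\<lambda>f g i j. if g i j = 0 then 0 else f (g i j)"
proof (intro conjI allI)
  fix f :: "'a \<Rightarrow> 'b" and g :: "nat \<Rightarrow> nat \<Rightarrow> 'a" and i
  assume *: "(\<forall>i. finite {j. g i j \<noteq> 0}) \<and> (\<forall>j. finite {i. g i j \<noteq> 0})"
  show "finite {j. (if g i j = 0 then 0 else f (g i j)) \<noteq> 0}"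
    by (rule finite_subset[of _ "{j. g i j \<noteq> 0}"]) (use * in auto)
  show "finite {j. (if g j i = 0 then 0 else f (g j i)) \<noteq> 0}"
    by (rule finite_subset[of _ "{j. g j i \<noteq> 0}"]) (use * in auto)
qed

context abelian_vna
begin

lemma norm_convergent:
  assumes a: "\<And>k. a k \<in> A" and step: "\<And>k. bop_norm (a (Suc k) - a k) \<le> (1/2) ^ Suc k"
  shows "\<exists>b\<in>A. \<forall>k. bop_norm (a k - b) \<le> (1/2) ^ k"
proof -
  have tail: "bop_norm (a (k + j) - a k) \<le> (1/2) ^ k - (1/2) ^ (k + j)" for k j
  proof (induct j)
    case (Suc j)
    have "bop_norm (a (k + Suc j) - a k)
        \<le> bop_norm (a (Suc (k + j)) - a (k + j)) + bop_norm (a (k + j) - a k)"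
      using bop_norm_add[of "a (Suc (k + j)) - a (k + j)" "a (k + j) - a k"] by simp
    also have "\<dots> \<le> (1/2) ^ Suc (k + j) + ((1/2) ^ k - (1/2) ^ (k + j))"
      by (rule add_mono[OF step Suc])
    finally show ?case by simp
  qed simp
  have tail': "norm (a m \<rhd> x - a k \<rhd> x) \<le> (1/2) ^ k * norm x" if km: "k \<le> m" for k m x
  proof -
    obtain j where j: "m = k + j" using le_Suc_ex[OF km] by blast
    have "norm ((a m - a k) \<rhd> x) \<le> bop_norm (a m - a k) * norm x" by (rule bop_norm)
    also have "\<dots> \<le> (1/2) ^ k * norm x"
    proof (rule mult_right_mono)
      show "bop_norm (a m - a k) \<le> (1/2) ^ k"
        using tail[of k j] unfolding j by (rule order_trans) simp
    qed simp
    finally show ?thesis by simp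
  qed
  have "Cauchy (\<lambda>k. a k \<rhd> x)" for x
  proof (rule metric_CauchyI)
    fix e :: real assume e: "0 < e"
    have "0 < e / (2 * (norm x + 1))" using e by (simp add: add_nonneg_pos)
    then obtain M where M: "(1/2) ^ M < e / (2 * (norm x + 1))"
      using real_arch_pow_inv[of "e / (2 * (norm x + 1))" "1/2"] by auto
    have nx: "0 < norm x + 1" by (simp add: add_nonneg_pos)
    have small: "(1/2) ^ M * norm x < e / 2"
    proof -
      have "(1/2::real) ^ M * norm x \<le> (1/2) ^ M * (norm x + 1)" by (intro mult_left_mono) auto
      also have "\<dots> < e / (2 * (norm x + 1)) * (norm x + 1)" using M nx by (intro mult_strict_right_mono)
      also have "\<dots> = e / 2" using nx by (simp add: field_simps)
      finally show ?thesis .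
    qed
    have "dist (a i \<rhd> x) (a j \<rhd> x) < e" if "M \<le> i" "M \<le> j" for i j
    proof -
      have "dist (a i \<rhd> x) (a j \<rhd> x) \<le> dist (a i \<rhd> x) (a M \<rhd> x) + dist (a j \<rhd> x) (a M \<rhd> x)"
        by (rule dist_triangle2)
      then show ?thesis using tail'[OF that(1), of x] tail'[OF that(2), of x] small by (simp add: dist_norm)
    qed
    then show "\<exists>M. \<forall>i\<ge>M. \<forall>j\<ge>M. dist (a i \<rhd> x) (a j \<rhd> x) < e" by blast
  qed
  moreover have "norm (a k \<rhd> x) \<le> (bop_norm (a 0) + 1) * norm x" for k x
  proof -
    have "norm (a k \<rhd> x) \<le> norm (a k \<rhd> x - a 0 \<rhd> x) + norm (a 0 \<rhd> x)"
      using norm_triangle_sub[of "a k \<rhd> x" "a 0 \<rhd> x"] by simp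
    then show ?thesis using tail'[of 0 k x] bop_norm[of "a 0" x] by (simp add: algebra_simps)
  qed
  ultimately obtain b where b: "b \<in> A" "\<And>x. (\<lambda>k. a k \<rhd> x) \<longlonglongrightarrow> b \<rhd> x"
    using strong_limit[of a "bop_norm (a 0) + 1", OF a] by blast
  have "bop_norm (a k - b) \<le> (1/2) ^ k" for k
  proof (rule bop_norm_le)
    fix x
    have "norm (b \<rhd> x - a k \<rhd> x) \<le> (1/2) ^ k * norm x"
    proof (rule LIMSEQ_le_const2)
      show "(\<lambda>m. norm (a m \<rhd> x - a k \<rhd> x)) \<longlonglongrightarrow> norm (b \<rhd> x - a k \<rhd> x)"
        by (intro tendsto_intros b)
    qed (use tail' in auto)
    then show "norm ((a k - b) \<rhd> x) \<le> (1/2) ^ k * norm x" by (simp add: norm_minus_commute)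
  qed simp
  with b(1) show ?thesis by blast
qed

text \<open>Convergence in this norm is convergence of the entries, and the norm is submultiplicative.\<close>

definition mat_norm :: "nat set \<Rightarrow> 'a bop lfmat \<Rightarrow> real" where
  "mat_norm I X = (\<Sum>i\<in>I. \<Sum>j\<in>I. bop_norm (ent X i j))"

lemma mat_norm_nonneg [simp]: "0 \<le> mat_norm I X"
  by (simp add: mat_norm_def sum_nonneg)

lemma mat_norm_add: "mat_norm I (X + Y) \<le> mat_norm I X + mat_norm I Y"
  unfolding mat_norm_def sum.distrib[symmetric] by (intro sum_mono) (simp add: bop_norm_add)

lemma mat_norm_minus [simp]: "mat_norm I (- X) = mat_norm I X"
  by (simp add: mat_norm_def)

lemma mat_norm_diff: "mat_norm I (X - Y) \<le> mat_norm I X + mat_norm I Y"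
  using mat_norm_add[of I X "- Y"] by simp

lemma mat_norm_mult:
  assumes "finite I" "X \<in> mats I"
  shows "mat_norm I (X * Y) \<le> mat_norm I X * mat_norm I Y"
proof -
  have "mat_norm I (X * Y) \<le> (\<Sum>i\<in>I. \<Sum>j\<in>I. \<Sum>k\<in>I. bop_norm (ent X i k) * bop_norm (ent Y k j))"
    unfolding mat_norm_def
  proof (intro sum_mono)
    fix i j
    have "bop_norm (ent (X * Y) i j) \<le> (\<Sum>k\<in>I. bop_norm (ent X i k * ent Y k j))"
      using assms bop_norm_sum by (simp add: ent_times_mats)
    also have "\<dots> \<le> (\<Sum>k\<in>I. bop_norm (ent X i k) * bop_norm (ent Y k j))"
      by (intro sum_mono bop_norm_mult)
    finally show "bop_norm (ent (X * Y) i j) \<le> (\<Sum>k\<in>I. bop_norm (ent X i k) * bop_norm (ent Y k j))" .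
  qed
  also have "\<dots> = (\<Sum>i\<in>I. \<Sum>k\<in>I. bop_norm (ent X i k) * (\<Sum>j\<in>I. bop_norm (ent Y k j)))"
    unfolding sum_distrib_left by (rule sum.cong[OF refl], rule sum.swap)
  also have "\<dots> \<le> (\<Sum>i\<in>I. \<Sum>k\<in>I. bop_norm (ent X i k) * mat_norm I Y)"
  proof (intro sum_mono mult_left_mono)
    fix k assume "k \<in> I"
    then show "(\<Sum>j\<in>I. bop_norm (ent Y k j)) \<le> mat_norm I Y"
      unfolding mat_norm_def using assms(1)
      by (intro member_le_sum[of k I "\<lambda>k. \<Sum>j\<in>I. bop_norm (ent Y k j)"]) (auto intro: sum_nonneg)
  qed simp
  also have "\<dots> = mat_norm I X * mat_norm I Y" by (simp add: mat_norm_def sum_distrib_right)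
  finally show ?thesis .
qed

lemma bop_norm_ent_le:
  assumes "finite I" "i \<in> I" "j \<in> I" shows "bop_norm (ent X i j) \<le> mat_norm I X"
proof -
  have "bop_norm (ent X i j) \<le> (\<Sum>j\<in>I. bop_norm (ent X i j))"
    using assms by (intro member_le_sum) auto
  also have "\<dots> \<le> mat_norm I X"
    unfolding mat_norm_def using assms
    by (intro member_le_sum[of i I "\<lambda>i. \<Sum>j\<in>I. bop_norm (ent X i j)"]) (auto intro: sum_nonneg)
  finally show ?thesis .
qed

lemma mat_norm_small_eq_0:
  assumes "finite I" "X \<in> mats I" "\<And>k. mat_norm I X \<le> K * (1/2) ^ k"
  shows "X = 0"
proof -
  have "(\<lambda>k. K * (1/2) ^ k) \<longlonglongrightarrow> K * 0" by (intro tendsto_intros LIMSEQ_realpow_zero) auto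
  then have "mat_norm I X \<le> K * 0" using assms(3) by (intro LIMSEQ_le_const) auto
  then have le: "mat_norm I X \<le> 0" by simp
  show ?thesis
  proof (rule lfmat_eqI)
    fix i j
    show "ent X i j = ent 0 i j"
    proof (cases "i \<in> I \<and> j \<in> I")
      case True
      then have "bop_norm (ent X i j) \<le> 0" using bop_norm_ent_le[OF assms(1), of i j X] le by simp
      then have "bop_norm (ent X i j) = 0" using bop_norm_nonneg by (rule antisym)
      then show ?thesis using bop_norm_eq_0 by simp
    next
      case False
      then show ?thesis using supported_ent[OF matsD(2)[OF assms(2)]] by auto
    qed
  qed
qed

end

text \<open>For \<open>X' = 3 X\<^sup>2 - 2 X\<^sup>3\<close> the defect \<open>Y = X\<^sup>2 - X\<close> is replaced by \<open>4 Y\<^sup>3 - 3 Y\<^sup>2\<close>, so it decreases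
  quadratically.\<close>

lemma newton_step:
  fixes X :: "'r::ring"
  defines "X' \<equiv> X * X + X * X + X * X - (X * X * X + X * X * X)" and "Y \<equiv> X * X - X"
  shows "X' * X' - X' = (Y * Y + Y * Y + Y * Y + Y * Y) * Y - (Y * Y + Y * Y + Y * Y)"
    and "X' - X = Y - (X * Y + X * Y)"
  unfolding X'_def Y_def by (simp_all add: algebra_simps)

context point
begin

abbreviation eval_mat :: "'a bop lfmat \<Rightarrow> complex lfmat" where
  "eval_mat \<equiv> map_lfmat (character F)"

lemma ent_eval_mat [simp]: "ent (eval_mat X) i j = character F (ent X i j)"
  by (simp add: map_lfmat.rep_eq)

lemma character_bound: "a \<in> A \<Longrightarrow> cmod (character F a) \<le> bop_norm a"
proof (rule field_le_epsilon)
  fix \<epsilon> :: real assume a: "a \<in> A" and \<epsilon>: "0 < \<epsilon>"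
  define c where "c = character F a"
  obtain e where e: "e \<in> F" "bop_norm ((a - bop_scale c 1) * e) \<le> \<epsilon>"
    using value_at_small[OF value_at_character[OF a] \<epsilon>] by (auto simp: c_def)
  obtain y where y: "y \<noteq> 0" "e \<rhd> y = y" using F_fixed_vector[OF e(1)] by blast
  have "norm (a \<rhd> y - c *\<^sub>C y) \<le> \<epsilon> * norm y"
    using order_trans[OF bop_norm[of "(a - bop_scale c 1) * e" y] mult_right_mono[OF e(2)]]
    by (simp add: y(2))
  moreover have "cmod c * norm y \<le> norm (a \<rhd> y) + norm (a \<rhd> y - c *\<^sub>C y)"
    using norm_triangle_sub[of "c *\<^sub>C y" "a \<rhd> y"] by (simp add: norm_scaleC norm_minus_commute)
  ultimately have "cmod c * norm y \<le> (bop_norm a + \<epsilon>) * norm y"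
    using bop_norm[of a y] by (simp add: algebra_simps)
  then show "cmod (character F a) \<le> bop_norm a + \<epsilon>" using y(1) by (simp add: c_def)
qed

lemma character_minus: "a \<in> A \<Longrightarrow> character F (- a) = - character F a"
  using character_add[of a "- a"] by (simp add: eq_neg_iff_add_eq_0 add.commute)

lemma character_diff: "a \<in> A \<Longrightarrow> b \<in> A \<Longrightarrow> character F (a - b) = character F a - character F b"
  using character_add[of a "- b"] by (simp add: character_minus)

lemma eval_mat_add: "X \<in> full \<Longrightarrow> Y \<in> full \<Longrightarrow> eval_mat (X + Y) = eval_mat X + eval_mat Y"
  by (rule lfmat_eqI) (simp add: character_add fullD)

lemma eval_mat_diff: "X \<in> full \<Longrightarrow> Y \<in> full \<Longrightarrow> eval_mat (X - Y) = eval_mat X - eval_mat Y"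
  by (rule lfmat_eqI) (simp add: character_diff fullD)

lemma eval_mat_mult:
  assumes "X \<in> full" "Y \<in> full" shows "eval_mat (X * Y) = eval_mat X * eval_mat Y"
proof (rule lfmat_eqI)
  fix i j
  define K where "K = {k. ent X i k \<noteq> 0}"
  have K: "finite K" by (simp add: K_def finite_row)
  have "ent (eval_mat (X * Y)) i j = character F (\<Sum>k\<in>K. ent X i k * ent Y k j)"
    by (simp add: times_lfmat.rep_eq K_def)
  also have "\<dots> = (\<Sum>k\<in>K. character F (ent X i k) * character F (ent Y k j))"
    using assms by (simp add: character_sum character_mult fullD)
  also have "\<dots> = ent (eval_mat X * eval_mat Y) i j"
    using K by (subst ent_times[of K]) (auto simp: K_def)
  finally show "ent (eval_mat (X * Y)) i j = ent (eval_mat X * eval_mat Y) i j" .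
qed

lemma eval_mat_zero [simp]: "eval_mat 0 = 0"
  by (rule lfmat_eqI) simp

lemma eval_mat_index_proj [simp]: "eval_mat (index_proj I) = index_proj I"
  by (rule lfmat_eqI) auto

lemma eval_mat_one [simp]: "eval_mat 1 = 1"
  by (rule lfmat_eqI) simp

lemma eval_mat_scalar: "eval_mat (scalar a) = scalar (character F a)"
  by (rule lfmat_eqI) simp

lemma eval_mat_power: "X \<in> full \<Longrightarrow> eval_mat (X ^ k) = eval_mat X ^ k"
  by (induct k) (simp_all add: eval_mat_mult)

lemma supported_eval_mat: "supported I X \<Longrightarrow> supported I (eval_mat X)"
  by (metis (no_types, lifting) character_zero ent_eval_mat supported_def)

text \<open>An idempotent value of \<open>X\<close> lifts to an idempotent that commutes with everything that
  commutes with \<open>X\<close>: on a small projection \<open>e\<close> of the ultrafilter \<open>X\<close> is nearly idempotent, and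
  Newton's iteration \<open>X \<mapsto> 3 X\<^sup>2 - 2 X\<^sup>3\<close>, which does not change the value, converges in norm.\<close>

lemma idempotent_lifting:
  assumes fin: "finite I" and X: "X \<in> mats I" and N: "N \<in> mats I" and XN: "X * N = N * X"
    and idem: "eval_mat X * eval_mat X = eval_mat X"
  shows "\<exists>Q\<in>mats I. Q * Q = Q \<and> Q * N = N * Q \<and> eval_mat Q = eval_mat X"
proof -
  define B where "B = mat_norm I X"
  have B: "0 \<le> B" by (simp add: B_def)
  \<comment> \<open>With an initial defect \<open>\<eta>\<close>, step \<open>k\<close> changes the iterate by at most \<open>(2 B + 3) \<eta> / 2^k\<close>, and
    \<open>\<eta>\<close> is so small that these changes add up to at most \<open>1\<close>.\<close>
  define \<eta> where "\<eta> = 1 / (2 * (2 * B + 3) * 8)"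
  have "2 * B + 3 \<ge> 3" using B by simp
  then have \<eta>: "0 < \<eta>" "\<eta> \<le> 1 / 8" "(2 * B + 3) * \<eta> \<le> 1 / 2"
    by (simp_all add: \<eta>_def field_simps)
  define Y where "Y = X * X - X"
  have Y: "Y \<in> mats I" using X by (simp add: Y_def)
  \<comment> \<open>A bound for the number of entries, positive also for empty \<open>I\<close>.\<close>
  define m where "m = real (card I) * real (card I) + 1"
  have m: "0 < m" by (simp add: m_def add_nonneg_pos)
  have "\<exists>e\<in>F. bop_norm (ent Y i j * e) \<le> \<eta> / m" for i j
  proof -
    have "ent (eval_mat Y) i j = 0"
      using X idem by (simp add: Y_def eval_mat_diff eval_mat_mult matsD del: ent_eval_mat)
    then have "character F (ent Y i j) = 0" by simp
    then have "value_at F (ent Y i j) 0" using value_at_character[of "ent Y i j"] Y by simp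
    from value_at_small[OF this, of "\<eta> / m"] show ?thesis using \<eta> m by simp
  qed
  then obtain g where g: "\<And>i j. g i j \<in> F" "\<And>i j. bop_norm (ent Y i j * g i j) \<le> \<eta> / m" by metis
  have fold: "\<exists>e\<in>F. \<forall>(i, j)\<in>S. bop_norm (ent Y i j * e) \<le> \<eta> / m" if "finite S" for S
    using that
  proof (induct S rule: finite_induct)
    case empty
    then show ?case using one_in_F by blast
  next
    case (insert p S)
    then obtain e where e: "e \<in> F" "\<And>i j. (i, j) \<in> S \<Longrightarrow> bop_norm (ent Y i j * e) \<le> \<eta> / m" by blast
    obtain a b where p: "p = (a, b)" by (cases p)
    have "bop_norm (ent Y i j * (e * g a b)) \<le> \<eta> / m" if "(i, j) \<in> insert p S" for i j
    proof (cases "(i, j) = p")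
      case True
      then show ?thesis using order_trans[OF bop_norm_restrict(2)[OF e(1) g(1)] g(2)] by (simp add: p)
    next
      case False
      then have "(i, j) \<in> S" using that by simp
      from order_trans[OF bop_norm_restrict(1)[OF e(1) g(1)] e(2)[OF this]] show ?thesis .
    qed
    then show ?case using F_mult[OF e(1) g(1)] by (intro bexI[of _ "e * g a b"]) auto
  qed
  obtain e where e: "e \<in> F" "\<And>i j. i \<in> I \<Longrightarrow> j \<in> I \<Longrightarrow> bop_norm (ent Y i j * e) \<le> \<eta> / m"
    using fold[of "I \<times> I"] fin by auto
  have e_in: "e \<in> A" using e(1) by (rule F_in)
  define Z where "Z = rec_nat (scalar e * X) (\<lambda>_ X. X * X + X * X + X * X - (X * X * X + X * X * X))"
  have Z0: "Z 0 = scalar e * X" and ZS: "Z (Suc k) = Z k * Z k + Z k * Z k + Z k * Z k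
      - (Z k * Z k * Z k + Z k * Z k * Z k)" for k by (simp_all add: Z_def)
  define y where "y k = Z k * Z k - Z k" for k
  have Z: "Z k \<in> mats I" for k
    by (induct k) (simp_all add: Z0 ZS X e_in)
  have y: "y k \<in> mats I" for k using Z by (simp add: y_def)
  have ZN: "Z k * N = N * Z k" for k
  proof (induct k)
    case 0
    then show ?case using scalar_left_comm[OF matsD(1)[OF N] e_in] XN by (simp add: Z0 mult.assoc)
  next
    case (Suc k)
    have "Z k * (N * W) = N * (Z k * W)" for W using Suc by (simp flip: mult.assoc)
    then show ?case by (simp add: ZS algebra_simps Suc)
  qed
  have Z_eval: "eval_mat (Z k) = eval_mat X" for k
  proof (induct k)
    case 0
    have "eval_mat (scalar e * X) = scalar 1 * eval_mat X"
      using matsD(1)[OF X] e_in by (simp add: eval_mat_mult eval_mat_scalar character_projection[OF e(1)] del: scalar_one)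
    then show ?case by (simp add: Z0)
  next
    case (Suc k)
    then show ?case
      using matsD(1)[OF Z[of k]] by (simp add: ZS eval_mat_diff eval_mat_add eval_mat_mult idem mult.assoc)
  qed
  have mult: "mat_norm I (U * V) \<le> u * v" if "mat_norm I U \<le> u" "mat_norm I V \<le> v" "U \<in> mats I" for U V u v
  proof -
    have "0 \<le> u" using mat_norm_nonneg that(1) by (rule order_trans)
    then show ?thesis
      using order_trans[OF mat_norm_mult[OF fin that(3)] mult_mono[OF that(1,2)]] by simp
  qed
  have add: "mat_norm I (U + V) \<le> u + v" if "mat_norm I U \<le> u" "mat_norm I V \<le> v" for U V u v
    using order_trans[OF mat_norm_add add_mono[OF that]] .
  have sub: "mat_norm I (U - V) \<le> u + v" if "mat_norm I U \<le> u" "mat_norm I V \<le> v" for U V u v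
    using order_trans[OF mat_norm_diff add_mono[OF that]] .
  have est: "mat_norm I (y k) \<le> \<eta> * (1/2) ^ k \<and> mat_norm I (Z k) \<le> B + 1 - (1/2) ^ k" for k
  proof (induct k)
    case 0
    have "y 0 = scalar e * Y"
      using scalar_left_comm[OF matsD(1)[OF X] e_in, of X] F_idem[OF e(1)]
      by (simp add: y_def Z0 Y_def right_diff_distrib mult.assoc) (simp flip: mult.assoc scalar_mult)
    then have "ent (y 0) i j = ent Y i j * e" for i j using comm[OF e_in, of "ent Y i j"] Y by simp
    then have "mat_norm I (y 0) \<le> (\<Sum>i\<in>I. \<Sum>j\<in>I. \<eta> / m)"
      unfolding mat_norm_def using e(2) by (intro sum_mono) simp
    also have "\<dots> = real (card I) * real (card I) * (\<eta> / m)" by simp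
    also have "\<dots> \<le> m * (\<eta> / m)" using \<eta> m by (intro mult_right_mono) (auto simp: m_def)
    also have "\<dots> = \<eta>" using m by simp
    finally have "mat_norm I (y 0) \<le> \<eta>" .
    moreover have "mat_norm I (Z 0) \<le> B"
      unfolding mat_norm_def B_def Z0
    proof (intro sum_mono)
      fix i j
      have "bop_norm (e * ent X i j) \<le> 1 * bop_norm (ent X i j)"
        by (rule order_trans[OF bop_norm_mult mult_right_mono[OF bop_norm_projection[OF e(1)]]]) simp
      then show "bop_norm (ent (scalar e * X) i j) \<le> bop_norm (ent X i j)" by simp
    qed
    ultimately show ?case by simp
  next
    case (Suc k)
    define h where "h = \<eta> * (1/2) ^ k"
    have h: "0 \<le> h" "h \<le> 1 / 8"
    proof -
      show "0 \<le> h" using \<eta> by (simp add: h_def)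
      have "h \<le> \<eta> * 1" unfolding h_def using \<eta> by (intro mult_left_mono power_le_one) auto
      then show "h \<le> 1 / 8" using \<eta> by simp
    qed
    have yk: "mat_norm I (y k) \<le> h" and Zk: "mat_norm I (Z k) \<le> B + 1 - (1/2) ^ k"
      using Suc by (simp_all add: h_def)
    have yy: "mat_norm I (y k * y k) \<le> h * h" using yk y by (intro mult)
    have "mat_norm I (y (Suc k)) \<le> (h * h + h * h + h * h + h * h) * h + (h * h + h * h + h * h)"
    proof -
      have "y (Suc k) = (y k * y k + y k * y k + y k * y k + y k * y k) * y k
          - (y k * y k + y k * y k + y k * y k)"
        unfolding y_def[of "Suc k"] ZS y_def[of k] by (rule newton_step(1))
      then show ?thesis using y by (simp only:) (intro sub mult add yy yk mats_add mats_mult y)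
    qed
    also have "\<dots> = h * (h * (4 * h + 3))" by (simp add: algebra_simps)
    also have "\<dots> \<le> h * (1 / 2)"
    proof (rule mult_left_mono[OF _ h(1)])
      have "h * (4 * h + 3) \<le> 1 / 8 * 4" using h by (intro mult_mono) auto
      then show "h * (4 * h + 3) \<le> 1 / 2" by simp
    qed
    finally have 1: "mat_norm I (y (Suc k)) \<le> \<eta> * (1/2) ^ Suc k" by (simp add: h_def)
    have Z_Suc: "Z (Suc k) = Z k + (y k - (Z k * y k + Z k * y k))"
      using newton_step(2)[of "Z k"] by (simp add: ZS y_def algebra_simps)
    have "mat_norm I (Z (Suc k)) \<le> (B + 1 - (1/2) ^ k) + (h + ((B + 1) * h + (B + 1) * h))"
    proof -
      have ZB: "mat_norm I (Z k) \<le> B + 1" using Zk by (rule order_trans) simp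
      show ?thesis unfolding Z_Suc
        by (intro add sub mult Zk yk ZB Z)
    qed
    also have "h + ((B + 1) * h + (B + 1) * h) = ((2 * B + 3) * \<eta>) * (1/2) ^ k"
      by (simp add: h_def algebra_simps)
    also have "\<dots> \<le> (1 / 2) * (1/2) ^ k" by (intro mult_right_mono \<eta>) simp
    finally have "mat_norm I (Z (Suc k)) \<le> B + 1 - (1/2) ^ Suc k" by simp
    with 1 show ?case by blast
  qed
  have ZB: "mat_norm I (Z k) \<le> B + 1" for k
    using conjunct2[OF est[of k]] by (rule order_trans) simp
  have step: "mat_norm I (Z (Suc k) - Z k) \<le> (1/2) ^ Suc k" for k
  proof -
    have "Z (Suc k) - Z k = y k - (Z k * y k + Z k * y k)"
      using newton_step(2)[of "Z k"] by (simp add: ZS y_def)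
    then have "mat_norm I (Z (Suc k) - Z k) \<le> \<eta> * (1/2) ^ k + ((B + 1) * (\<eta> * (1/2) ^ k) + (B + 1) * (\<eta> * (1/2) ^ k))"
      using est[of k] by (simp only:) (intro sub add mult ZB Z, auto)
    also have "\<dots> = ((2 * B + 3) * \<eta>) * (1/2) ^ k" by (simp add: algebra_simps)
    also have "\<dots> \<le> (1 / 2) * (1/2) ^ k" by (intro mult_right_mono \<eta>) simp
    finally show ?thesis by simp
  qed
  have "\<exists>b\<in>A. \<forall>k. bop_norm (ent (Z k) i j - b) \<le> (1/2) ^ k" if "i \<in> I" "j \<in> I" for i j
  proof (rule norm_convergent)
    fix k
    show "ent (Z k) i j \<in> A" by (rule mats_ent[OF Z])
    show "bop_norm (ent (Z (Suc k)) i j - ent (Z k) i j) \<le> (1/2) ^ Suc k"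
      using order_trans[OF bop_norm_ent_le[OF fin that] step[of k]] by simp
  qed
  then obtain L where L: "\<And>i j. i \<in> I \<Longrightarrow> j \<in> I \<Longrightarrow> L i j \<in> A"
    "\<And>i j k. i \<in> I \<Longrightarrow> j \<in> I \<Longrightarrow> bop_norm (ent (Z k) i j - L i j) \<le> (1/2) ^ k"
    by metis
  define Q where "Q = (\<Sum>i\<in>I. \<Sum>j\<in>I. scalar (L i j) * munit i j)"
  have Q: "Q \<in> mats I" unfolding Q_def using L(1) by (intro mats_sum mats_scalar mats_munit)
  have Q_ent: "ent Q a b = L a b" if "a \<in> I" "b \<in> I" for a b
  proof -
    have "ent Q a b = (\<Sum>i\<in>I. \<Sum>j\<in>I. if b = j then (if a = i then L i j else 0) else 0)"
      unfolding Q_def ent_sum by (intro sum.cong refl) auto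
    then show ?thesis using fin that by (simp add: sum.delta)
  qed
  have QZ: "mat_norm I (Z k - Q) \<le> m * (1/2) ^ k" for k
  proof -
    have "mat_norm I (Z k - Q) \<le> (\<Sum>i\<in>I. \<Sum>j\<in>I. (1/2) ^ k)"
      unfolding mat_norm_def by (intro sum_mono) (simp add: Q_ent L)
    also have "\<dots> \<le> m * (1/2) ^ k" by (simp add: m_def distrib_right)
    finally show ?thesis .
  qed
  define q where "q = mat_norm I Q"
  have "Q * Q - Q = 0"
  proof (rule mat_norm_small_eq_0[OF fin])
    fix k
    have "Q * Q - Q = y k + (Z k - Q) - (Z k * (Z k - Q) + (Z k - Q) * Q)"
      by (simp add: y_def algebra_simps)
    then have "mat_norm I (Q * Q - Q) \<le> (\<eta> * (1/2) ^ k + m * (1/2) ^ k)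
        + ((B + 1) * (m * (1/2) ^ k) + (m * (1/2) ^ k) * q)"
      using est[of k] Z Q by (simp only:) (intro sub add mult ZB QZ, auto simp: q_def)
    also have "\<dots> = (\<eta> + m + (B + 1) * m + m * q) * (1/2) ^ k" by (simp add: algebra_simps)
    finally show "mat_norm I (Q * Q - Q) \<le> (\<eta> + m + (B + 1) * m + m * q) * (1/2) ^ k" .
  qed (use Q in simp)
  moreover have "Q * N - N * Q = 0"
  proof (rule mat_norm_small_eq_0[OF fin])
    fix k
    have "Q * N - N * Q = N * (Z k - Q) - (Z k - Q) * N"
      using ZN[of k] by (simp add: algebra_simps)
    then have "mat_norm I (Q * N - N * Q) \<le> mat_norm I N * (m * (1/2) ^ k) + (m * (1/2) ^ k) * mat_norm I N"
      using Z Q N by (simp only:) (intro sub mult QZ, auto)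
    also have "\<dots> = (mat_norm I N * m + m * mat_norm I N) * (1/2) ^ k" by (simp add: algebra_simps)
    finally show "mat_norm I (Q * N - N * Q) \<le> (mat_norm I N * m + m * mat_norm I N) * (1/2) ^ k" .
  qed (use Q N in simp)
  moreover have "eval_mat Q = eval_mat X"
  proof (rule lfmat_eqI)
    fix i j
    show "ent (eval_mat Q) i j = ent (eval_mat X) i j"
    proof (cases "i \<in> I \<and> j \<in> I")
      case True
      have le: "cmod (ent (eval_mat X) i j - ent (eval_mat Q) i j) \<le> 1 * (1/2) ^ k" for k
      proof -
        have "ent (eval_mat X) i j - ent (eval_mat Q) i j = character F (ent (Z k) i j - L i j)"
          using True mats_ent[OF Z[of k]] L(1) by (simp add: character_diff Q_ent flip: Z_eval[of k])
        then show ?thesis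
          using order_trans[OF character_bound[of "ent (Z k) i j - L i j"] L(2)] True
            mats_ent[OF Z[of k]] L(1) by simp
      qed
      have "(\<lambda>k. 1 * (1/2 :: real) ^ k) \<longlonglongrightarrow> 1 * 0" by (intro tendsto_intros LIMSEQ_realpow_zero) auto
      then have "cmod (ent (eval_mat X) i j - ent (eval_mat Q) i j) \<le> 1 * 0"
        using le by (intro LIMSEQ_le_const) auto
      then show ?thesis by simp
    next
      case False
      then show ?thesis
        using supported_ent[OF matsD(2)[OF Q], of i j] supported_ent[OF matsD(2)[OF X], of i j] by auto
    qed
  qed
  ultimately show ?thesis using Q by (intro bexI[of _ Q]) auto
qed

lemma eval_mat_peval:
  assumes "N \<in> full"
  shows "\<exists>Y\<in>full. eval_mat Y = complex_mat.peval (eval_mat N) p \<and> (\<forall>X\<in>full. X * N = N * X \<longrightarrow> X * Y = Y * X)"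
proof (induct p)
  case 0
  then show ?case by (intro bexI[of _ 0]) auto
next
  case (pCons a p)
  then obtain Y where Y: "Y \<in> full" "eval_mat Y = complex_mat.peval (eval_mat N) p"
    "\<And>X. X \<in> full \<Longrightarrow> X * N = N * X \<Longrightarrow> X * Y = Y * X" by blast
  define W where "W = scalar (bop_scale a 1) + N * Y"
  have "W \<in> full" using Y assms by (simp add: W_def)
  moreover have "eval_mat W = complex_mat.peval (eval_mat N) (pCons a p)"
    using Y(1,2) assms by (simp add: W_def eval_mat_add eval_mat_mult eval_mat_scalar character_scalar complex_mat.peval_pCons)
  moreover have "X * W = W * X" if X: "X \<in> full" "X * N = N * X" for X
  proof -
    have "X * (N * Y) = N * (X * Y)" using X(2) by (simp flip: mult.assoc)
    then have "X * (N * Y) = N * Y * X" using Y(3)[OF X] by (simp add: mult.assoc)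
    then show ?thesis using scalar_comm[OF X(1), of "bop_scale a 1"] by (simp add: W_def distrib_left distrib_right)
  qed
  ultimately show ?case by blast
qed

end

text \<open>If \<open>N^n\<close> is not \<open>0\<close>, then neither is \<open>C^n\<close> for the value \<open>C\<close> of \<open>N\<close> at some point of the spectrum. As \<open>C\<close>
  has trace \<open>0\<close>, some polynomial in \<open>C\<close> is an idempotent that is not scalar, and it lifts to an
  idempotent that commutes with \<open>N\<close>.\<close>

lemma (in abelian_vna) strongly_irreducible_nilpotent:
  assumes N: "N \<in> mats {..<n}" and n: "n > 0" and irr: "strongly_irreducible {..<n} N"
    and tr: "tr {..<n} N = 0"
  shows "N ^ n = 0"
proof (rule ccontr)
  assume "N ^ n \<noteq> 0"
  then obtain i j where ij: "ent (N ^ n) i j \<noteq> 0" using lfmat_eqI[of "N ^ n" 0] by auto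
  have N_full: "N \<in> full" using N by (rule matsD)
  obtain F where F: "point A F" "character F (ent (N ^ n) i j) \<noteq> 0"
    using character_nonzero[OF _ ij] N_full by (metis full_power fullD)
  interpret point A F by (rule F(1))
  define C where "C = eval_mat N"
  have C: "supported {..<n} C" using N by (simp add: C_def supported_eval_mat matsD)
  have "C ^ n \<noteq> 0"
  proof
    assume "C ^ n = 0"
    then have "ent (eval_mat (N ^ n)) i j = 0"
      using N_full by (simp add: C_def eval_mat_power del: ent_eval_mat)
    then show False using F(2) by simp
  qed
  moreover have "tr {..<n} C = 0"
  proof -
    have "tr {..<n} C = character F (tr {..<n} N)"
      using N by (simp add: tr_def C_def character_sum)
    then show ?thesis by (simp add: tr)
  qed
  ultimately obtain q Q where Q: "Q = index_proj {..<n} * complex_mat.peval C q" "Q * Q = Q"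
    "\<And>c. Q \<noteq> scalar c * index_proj {..<n}"
    using complex_splitting[OF C _ _ n] by blast
  obtain Y where Y: "Y \<in> full" "eval_mat Y = complex_mat.peval C q"
    "\<And>X. X \<in> full \<Longrightarrow> X * N = N * X \<Longrightarrow> X * Y = Y * X"
    using eval_mat_peval[OF N_full, of q] unfolding C_def by blast
  let ?P = "index_proj {..<n} :: 'a bop lfmat"
  have PY: "?P * Y = Y * ?P" by (rule Y(3)) (simp_all add: mats_left[OF N] mats_right[OF N])
  define X where "X = ?P * Y"
  have X_eval: "eval_mat X = Q" using Y(1) by (simp add: X_def eval_mat_mult Y(2) Q(1))
  have P_P: "?P * (?P * W) = ?P * W" for W by (simp flip: mult.assoc)
  have X: "X \<in> mats {..<n}"
    using Y(1) by (simp add: mats_def supported_iff X_def mult.assoc PY[symmetric] P_P)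
  have XN: "X * N = N * X"
  proof -
    have "X * N = ?P * (N * Y)" using Y(3)[OF N_full refl] by (simp add: X_def mult.assoc)
    also have "\<dots> = N * (?P * Y)" by (simp add: mats_left[OF N] mats_right[OF N] flip: mult.assoc)
    finally show ?thesis by (simp add: X_def)
  qed
  obtain R where R: "R \<in> mats {..<n}" "R * R = R" "R * N = N * R" "eval_mat R = eval_mat X"
    using idempotent_lifting[OF _ X N XN] X_eval Q(2) by auto
  obtain p where p: "p \<in> A" "R = scalar p * ?P"
    using irr R unfolding strongly_irreducible_def by blast
  have "Q = scalar (character F p) * index_proj {..<n}"
    using R(4) p by (simp add: X_eval eval_mat_mult eval_mat_scalar)
  with Q(3) show False by blast
qed

section \<open>The structure theorem for locally finite matrices\<close>

context abelian_vna
begin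

text \<open>The only nonzero entry of \<open>t^(n-1)\<close> is in the corner, and it is the product of the superdiagonal.\<close>

lemma superdiagonal_annihilates_power:
  assumes t: "t \<in> mats {..<n}" "\<And>i j. j \<le> i \<Longrightarrow> ent t i j = 0"
    and z: "z \<in> A" "z * ent t j (Suc j) = 0" and j: "Suc j < n"
  shows "scalar z * (index_proj {..<n} * t ^ (n - 1)) = 0"
proof -
  have t_full: "t \<in> full" using t(1) by (rule matsD)
  have path: "z * ent (t ^ d) i (i + d) = 0" if "i \<le> j" "j < i + d" for i d
    using that(2)
  proof (induct d)
    case (Suc d)
    have split: "ent (t ^ Suc d) i (i + Suc d) = ent (t ^ d) i (i + d) * ent t (i + d) (Suc (i + d))"
      by (rule strictly_upper_power_superdiagonal[OF t(2)])
    show ?case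
    proof (cases "j = i + d")
      case True
      have "ent (t ^ d) i (i + d) \<in> A" using t_full by (simp add: fullD)
      from left_comm[OF z(1) this, of "ent t j (Suc j)"] show ?thesis
        unfolding split using True z(2) by simp
    next
      case False
      then have "z * ent (t ^ d) i (i + d) = 0" using Suc by simp
      then show ?thesis unfolding split by (simp flip: mult.assoc)
    qed
  qed (use \<open>i \<le> j\<close> in simp)
  have supp: "supported {..<n} (index_proj {..<n} * t ^ (n - 1))"
    using mats_power[OF t(1)] by (rule matsD)
  show ?thesis
  proof (rule lfmat_eqI)
    fix a b
    consider "a < n" "b < n" "b < a + (n - 1)" | "a < n" "b < n" "a = 0" "b = n - 1" | "\<not> (a < n \<and> b < n)"
      by linarith
    then show "ent (scalar z * (index_proj {..<n} * t ^ (n - 1))) a b = ent 0 a b"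
    proof cases
      case 1
      then show ?thesis using strictly_upper_power_ent[OF t(2), of b a "n - 1"] by simp
    next
      case 2
      then show ?thesis using path[of 0 "n - 1"] j by simp
    next
      case 3
      then have "ent (index_proj {..<n} * t ^ (n - 1)) a b = 0" using supported_ent[OF supp, of a b] by auto
      then show ?thesis by (simp del: ent_index_proj_times)
    qed
  qed
qed

lemma strongly_irreducible_translate:
  assumes "T \<in> mats I" "a \<in> A"
  shows "strongly_irreducible I (T - scalar a * index_proj I) \<longleftrightarrow> strongly_irreducible I T"
proof -
  have "Q * (T - scalar a * index_proj I) = (T - scalar a * index_proj I) * Q \<longleftrightarrow> Q * T = T * Q"
    if "Q \<in> mats I" for Q
  proof -
    have "Q * (scalar a * index_proj I) = scalar a * index_proj I * Q"
      using scalar_left_comm[OF matsD(1)[OF that] assms(2)] that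
      by (simp add: mult.assoc mats_left mats_right)
    then show ?thesis by (simp add: left_diff_distrib right_diff_distrib)
  qed
  then show ?thesis unfolding strongly_irreducible_def by blast
qed

text \<open>Subtracting the scalar \<open>a\<close> turns the three conditions on \<open>V\<^sup>\<star> T V\<close> into strict triangularity and
  regularity of the superdiagonal.\<close>

definition triangular_form :: "nat \<Rightarrow> 'a bop lfmat \<Rightarrow> 'a bop lfmat \<Rightarrow> 'a bop \<Rightarrow> bool" where
  "triangular_form n T V a \<longleftrightarrow> V \<in> mats {..<n} \<and> a \<in> A \<and>
     madj V * V = index_proj {..<n} \<and> V * madj V = index_proj {..<n} \<and>
     (\<forall>i j. j \<le> i \<longrightarrow> ent (madj V * (T - scalar a * index_proj {..<n}) * V) i j = 0) \<and>
     (\<forall>j. Suc j < n \<longrightarrow> regular (ent (madj V * (T - scalar a * index_proj {..<n}) * V) j (Suc j)))"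

text \<open>The scalar \<open>a\<close> is the normalised trace of \<open>T\<close>. A central element that annihilates an entry of the
  superdiagonal annihilates \<open>(T - a)^(n-1)\<close>.\<close>

lemma strongly_irreducible_imp_triangular:
  assumes T: "T \<in> mats {..<n}" and n: "n > 0" and irr: "strongly_irreducible {..<n} T"
  shows "\<exists>V a. triangular_form n T V a"
proof -
  let ?P = "index_proj {..<n} :: 'a bop lfmat"
  define a where "a = bop_scale (1 / of_nat n) (tr {..<n} T)"
  have a: "a \<in> A" using T by (simp add: a_def tr_in matsD)
  define N where "N = T - scalar a * ?P"
  have N: "N \<in> mats {..<n}" using T a by (simp add: N_def)
  have irrN: "strongly_irreducible {..<n} N"
    unfolding N_def using irr strongly_irreducible_translate[OF T a] by simp
  have "tr {..<n} N = 0"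
  proof -
    have "tr {..<n} (scalar a * ?P) = bop_scale (of_nat n) a"
      by (simp add: tr_def sum_const_scale)
    also have "\<dots> = tr {..<n} T" using n by (simp add: a_def)
    finally show ?thesis by (simp add: N_def tr_diff)
  qed
  then have "N ^ n = 0" by (rule strongly_irreducible_nilpotent[OF N n irrN])
  then have "N ^ Suc (n - 1) = 0" using n by simp
  then obtain U where U: "U \<in> full" "madj U * U = 1" "U * madj U = 1" "supported {..<n} (U - 1)"
    "\<And>i j. j \<le> i \<Longrightarrow> ent (madj U * N * U) i j = 0"
    using nilpotent_triangularization[of N 0 n "n - 1"] N by (auto simp: lessThan_atLeast0)
  have UP: "U * ?P = ?P * U"
  proof -
    have "(U - 1) * ?P = ?P * (U - 1)" by (simp add: supported_left[OF U(4)] supported_right[OF U(4)])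
    then show ?thesis by (simp add: algebra_simps)
  qed
  have UP': "madj U * ?P = ?P * madj U" using arg_cong[OF UP, of madj] by (simp add: madj_simps)
  define s where "s = madj U * N * U"
  have s: "s \<in> mats {..<n}"
  proof -
    have "?P * s = madj U * (?P * N) * U" by (simp add: s_def UP' flip: mult.assoc)
    moreover have "s * ?P = madj U * (N * ?P) * U" by (simp add: s_def UP mult.assoc)
    ultimately have "supported {..<n} s"
      by (simp add: supported_iff s_def mats_left[OF N] mats_right[OF N])
    then show ?thesis using U N by (simp add: mats_def s_def)
  qed
  have N_pow: "N ^ k = U * s ^ k * madj U" for k
  proof (induct k)
    case (Suc k)
    have N_eq: "U * s * madj U = N"
    proof -
      have "U * s * madj U = (U * madj U) * N * (U * madj U)" by (simp add: s_def mult.assoc)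
      then show ?thesis by (simp add: U(3))
    qed
    have "N ^ Suc k = (U * s * madj U) * (U * s ^ k * madj U)"
      by (simp only: power_Suc[of N] Suc N_eq)
    also have "\<dots> = U * s * (madj U * U) * s ^ k * madj U" by (simp only: mult.assoc)
    finally show ?case by (simp add: U(2) mult.assoc)
  qed (simp add: U(3))
  define V where "V = U * ?P"
  have V: "V \<in> mats {..<n}"
  proof -
    have "?P * (?P * W) = ?P * W" for W by (simp flip: mult.assoc)
    then have "?P * V = V" "V * ?P = V" by (simp_all add: V_def UP mult.assoc)
    then show ?thesis using U(1) by (simp add: mats_def supported_iff V_def)
  qed
  have "madj V * V = ?P"
  proof -
    have "madj V * V = ?P * (madj U * U) * ?P" by (simp add: V_def madj_simps mult.assoc)
    then show ?thesis by (simp add: U(2))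
  qed
  moreover have "V * madj V = ?P"
  proof -
    have "V * madj V = U * (?P * ?P) * madj U" by (simp only: V_def madj_simps mult.assoc)
    also have "\<dots> = ?P * (U * madj U)" by (simp add: UP mult.assoc)
    finally show ?thesis by (simp add: U(3))
  qed
  moreover have "madj V * N * V = s"
  proof -
    have "madj V * N * V = ?P * s * ?P" by (simp add: V_def madj_simps s_def mult.assoc)
    then show ?thesis by (simp add: mats_left[OF s] mats_right[OF s])
  qed
  moreover have "regular (ent s j (Suc j))" if j: "Suc j < n" for j
    unfolding regular_def
  proof (intro ballI impI)
    fix z assume z: "z \<in> A" "z * ent s j (Suc j) = 0"
    have "scalar z * (?P * s ^ (n - 1)) = 0"
      by (rule superdiagonal_annihilates_power[OF s _ z j]) (simp add: s_def U(5))
    then have "U * (scalar z * (?P * s ^ (n - 1))) * madj U = 0" by simp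
    moreover have "U * (scalar z * (?P * s ^ (n - 1))) * madj U
        = scalar z * ((U * ?P) * s ^ (n - 1) * madj U)"
      using scalar_left_comm[OF U(1) z(1)] by (simp add: mult.assoc)
    moreover have "(U * ?P) * s ^ (n - 1) * madj U = ?P * N ^ (n - 1)"
      by (simp add: UP N_pow mult.assoc)
    ultimately have "scalar z * (?P * N ^ (n - 1)) = 0" by simp
    then show "z = 0"
      using strongly_irreducible_power_regular[OF N _ irrN, of "n - 1" z] n z(1) by simp
  qed
  ultimately have "triangular_form n T V a"
    unfolding triangular_form_def N_def[symmetric] using V a U(5) by (simp add: s_def)
  then show ?thesis by blast
qed

end

locale triangularized = abelian_vna +
  fixes n :: nat and T V :: "'a bop lfmat" and a :: "'a bop"
  assumes n: "n > 0" and T: "T \<in> mats {..<n}" and triangular: "triangular_form n T V a"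
begin

abbreviation P :: "'a bop lfmat" where "P \<equiv> index_proj {..<n}"

definition M where "M = madj V * (T - scalar a * P) * V"

lemma V: "V \<in> mats {..<n}" and a: "a \<in> A" and VV: "madj V * V = P" "V * madj V = P"
  using triangular by (auto simp: triangular_form_def)

lemma V': "madj V \<in> mats {..<n}"
  using V by simp

sublocale jordan_type A n M
proof
  show "M \<in> mats {..<n}" using V T a by (simp add: M_def)
  show "ent M i j = 0" if "j \<le> i" for i j
    using triangular that by (simp add: triangular_form_def M_def)
  show "regular (ent M j (Suc j))" if "Suc j < n" for j
    using triangular that by (simp add: triangular_form_def M_def)
qed

lemma conj_back: "X \<in> mats {..<n} \<Longrightarrow> V * (madj V * X * V) * madj V = X"
proof -
  assume X: "X \<in> mats {..<n}"
  have "V * (madj V * X * V) * madj V = (V * madj V) * X * (V * madj V)" by (simp only: mult.assoc)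
  then show ?thesis by (simp add: VV mats_left[OF X] mats_right[OF X])
qed

lemma conj_mult:
  assumes "X \<in> mats {..<n}"
  shows "madj V * X * V * (madj V * Y * V) = madj V * (X * Y) * V"
proof -
  have "madj V * X * V * (madj V * Y * V) = madj V * (X * (V * madj V)) * Y * V" by (simp only: mult.assoc)
  then show ?thesis by (simp add: VV mats_right[OF assms] mult.assoc)
qed

lemma conj_in: "X \<in> mats {..<n} \<Longrightarrow> madj V * X * V \<in> mats {..<n}"
  using V by simp

lemma conj_scalar: "p \<in> A \<Longrightarrow> V * (scalar p * P) * madj V = scalar p * P"
proof -
  assume p: "p \<in> A"
  have "V * (scalar p * (P * madj V)) = scalar p * (V * (P * madj V))"
    by (rule scalar_left_comm[OF matsD(1)[OF V] p])
  then show ?thesis by (simp add: mult.assoc mats_left[OF V'] VV)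
qed

lemma N_eq: "T - scalar a * P = V * M * madj V"
  unfolding M_def by (rule conj_back[symmetric]) (use T a in simp)

lemma commutant_conj:
  assumes X: "X \<in> mats {..<n}" "X * T = T * X"
  shows "madj V * X * V * M = M * (madj V * X * V)"
proof -
  have N: "T - scalar a * P \<in> mats {..<n}" using T a by simp
  have "X * (scalar a * P) = scalar a * P * X"
    using scalar_left_comm[OF matsD(1)[OF X(1)] a] X(1) by (simp add: mult.assoc mats_left mats_right)
  then have "X * (T - scalar a * P) = (T - scalar a * P) * X"
    using X(2) by (simp add: left_diff_distrib right_diff_distrib)
  then show ?thesis unfolding M_def conj_mult[OF X(1)] conj_mult[OF N] by simp
qed

lemma is_strongly_irreducible: "strongly_irreducible {..<n} T"
  unfolding strongly_irreducible_def
proof (intro ballI impI)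
  fix Q assume Q: "Q \<in> mats {..<n}" "Q * Q = Q" "Q * T = T * Q"
  define R where "R = madj V * Q * V"
  have R: "R \<in> mats {..<n}" "R * M = M * R" "R * R = R"
    using conj_in[OF Q(1)] commutant_conj[OF Q(1,3)] conj_mult[OF Q(1), of Q] Q(2)
    by (simp_all add: R_def)
  have "R = scalar (ent R 0 0) * P" by (rule commutant_idempotent_scalar[OF R n])
  moreover have p: "ent R 0 0 \<in> A" by (rule mats_ent[OF R(1)])
  ultimately have "Q = scalar (ent R 0 0) * P"
    using conj_back[OF Q(1)] conj_scalar[OF p] unfolding R_def[symmetric] by metis
  with p show "\<exists>p\<in>A. Q = scalar p * P" by blast
qed

lemma conj_back_power:
  assumes Y: "Y \<in> mats {..<n}"
  shows "P * (V * Y * madj V) ^ k = V * (P * Y ^ k) * madj V"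
proof (induct k)
  case 0
  then show ?case by (simp add: mats_right[OF V] VV)
next
  case (Suc k)
  have Y_Suc: "Y * (P * Y ^ k) = P * Y ^ Suc k"
    by (simp add: mats_left[OF Y] mats_right[OF Y] flip: mult.assoc)
  have "V * Y * madj V \<in> mats {..<n}" using V V' Y by simp
  from mats_left[OF this] mats_right[OF this]
  have "P * (V * Y * madj V) ^ Suc k = V * Y * madj V * (P * (V * Y * madj V) ^ k)"
    by (simp only: power_Suc mult.assoc[symmetric])
  also have "\<dots> = V * Y * (madj V * V) * (P * Y ^ k) * madj V" unfolding Suc by (simp only: mult.assoc)
  also have "\<dots> = V * (Y * (P * Y ^ k)) * madj V" by (simp add: VV mats_right[OF Y] mult.assoc)
  finally show ?case by (simp only: Y_Suc)
qed

lemma commutant_trace_nilpotent: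
  assumes X: "X \<in> mats {..<n}" "X * T = T * X"
  shows "(X - scalar (bop_scale (1 / of_nat n) (tr {..<n} X)) * P) ^ n = 0"
proof -
  define R where "R = madj V * X * V"
  have R: "R \<in> mats {..<n}" "R * M = M * R"
    using conj_in[OF X(1)] commutant_conj[OF X] by (simp_all add: R_def)
  define x where "x = ent R 0 0"
  have x: "x \<in> A" unfolding x_def by (rule mats_ent[OF R(1)])
  have "tr {..<n} X = tr {..<n} (V * (R * madj V))"
    using conj_back[OF X(1)] by (simp add: R_def mult.assoc)
  also have "\<dots> = tr {..<n} (R * madj V * V)"
    using V matsD(1)[OF R(1)] matsD(1)[OF V'] by (intro tr_commute) simp_all
  also have "\<dots> = tr {..<n} R" by (simp add: mult.assoc VV mats_right[OF R(1)])
  also have "\<dots> = (\<Sum>i<n. x)"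
    unfolding tr_def x_def by (intro sum.cong refl commutant_scalar_plus_nilpotent(1)[OF R n]) simp
  also have "\<dots> = bop_scale (of_nat n) x" by (simp add: sum_const_scale)
  finally have trace: "bop_scale (1 / of_nat n) (tr {..<n} X) = x" using n by simp
  define Y where "Y = R - scalar x * P"
  have Y: "Y \<in> mats {..<n}" using R x by (simp add: Y_def)
  have "X - scalar x * P = V * Y * madj V"
    using conj_back[OF X(1)] conj_scalar[OF x] by (simp add: Y_def R_def left_diff_distrib right_diff_distrib)
  moreover have "Y ^ n = 0" unfolding Y_def x_def by (rule commutant_scalar_plus_nilpotent(2)[OF R n])
  ultimately have "P * (X - scalar x * P) ^ n = 0" using conj_back_power[OF Y, of n] by simp
  moreover have "P * (X - scalar x * P) ^ Suc (n - 1) = (X - scalar x * P) ^ Suc (n - 1)"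
    by (rule index_proj_power_Suc) (use X x in simp)
  ultimately show ?thesis unfolding trace using n by simp
qed

text \<open>The algebra generated by \<open>T\<close> and the center, inside the corner: the power \<open>T^0 = 1\<close> has to be cut
  down by \<open>P\<close>.\<close>

definition polynomials :: "'a bop lfmat set" where
  "polynomials = {Y. \<exists>k b. (\<forall>l\<le>k. b l \<in> A) \<and> Y = (\<Sum>l\<le>k. scalar (b l) * (P * T ^ l))}"

lemma polynomialsI:
  "(\<And>l. l \<le> k \<Longrightarrow> b l \<in> A) \<Longrightarrow> Y = (\<Sum>l\<le>k. scalar (b l) * (P * T ^ l)) \<Longrightarrow> Y \<in> polynomials"
  unfolding polynomials_def by (intro CollectI exI[of _ k] exI[of _ b]) simp

lemma polynomials_add:
  assumes "X \<in> polynomials" "Y \<in> polynomials" shows "X + Y \<in> polynomials"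
proof -
  obtain k b k' b' where X: "\<And>l. l \<le> k \<Longrightarrow> b l \<in> A" "X = (\<Sum>l\<le>k. scalar (b l) * (P * T ^ l))"
    and Y: "\<And>l. l \<le> k' \<Longrightarrow> b' l \<in> A" "Y = (\<Sum>l\<le>k'. scalar (b' l) * (P * T ^ l))"
    using assms unfolding polynomials_def by blast
  define ext where "ext j b l = (if l \<le> j then b l else 0)" for j l :: nat and b :: "nat \<Rightarrow> 'a bop"
  have ext: "(\<Sum>l\<le>j. scalar (b l) * (P * T ^ l)) = (\<Sum>l\<le>k + k'. scalar (ext j b l) * (P * T ^ l))"
    if "j \<le> k + k'" for j b
  proof -
    have "(\<Sum>l\<le>j. scalar (b l) * (P * T ^ l)) = (\<Sum>l\<le>j. scalar (ext j b l) * (P * T ^ l))"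
      by (rule sum.cong) (auto simp: ext_def)
    also have "\<dots> = (\<Sum>l\<le>k + k'. scalar (ext j b l) * (P * T ^ l))"
      by (rule sum.mono_neutral_left) (use that in \<open>auto simp: ext_def\<close>)
    finally show ?thesis .
  qed
  have "X + Y = (\<Sum>l\<le>k + k'. scalar (ext k b l + ext k' b' l) * (P * T ^ l))"
    by (simp add: X(2) Y(2) ext[of k b] ext[of k' b'] scalar_add distrib_right sum.distrib)
  moreover have "ext k b l + ext k' b' l \<in> A" for l
    using X(1)[of l] Y(1)[of l] by (simp add: ext_def)
  ultimately show ?thesis by (intro polynomialsI[where b = "\<lambda>l. ext k b l + ext k' b' l"])
qed

lemma polynomials_scalar:
  assumes "c \<in> A" "X \<in> polynomials" shows "scalar c * X \<in> polynomials"
proof -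
  obtain k b where X: "\<And>l. l \<le> k \<Longrightarrow> b l \<in> A" "X = (\<Sum>l\<le>k. scalar (b l) * (P * T ^ l))"
    using assms(2) unfolding polynomials_def by blast
  have "scalar c * X = (\<Sum>l\<le>k. scalar (c * b l) * (P * T ^ l))"
    by (simp add: X(2) sum_distrib_left scalar_mult mult.assoc)
  then show ?thesis using X(1) assms(1) by (intro polynomialsI[where b = "\<lambda>l. c * b l"]) simp_all
qed

lemma polynomials_times_T:
  assumes "X \<in> polynomials" shows "X * T \<in> polynomials"
proof -
  obtain k b where X: "\<And>l. l \<le> k \<Longrightarrow> b l \<in> A" "X = (\<Sum>l\<le>k. scalar (b l) * (P * T ^ l))"
    using assms unfolding polynomials_def by blast
  define b' where "b' l = (case l of 0 \<Rightarrow> 0 | Suc m \<Rightarrow> b m)" for l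
  have "(\<Sum>l\<le>Suc k. scalar (b' l) * (P * T ^ l)) = (\<Sum>l\<le>k. scalar (b l) * (P * T ^ Suc l))"
    by (subst sum.atMost_Suc_shift) (simp add: b'_def)
  also have "\<dots> = X * T"
    by (simp add: X(2) sum_distrib_right mult.assoc power_commutes)
  finally have "X * T = (\<Sum>l\<le>Suc k. scalar (b' l) * (P * T ^ l))" by simp
  moreover have "b' l \<in> A" if "l \<le> Suc k" for l
    using that X(1) by (cases l) (auto simp: b'_def)
  ultimately show ?thesis by (intro polynomialsI[where b = b'])
qed

lemma polynomials_P: "P \<in> polynomials"
  by (rule polynomialsI[of 0 "\<lambda>_. 1"]) simp_all

lemma polynomials_sum:
  "finite S \<Longrightarrow> (\<And>x. x \<in> S \<Longrightarrow> f x \<in> polynomials) \<Longrightarrow> (\<Sum>x\<in>S. f x) \<in> polynomials"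
proof (induct S rule: finite_induct)
  case empty
  then show ?case using polynomials_scalar[OF zero_in polynomials_P] by simp
qed (auto simp: polynomials_add)

lemma polynomials_power: "P * (T - scalar a * P) ^ l \<in> polynomials"
proof (induct l)
  case (Suc l)
  define Y where "Y = P * (T - scalar a * P) ^ l"
  have N: "T - scalar a * P \<in> mats {..<n}" using T a by simp
  have Y: "Y \<in> mats {..<n}" unfolding Y_def by (rule mats_power[OF N])
  have "P * (T - scalar a * P) ^ Suc l = Y * (T - scalar a * P)"
    by (simp add: Y_def power_Suc2 mult.assoc del: power_Suc)
  also have "\<dots> = Y * T + scalar (- a) * Y"
    using scalar_left_comm[OF matsD(1)[OF Y] a] by (simp add: right_diff_distrib mats_right[OF Y] scalar_minus)
  finally show ?case
    using Suc a by (auto simp: Y_def intro!: polynomials_add polynomials_scalar polynomials_times_T)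
qed (simp add: polynomials_P)

lemma commutant_regular_multiple:
  assumes X: "X \<in> mats {..<n}" "X * T = T * X"
  shows "\<exists>c\<in>A. regular c \<and> scalar c * X \<in> polynomials"
proof -
  define R where "R = madj V * X * V"
  have R: "R \<in> mats {..<n}" "R * M = M * R"
    using conj_in[OF X(1)] commutant_conj[OF X] by (simp_all add: R_def)
  obtain c b where c: "c \<in> A" "regular c" "\<And>l. b l \<in> A"
    "scalar c * R = (\<Sum>l<n. scalar (b l) * (P * M ^ l))"
    using commutant_polynomial[OF R] by blast
  have V_scalar: "V * (scalar x * Y) * madj V = scalar x * (V * Y * madj V)" if "x \<in> A" for x Y
    using scalar_left_comm[OF matsD(1)[OF V] that] by (simp add: mult.assoc)
  have "scalar c * X = V * (scalar c * R) * madj V"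
    using conj_back[OF X(1)] by (simp add: V_scalar[OF c(1)] R_def)
  also have "\<dots> = (\<Sum>l<n. scalar (b l) * (P * (T - scalar a * P) ^ l))"
    by (simp add: c(4) sum_distrib_left sum_distrib_right V_scalar[OF c(3)] N_eq conj_back_power[OF M_mats])
  finally have "scalar c * X \<in> polynomials"
    using c(3) by (auto intro!: polynomials_sum polynomials_scalar polynomials_power)
  with c show ?thesis by blast
qed

lemma polynomials_commute:
  assumes "Y \<in> polynomials" shows "Y \<in> mats {..<n}" "Y * T = T * Y"
proof -
  obtain k b where Y: "\<And>l. l \<le> k \<Longrightarrow> b l \<in> A" "Y = (\<Sum>l\<le>k. scalar (b l) * (P * T ^ l))"
    using assms unfolding polynomials_def by blast
  show "Y \<in> mats {..<n}" unfolding Y(2) using Y(1) T by (intro mats_sum mats_scalar mats_power) auto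
  have "scalar (b l) * (P * T ^ l) * T = T * (scalar (b l) * (P * T ^ l))" if "l \<le> k" for l
  proof -
    have "T * (P * T ^ l) = P * T ^ l * T"
    proof -
      have "T * (P * T ^ l) = T * T ^ l" by (simp add: mats_right[OF T] flip: mult.assoc)
      also have "\<dots> = P * T * T ^ l" by (simp add: mats_left[OF T])
      finally show ?thesis by (simp add: mult.assoc power_commutes)
    qed
    then show ?thesis using scalar_left_comm[OF matsD(1)[OF T] Y(1)[OF that]] by (simp add: mult.assoc)
  qed
  then show "Y * T = T * Y" unfolding Y(2) sum_distrib_left sum_distrib_right by (intro sum.cong) auto
qed

end

section \<open>Transfer to matrices of fixed size\<close>

lemma of_mat_diff:
  fixes X Y :: "'r::ring mat"
  assumes "X \<in> carrier_mat n n" "Y \<in> carrier_mat n n"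
  shows "of_mat (X - Y) = of_mat X - of_mat Y"
proof (rule lfmat_eqI)
  fix i j
  have "X - Y \<in> carrier_mat n n" using assms(2) by (rule minus_carrier_mat)
  from ent_of_mat[OF this, of i j] show "ent (of_mat (X - Y)) i j = ent (of_mat X - of_mat Y) i j"
    using assms by (auto simp: ent_of_mat[of _ n])
qed

lemma mat_adj_carrier: "X \<in> carrier_mat n n \<Longrightarrow> mat_adj X \<in> carrier_mat n n"
  by (simp add: mat_adj_def)

lemma of_mat_adj: "X \<in> carrier_mat n n \<Longrightarrow> of_mat (mat_adj X) = madj (of_mat X)"
  by (rule lfmat_eqI) (simp add: ent_of_mat[of _ n] mat_adj_def)

lemma amplification_carrier: "amplification n a \<in> carrier_mat n n"
  by (simp add: amplification_def)

lemma of_mat_amplification: "of_mat (amplification n a) = scalar a * index_proj {..<n}"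
  by (rule lfmat_eqI, subst ent_of_mat[OF amplification_carrier]) (auto simp: amplification_def)

lemma mat_power_carrier:
  assumes "T \<in> carrier_mat n n"
  shows "mat_power n T k \<in> carrier_mat n n" "of_mat (mat_power n T k) = index_proj {..<n} * of_mat T ^ k"
proof (induct k)
  case 0
  show "mat_power n T 0 \<in> carrier_mat n n" "of_mat (mat_power n T 0) = index_proj {..<n} * of_mat T ^ 0"
    by (simp_all add: mat_power_def of_mat_one)
next
  case (Suc k)
  have step: "mat_power n T (Suc k) = mat_power n T k * T" by (simp add: mat_power_def)
  show "mat_power n T (Suc k) \<in> carrier_mat n n" unfolding step using Suc(1) assms by simp
  show "of_mat (mat_power n T (Suc k)) = index_proj {..<n} * of_mat T ^ Suc k"
    unfolding step using of_mat_mult[OF Suc(1) assms] Suc(2) by (simp add: power_commutes mult.assoc)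
qed

lemma of_mat_center_valued_trace:
  assumes "X \<in> carrier_mat n n"
  shows "of_mat (center_valued_trace n X)
    = scalar (bop_scale (1 / of_nat n) (tr {..<n} (of_mat X))) * index_proj {..<n}"
  using assms by (simp add: center_valued_trace_def of_mat_amplification tr_def ent_of_mat[of _ n])

lemma center_valued_trace_carrier: "center_valued_trace n X \<in> carrier_mat n n"
  by (simp add: center_valued_trace_def amplification_carrier)

subsection \<open>The strong operator topology of the matrix algebra\<close>

lemma topspace_mat_sot: "topspace (mat_sot n) = carrier_mat n n"
  unfolding mat_sot_def topology_generated_by_topspace
proof (intro equalityI subsetI)
  fix X :: "'a bop mat" assume X: "X \<in> carrier_mat n n"
  have "mat_apply_norm n (X - X) (\<lambda>_. 0) < 1" by (simp add: mat_apply_norm_def L2_set_def)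
  then have "X \<in> {S \<in> carrier_mat n n. mat_apply_norm n (S - X) (\<lambda>_. 0) < 1}" using X by simp
  moreover have "{S \<in> carrier_mat n n. mat_apply_norm n (S - X) (\<lambda>_. 0) < 1}
      \<in> {{S \<in> carrier_mat n n. mat_apply_norm n (S - T) x < e} |T x e. T \<in> carrier_mat n n \<and> 0 < e}"
    using X by (intro CollectI exI[of _ X] exI[of _ "\<lambda>_. 0"] exI[of _ 1]) simp
  ultimately show "X \<in> \<Union> {{S \<in> carrier_mat n n. mat_apply_norm n (S - T) x < e} |T x e.
      T \<in> carrier_mat n n \<and> 0 < e}" by blast
qed auto

lemma limitin_mat_sot:
  assumes Y: "\<And>k. Y k \<in> carrier_mat n n" and X: "X \<in> carrier_mat n n"
    and lim: "\<And>i j x. i < n \<Longrightarrow> j < n \<Longrightarrow> (\<lambda>k. (Y k $$ (i, j)) \<rhd> x) \<longlonglongrightarrow> (X $$ (i, j)) \<rhd> x"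
  shows "limitin (mat_sot n) Y X sequentially"
  unfolding mat_sot_def
proof (rule limitin_topology_generated_by)
  show "X \<in> \<Union> {{S \<in> carrier_mat n n. mat_apply_norm n (S - T) x < e} |T x e. T \<in> carrier_mat n n \<and> 0 < e}"
    using topspace_mat_sot[of n] X unfolding mat_sot_def topology_generated_by_topspace by blast
next
  fix B assume "B \<in> {{S \<in> carrier_mat n n. mat_apply_norm n (S - T) x < e} |T x e. T \<in> carrier_mat n n \<and> 0 < e}"
    and XB: "X \<in> B"
  then obtain T x e where T: "T \<in> carrier_mat n n"
    and B: "B = {S \<in> carrier_mat n n. mat_apply_norm n (S - T) x < e}" by blast
  have "(\<lambda>k. mat_apply_norm n (Y k - T) x) \<longlonglongrightarrow> mat_apply_norm n (X - T) x"
    unfolding mat_apply_norm_def L2_set_def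
  proof (intro tendsto_real_sqrt tendsto_sum tendsto_power tendsto_norm)
    fix i j assume "i \<in> {..<n}" "j \<in> {..<n}"
    then show "(\<lambda>k. (Y k - T) $$ (i, j) \<rhd> x j) \<longlonglongrightarrow> (X - T) $$ (i, j) \<rhd> x j"
      using T tendsto_diff[OF lim[of i j "x j"] tendsto_const] by simp
  qed
  moreover have "mat_apply_norm n (X - T) x < e" using XB B by simp
  ultimately have "\<forall>\<^sub>F k in sequentially. mat_apply_norm n (Y k - T) x < e" by (rule order_tendstoD(2))
  then show "\<forall>\<^sub>F k in sequentially. Y k \<in> B" by (simp add: B Y)
qed

lemma continuous_map_entry_apply:
  assumes ij: "i < n" "j < n"
  shows "continuous_map (mat_sot n) euclidean (\<lambda>X :: 'a::complex_hilbert bop mat. (X $$ (i, j)) \<rhd> x)"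
  unfolding continuous_map_def
proof (intro conjI allI impI)
  fix V :: "'a set" assume "openin euclidean V"
  then have V: "open V" by simp
  define W where "W = {X \<in> topspace (mat_sot n). (X $$ (i, j)) \<rhd> x \<in> V}"
  have "\<exists>B. openin (mat_sot n) B \<and> X \<in> B \<and> B \<subseteq> W" if X: "X \<in> W" for X
  proof -
    have Xc: "X \<in> carrier_mat n n" using X by (simp add: W_def topspace_mat_sot)
    obtain e where e: "0 < e" "ball ((X $$ (i, j)) \<rhd> x) e \<subseteq> V"
      using V X unfolding W_def by (auto elim: openE)
    define y where "y k = (if k = j then x else 0)" for k
    define B where "B = {S \<in> carrier_mat n n. mat_apply_norm n (S - X) y < e}"
    have "openin (mat_sot n) B"
      unfolding mat_sot_def by (rule topology_generated_by_Basis) (use Xc e B_def in blast)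
    moreover have "X \<in> B"
    proof -
      have "L2_set (\<lambda>i. norm (\<Sum>j<n. ((X - X) $$ (i, j)) \<rhd> y j)) {..<n} = L2_set (\<lambda>i. 0) {..<n}"
        using Xc by (intro L2_set_cong) auto
      then show ?thesis using Xc e by (simp add: B_def mat_apply_norm_def L2_set_def)
    qed
    moreover have "S \<in> W" if S: "S \<in> B" for S
    proof -
      have Sc: "S \<in> carrier_mat n n" and lt: "mat_apply_norm n (S - X) y < e" using S by (simp_all add: B_def)
      have "(\<Sum>k<n. ((S - X) $$ (i, k)) \<rhd> y k) = (\<Sum>k<n. if k = j then ((S - X) $$ (i, j)) \<rhd> x else 0)"
        by (rule sum.cong) (auto simp: y_def)
      also have "\<dots> = S $$ (i, j) \<rhd> x - X $$ (i, j) \<rhd> x"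
        using ij Xc Sc by (simp add: sum.delta)
      finally have "norm (S $$ (i, j) \<rhd> x - X $$ (i, j) \<rhd> x) \<le> mat_apply_norm n (S - X) y"
        unfolding mat_apply_norm_def
        using member_le_L2_set[of "{..<n}" i "\<lambda>i. norm (\<Sum>j<n. ((S - X) $$ (i, j)) \<rhd> y j)"] ij by simp
      then have "S $$ (i, j) \<rhd> x \<in> ball ((X $$ (i, j)) \<rhd> x) e"
        using lt by (simp add: dist_norm norm_minus_commute)
      then show ?thesis using e(2) Sc by (auto simp: W_def topspace_mat_sot)
    qed
    ultimately show ?thesis by blast
  qed
  then show "openin (mat_sot n) {X \<in> topspace (mat_sot n). (X $$ (i, j)) \<rhd> x \<in> V}"
    unfolding W_def[symmetric] by (subst openin_subopen) blast
qed simp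

lemma continuous_map_entry:
  assumes "i < n" "j < n"
  shows "continuous_map (mat_sot n) bop_sot (\<lambda>X :: 'a::complex_hilbert bop mat. X $$ (i, j))"
  unfolding bop_sot_def
proof (rule continuous_on_generated_topo)
  fix U :: "'a bop set" assume "U \<in> {{S. norm ((S - T) \<rhd> x) < e} |T x e. 0 < e}"
  then obtain T x e where U: "U = {S. norm ((S - T) \<rhd> x) < e}" by blast
  have "(\<lambda>X. X $$ (i, j)) -` U \<inter> topspace (mat_sot n)
      = {X \<in> topspace (mat_sot n). X $$ (i, j) \<rhd> x \<in> ball (T \<rhd> x) e}"
    by (auto simp: U dist_norm norm_minus_commute)
  moreover have "openin (mat_sot n) {X \<in> topspace (mat_sot n). X $$ (i, j) \<rhd> x \<in> ball (T \<rhd> x) e}"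
    by (rule openin_continuous_map_preimage[OF continuous_map_entry_apply[OF assms]]) simp
  ultimately show "openin (mat_sot n) ((\<lambda>X. X $$ (i, j)) -` U \<inter> topspace (mat_sot n))" by simp
next
  show "(\<lambda>X :: 'a bop mat. X $$ (i, j)) ` topspace (mat_sot n) \<subseteq> \<Union> {{S. norm ((S - T) \<rhd> x) < e} |T x e. 0 < e}"
  proof (rule subsetI)
    fix S :: "'a bop" assume "S \<in> (\<lambda>X. X $$ (i, j)) ` topspace (mat_sot n)"
    have "S \<in> {R. norm ((R - S) \<rhd> 0) < 1}" by simp
    moreover have "{R. norm ((R - S) \<rhd> 0) < 1} \<in> {{S. norm ((S - T) \<rhd> x) < e} |T x e. 0 < e}"
      by (rule CollectI, rule exI[of _ S], rule exI[of _ 0], rule exI[of _ 1]) simp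
    ultimately show "S \<in> \<Union> {{S. norm ((S - T) \<rhd> x) < e} |T x e. 0 < e}" by (rule UnionI[rotated])
  qed
qed

lemma continuous_map_bop_apply:
  "continuous_map X euclidean f \<Longrightarrow> continuous_map X euclidean (\<lambda>y. b \<rhd> f y)"
  using continuous_map_compose[of X euclidean f euclidean "bop_apply b"]
    linear_continuous_on[OF bounded_linear_bop, of UNIV b]
  by (simp add: o_def)

context abelian_vna
begin

lemma matrix_algebra_carrier: "X \<in> matrix_algebra n A \<Longrightarrow> X \<in> carrier_mat n n"
  by (simp add: matrix_algebra_def)

lemma of_mat_in: "X \<in> matrix_algebra n A \<Longrightarrow> of_mat X \<in> mats {..<n}"
proof -
  assume X: "X \<in> matrix_algebra n A"
  have "ent (of_mat X) i j \<in> A" for i j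
    unfolding ent_of_mat[OF matrix_algebra_carrier[OF X]] using X by (auto simp: matrix_algebra_def)
  then have "of_mat X \<in> full" by (simp add: full_def)
  then show "of_mat X \<in> mats {..<n}"
    using supported_of_mat[OF matrix_algebra_carrier[OF X]] by (simp add: mats_def)
qed

lemma to_mat_in: "X \<in> mats {..<n} \<Longrightarrow> to_mat n X \<in> matrix_algebra n A"
  by (simp add: matrix_algebra_def to_mat_def)

lemma of_mat_to_mat_mats: "X \<in> mats {..<n} \<Longrightarrow> of_mat (to_mat n X) = X"
  by (rule of_mat_to_mat) (rule matsD)

lemma of_mat_eq_iff:
  "X \<in> matrix_algebra n A \<Longrightarrow> Y \<in> matrix_algebra n A \<Longrightarrow> of_mat X = of_mat Y \<longleftrightarrow> X = Y"
  by (rule of_mat_inject[OF matrix_algebra_carrier matrix_algebra_carrier])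

lemma matrix_algebra_mult:
  assumes "X \<in> matrix_algebra n A" "Y \<in> matrix_algebra n A"
  shows "X * Y \<in> matrix_algebra n A" "of_mat (X * Y) = of_mat X * of_mat Y"
proof -
  note c = matrix_algebra_carrier[OF assms(1)] matrix_algebra_carrier[OF assms(2)]
  show eq: "of_mat (X * Y) = of_mat X * of_mat Y" by (rule of_mat_mult[OF c])
  have "to_mat n (of_mat (X * Y)) \<in> matrix_algebra n A"
    unfolding eq by (intro to_mat_in mats_mult of_mat_in assms)
  then show "X * Y \<in> matrix_algebra n A" using c by (simp add: to_mat_of_mat)
qed

lemma relative_commutant_iff:
  assumes "T \<in> matrix_algebra n A"
  shows "X \<in> relative_commutant (matrix_algebra n A) T \<longleftrightarrow>
    X \<in> matrix_algebra n A \<and> of_mat X * of_mat T = of_mat T * of_mat X"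
proof (cases "X \<in> matrix_algebra n A")
  case True
  note XT = matrix_algebra_mult[OF True assms] and TX = matrix_algebra_mult[OF assms True]
  show ?thesis
    using of_mat_eq_iff[OF XT(1) TX(1)] True by (simp add: relative_commutant_def XT(2) TX(2))
qed (simp add: relative_commutant_def)

text \<open>Commutation with the matrix units in the first row suffices.\<close>

lemma center_matrix_algebra_iff:
  assumes n: "n > 0"
  shows "Z \<in> center (matrix_algebra n A) \<longleftrightarrow>
    Z \<in> matrix_algebra n A \<and> (\<exists>p\<in>A. of_mat Z = scalar p * index_proj {..<n})"
proof (intro iffI conjI)
  assume Z: "Z \<in> center (matrix_algebra n A)"
  then show Zm: "Z \<in> matrix_algebra n A" by (simp add: center_def)
  define W where "W = of_mat Z"
  have W: "W \<in> mats {..<n}" unfolding W_def by (rule of_mat_in[OF Zm])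
  have commutes: "munit 0 i * W = W * munit 0 i" if "i < n" for i
  proof -
    have E: "munit 0 i \<in> mats {..<n}" using n that by (intro mats_munit) auto
    have "to_mat n (munit 0 i) * Z = Z * to_mat n (munit 0 i)"
      using Z to_mat_in[OF E] by (simp add: center_def)
    from arg_cong[OF this, of of_mat] show ?thesis
      using matrix_algebra_mult(2)[OF to_mat_in[OF E] Zm] matrix_algebra_mult(2)[OF Zm to_mat_in[OF E]]
      by (simp add: of_mat_to_mat_mats[OF E] W_def)
  qed
  have entries: "(if a = 0 then ent W i b else 0) = (if b = i then ent W a 0 else 0)" if "i < n" for i a b
    using arg_cong[OF commutes[OF that], of "\<lambda>X. ent X a b"] by simp
  have "W = scalar (ent W 0 0) * index_proj {..<n}"
  proof (rule lfmat_eqI)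
    fix i b
    show "ent W i b = ent (scalar (ent W 0 0) * index_proj {..<n}) i b"
      using entries[of i 0 b] supported_ent[OF matsD(2)[OF W], of i b] by (cases "i < n") auto
  qed
  then show "\<exists>p\<in>A. of_mat Z = scalar p * index_proj {..<n}" using mats_ent[OF W] W_def by blast
next
  assume "Z \<in> matrix_algebra n A \<and> (\<exists>p\<in>A. of_mat Z = scalar p * index_proj {..<n})"
  then obtain p where Z: "Z \<in> matrix_algebra n A" and p: "p \<in> A" "of_mat Z = scalar p * index_proj {..<n}"
    by blast
  have "X * Z = Z * X" if X: "X \<in> matrix_algebra n A" for X
  proof -
    have Xm: "of_mat X \<in> mats {..<n}" by (rule of_mat_in[OF X])
    have "of_mat (X * Z) = of_mat (Z * X)"
      unfolding matrix_algebra_mult(2)[OF X Z] matrix_algebra_mult(2)[OF Z X] p(2)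
      using scalar_left_comm[OF matsD(1)[OF Xm] p(1)]
      by (simp add: mult.assoc mats_left[OF Xm] mats_right[OF Xm])
    then show ?thesis
      using of_mat_eq_iff[OF matrix_algebra_mult(1)[OF X Z] matrix_algebra_mult(1)[OF Z X]] by simp
  qed
  then show "Z \<in> center (matrix_algebra n A)" using Z by (simp add: center_def)
qed

lemma strongly_irreducible_in_iff:
  assumes n: "n > 0" and T: "T \<in> matrix_algebra n A"
  shows "strongly_irreducible_in (matrix_algebra n A) T \<longleftrightarrow> strongly_irreducible {..<n} (of_mat T)"
proof
  assume irr: "strongly_irreducible_in (matrix_algebra n A) T"
  show "strongly_irreducible {..<n} (of_mat T)"
    unfolding strongly_irreducible_def
  proof (intro ballI impI)
    fix Q assume Q: "Q \<in> mats {..<n}" "Q * Q = Q" "Q * of_mat T = of_mat T * Q"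
    define Z where "Z = to_mat n Q"
    have Z: "Z \<in> matrix_algebra n A" "of_mat Z = Q"
      using Q(1) by (simp_all add: Z_def to_mat_in of_mat_to_mat_mats)
    have "Z \<in> relative_commutant (matrix_algebra n A) T"
      using relative_commutant_iff[OF T] Z Q(3) by simp
    moreover have "Z * Z = Z"
      using of_mat_eq_iff[OF matrix_algebra_mult(1)[OF Z(1) Z(1)] Z(1)] matrix_algebra_mult(2)[OF Z(1) Z(1)]
        Z(2) Q(2) by simp
    ultimately have "Z \<in> center (matrix_algebra n A)"
      using irr by (simp add: strongly_irreducible_in_def)
    then show "\<exists>p\<in>A. Q = scalar p * index_proj {..<n}"
      using center_matrix_algebra_iff[OF n] Z(2) by simp
  qed
next
  assume irr: "strongly_irreducible {..<n} (of_mat T)"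
  show "strongly_irreducible_in (matrix_algebra n A) T"
    unfolding strongly_irreducible_in_def
  proof (intro conjI T ballI impI)
    fix Z assume "Z \<in> relative_commutant (matrix_algebra n A) T" and ZZ: "Z * Z = Z"
    then have Z: "Z \<in> matrix_algebra n A" "of_mat Z * of_mat T = of_mat T * of_mat Z"
      using relative_commutant_iff[OF T] by simp_all
    have "of_mat Z * of_mat Z = of_mat Z"
      using matrix_algebra_mult(2)[OF Z(1) Z(1)] ZZ by simp
    then have "\<exists>p\<in>A. of_mat Z = scalar p * index_proj {..<n}"
      using irr of_mat_in[OF Z(1)] Z(2) unfolding strongly_irreducible_def by blast
    then show "Z \<in> center (matrix_algebra n A)" using center_matrix_algebra_iff[OF n] Z(1) by simp
  qed
qed

text \<open>Conjugation by a unitary fixes the scalar \<open>a\<close>, so that \<open>U\<^sup>\<star> (T - a) U = U\<^sup>\<star> T U - a\<close>.\<close>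

lemma triangular_form_iff:
  assumes n: "n > 0" and T: "T \<in> matrix_algebra n A"
  shows "(\<exists>U t. unitary_in n A U \<and> t = mat_adj U * T * U \<and> upper_triangular t \<and>
         (\<forall>j<n - 1. t $$ (j, j) = t $$ (n - 1, n - 1)) \<and>
         (\<forall>j<n - 1. is_range_projection A (t $$ (j, Suc j)) 1))
    \<longleftrightarrow> (\<exists>V a. triangular_form n (of_mat T) V a)"
proof -
  let ?P = "index_proj {..<n} :: 'a bop lfmat"
  define T' where "T' = of_mat T"
  have T': "T' \<in> mats {..<n}" unfolding T'_def by (rule of_mat_in[OF T])
  have unitary: "unitary_in n A U \<longleftrightarrow> madj (of_mat U) * of_mat U = ?P \<and> of_mat U * madj (of_mat U) = ?P"
    if U: "U \<in> matrix_algebra n A" for U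
  proof -
    note Uc = matrix_algebra_carrier[OF U]
    note Uc' = mat_adj_carrier[OF Uc]
    have "mat_adj U * U = 1\<^sub>m n \<longleftrightarrow> madj (of_mat U) * of_mat U = ?P"
      using of_mat_inject[of "mat_adj U * U" n "1\<^sub>m n"] Uc Uc' of_mat_mult[OF Uc' Uc] of_mat_adj[OF Uc]
      by (simp add: of_mat_one)
    moreover have "U * mat_adj U = 1\<^sub>m n \<longleftrightarrow> of_mat U * madj (of_mat U) = ?P"
      using of_mat_inject[of "U * mat_adj U" n "1\<^sub>m n"] Uc Uc' of_mat_mult[OF Uc Uc'] of_mat_adj[OF Uc]
      by (simp add: of_mat_one)
    ultimately show ?thesis using U by (simp add: unitary_in_def)
  qed
  have conj: "mat_adj U * T * U \<in> carrier_mat n n" "of_mat (mat_adj U * T * U) = madj (of_mat U) * T' * of_mat U"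
    if U: "U \<in> matrix_algebra n A" for U
  proof -
    note c = matrix_algebra_carrier[OF U] matrix_algebra_carrier[OF T] mat_adj_carrier[OF matrix_algebra_carrier[OF U]]
    show "mat_adj U * T * U \<in> carrier_mat n n" using c by simp
    show "of_mat (mat_adj U * T * U) = madj (of_mat U) * T' * of_mat U"
      using c by (simp add: of_mat_mult[of _ n] of_mat_adj T'_def mult.assoc)
  qed
  have split: "madj V * (T' - scalar a * ?P) * V = madj V * T' * V - scalar a * ?P"
    if V: "V \<in> mats {..<n}" "madj V * V = ?P" and a: "a \<in> A" for V a
  proof -
    have "madj V * (scalar a * (?P * V)) = scalar a * (madj V * (?P * V))"
      using V(1) a by (intro scalar_left_comm) (auto dest: matsD)
    then show ?thesis
      by (simp add: left_diff_distrib right_diff_distrib mult.assoc mats_left[OF V(1)] V(2))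
  qed
  show ?thesis
  proof
    assume "\<exists>U t. unitary_in n A U \<and> t = mat_adj U * T * U \<and> upper_triangular t \<and>
         (\<forall>j<n - 1. t $$ (j, j) = t $$ (n - 1, n - 1)) \<and>
         (\<forall>j<n - 1. is_range_projection A (t $$ (j, Suc j)) 1)"
    then obtain U t where U: "unitary_in n A U" and t: "t = mat_adj U * T * U" "upper_triangular t"
      and diag: "\<And>j. j < n - 1 \<Longrightarrow> t $$ (j, j) = t $$ (n - 1, n - 1)"
      and super: "\<And>j. j < n - 1 \<Longrightarrow> is_range_projection A (t $$ (j, Suc j)) 1" by blast
    have Um: "U \<in> matrix_algebra n A" using U by (simp add: unitary_in_def)
    define V where "V = of_mat U"
    have V: "V \<in> mats {..<n}" unfolding V_def by (rule of_mat_in[OF Um])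
    have VV: "madj V * V = ?P" "V * madj V = ?P" using unitary[OF Um] U by (simp_all add: V_def)
    define s where "s = madj V * T' * V"
    have s: "s \<in> mats {..<n}" using V T' by (simp add: s_def)
    have tc: "t \<in> carrier_mat n n" and ts: "of_mat t = s"
      using conj[OF Um] by (simp_all add: t(1) s_def V_def)
    have t_ent: "t $$ (i, j) = ent s i j" if "i < n" "j < n" for i j
      using that ent_of_mat[OF tc, of i j] by (simp add: ts)
    define a where "a = t $$ (n - 1, n - 1)"
    have a: "a \<in> A" using t_ent[of "n - 1" "n - 1"] n mats_ent[OF s] by (simp add: a_def)
    have diag': "ent s i i = a" if "i < n" for i
      using diag[of i] that t_ent[of i i] by (cases "i < n - 1") (auto simp: a_def dest: less_antisym)
    have "ent (s - scalar a * ?P) i j = 0" if "j \<le> i" for i j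
    proof (cases "i < n")
      case True
      then show ?thesis
        using that diag'[of i] t(2) tc t_ent[of i j] by (cases "j = i") (auto simp: upper_triangular_def)
    next
      case False
      then show ?thesis using supported_ent[OF matsD(2)[OF s], of i j] by simp
    qed
    moreover have "regular (ent (s - scalar a * ?P) j (Suc j))" if "Suc j < n" for j
      using super[of j] that t_ent[of j "Suc j"] range_projection_one_iff_regular[OF mats_ent[OF s]] by simp
    ultimately have "triangular_form n T' V a"
      unfolding triangular_form_def split[OF V VV(1) a] s_def[symmetric] using V a VV by simp
    then show "\<exists>V a. triangular_form n (of_mat T) V a" unfolding T'_def by blast
  next
    assume "\<exists>V a. triangular_form n (of_mat T) V a"
    then obtain V a where tf: "triangular_form n T' V a" unfolding T'_def by blast
    then have V: "V \<in> mats {..<n}" and a: "a \<in> A" and VV: "madj V * V = ?P" "V * madj V = ?P"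
      by (simp_all add: triangular_form_def)
    define s where "s = madj V * T' * V"
    have s: "s \<in> mats {..<n}" using V T' by (simp add: s_def)
    have low: "ent (s - scalar a * ?P) i j = 0" if "j \<le> i" for i j
      using tf that unfolding triangular_form_def split[OF V VV(1) a] s_def[symmetric] by blast
    have super: "regular (ent (s - scalar a * ?P) j (Suc j))" if "Suc j < n" for j
      using tf that unfolding triangular_form_def split[OF V VV(1) a] s_def[symmetric] by blast
    define U where "U = to_mat n V"
    have Um: "U \<in> matrix_algebra n A" and UV: "of_mat U = V"
      using V by (simp_all add: U_def to_mat_in of_mat_to_mat_mats)
    define t where "t = mat_adj U * T * U"
    have tc: "t \<in> carrier_mat n n" and ts: "of_mat t = s"
      using conj[OF Um] by (simp_all add: t_def s_def UV)
    have t_ent: "t $$ (i, j) = ent s i j" if "i < n" "j < n" for i j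
      using that ent_of_mat[OF tc, of i j] by (simp add: ts)
    have diag: "t $$ (j, j) = a" if "j < n" for j
      using low[of j j] t_ent[of j j] that by simp
    have "unitary_in n A U" using unitary[OF Um] VV by (simp add: UV)
    moreover have "upper_triangular t"
      unfolding upper_triangular_def
    proof (intro allI impI)
      fix i j assume "i < dim_row t" "j < i"
      then show "t $$ (i, j) = 0" using tc low[of j i] t_ent[of i j] by auto
    qed
    moreover have "\<forall>j<n - 1. t $$ (j, j) = t $$ (n - 1, n - 1)" using diag n by simp
    moreover have "\<forall>j<n - 1. is_range_projection A (t $$ (j, Suc j)) 1"
      using super t_ent range_projection_one_iff_regular[OF mats_ent[OF s]] by simp
    ultimately show "\<exists>U t. unitary_in n A U \<and> t = mat_adj U * T * U \<and> upper_triangular t \<and>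
         (\<forall>j<n - 1. t $$ (j, j) = t $$ (n - 1, n - 1)) \<and>
         (\<forall>j<n - 1. is_range_projection A (t $$ (j, Suc j)) 1)"
      using t_def by blast
  qed
qed

text \<open>Evaluation of an entry at a vector is strongly continuous. Hence membership of the entries in \<open>A\<close>
  and commutation with \<open>T\<close> are closed conditions.\<close>

lemma closure_in_relative_commutant:
  assumes T: "T \<in> matrix_algebra n A" and X: "X \<in> mat_sot n closure_of S"
    and S: "S \<subseteq> relative_commutant (matrix_algebra n A) T"
  shows "X \<in> relative_commutant (matrix_algebra n A) T"
proof -
  note Tc = matrix_algebra_carrier[OF T]
  have Xc: "X \<in> carrier_mat n n"
    using X closure_of_subset_topspace[of "mat_sot n" S] by (auto simp: topspace_mat_sot)
  have Sc: "Y \<in> carrier_mat n n" "Y \<in> matrix_algebra n A" "Y * T = T * Y" if "Y \<in> S" for Y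
    using S that by (auto simp: relative_commutant_def matrix_algebra_def)
  have closed_cond: "X \<in> C" if "closedin (mat_sot n) C" "S \<subseteq> C" for C
    using closure_of_minimal[OF that(2,1)] X by blast
  have "X $$ (i, j) \<in> A" if ij: "i < n" "j < n" for i j
  proof -
    have "X \<in> {X \<in> topspace (mat_sot n). X $$ (i, j) \<in> A}"
    proof (rule closed_cond)
      show "closedin (mat_sot n) {X \<in> topspace (mat_sot n). X $$ (i, j) \<in> A}"
        by (rule closedin_continuous_map_preimage[OF continuous_map_entry[OF ij] closed])
      show "S \<subseteq> {X \<in> topspace (mat_sot n). X $$ (i, j) \<in> A}"
        using Sc ij by (auto simp: topspace_mat_sot matrix_algebra_def)
    qed
    then show ?thesis by simp
  qed
  then have Xm: "X \<in> matrix_algebra n A" using Xc by (simp add: matrix_algebra_def)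
  define d where "d i j x Y = (\<Sum>k<n. Y $$ (i, k) \<rhd> T $$ (k, j) \<rhd> x) - (\<Sum>k<n. T $$ (i, k) \<rhd> Y $$ (k, j) \<rhd> x)"
    for i j x and Y :: "'a bop mat"
  have d_eq: "d i j x Y = (Y * T) $$ (i, j) \<rhd> x - (T * Y) $$ (i, j) \<rhd> x"
    if "i < n" "j < n" "Y \<in> carrier_mat n n" for i j x Y
    using that Tc by (simp add: d_def scalar_prod_def lessThan_atLeast0)
  have "X * T = T * X"
  proof (rule eq_matI)
    fix i j assume "i < dim_row (T * X)" "j < dim_col (T * X)"
    then have ij: "i < n" "j < n" using Tc Xc by auto
    show "(X * T) $$ (i, j) = (T * X) $$ (i, j)"
    proof (rule bop_eqI)
      fix x
      have "X \<in> {X \<in> topspace (mat_sot n). d i j x X \<in> {0}}"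
      proof (rule closed_cond)
        have "continuous_map (mat_sot n) euclidean (d i j x)"
          unfolding d_def using ij
          by (intro continuous_map_diff continuous_map_sum continuous_map_entry_apply
              continuous_map_bop_apply) auto
        then show "closedin (mat_sot n) {X \<in> topspace (mat_sot n). d i j x X \<in> {0}}"
          by (rule closedin_continuous_map_preimage) simp
        show "S \<subseteq> {X \<in> topspace (mat_sot n). d i j x X \<in> {0}}"
          using Sc ij d_eq by (auto simp: topspace_mat_sot)
      qed
      then show "(X * T) $$ (i, j) \<rhd> x = (T * X) $$ (i, j) \<rhd> x" using d_eq[OF ij Xc] by simp
    qed
  qed (use Tc Xc in auto)
  with Xm show ?thesis by (simp add: relative_commutant_def)
qed

end

lemma (in triangularized) generated_algebra_eq:
  assumes T': "T' \<in> matrix_algebra n A" "of_mat T' = T"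
  shows "generated_algebra n A T' = to_mat n ` polynomials"
proof -
  note Tc = matrix_algebra_carrier[OF T'(1)]
  have eq: "mat n n (\<lambda>ij. \<Sum>l\<le>k. (amplification n (b l) * mat_power n T' l) $$ ij)
      = to_mat n (\<Sum>l\<le>k. scalar (b l) * (P * T ^ l))" for k b
  proof (rule eq_matI)
    fix i j assume "i < dim_row (to_mat n (\<Sum>l\<le>k. scalar (b l) * (P * T ^ l)))"
      "j < dim_col (to_mat n (\<Sum>l\<le>k. scalar (b l) * (P * T ^ l)))"
    then have ij: "i < n" "j < n" by (simp_all add: to_mat_def)
    have "(amplification n (b l) * mat_power n T' l) $$ (i, j) = ent (scalar (b l) * (P * T ^ l)) i j" for l
    proof -
      let ?X = "amplification n (b l) * mat_power n T' l"
      have X: "?X \<in> carrier_mat n n"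
        by (rule mult_carrier_mat[OF amplification_carrier mat_power_carrier(1)[OF Tc]])
      have "of_mat ?X = scalar (b l) * (P * (P * T ^ l))"
        using of_mat_mult[OF amplification_carrier mat_power_carrier(1)[OF Tc]]
          mat_power_carrier(2)[OF Tc, of l] by (simp add: of_mat_amplification T'(2) mult.assoc)
      also have "P * (P * T ^ l) = P * T ^ l" by (simp flip: mult.assoc)
      finally show ?thesis using ent_of_mat[OF X, of i j] ij by simp
    qed
    then show "mat n n (\<lambda>ij. \<Sum>l\<le>k. (amplification n (b l) * mat_power n T' l) $$ ij) $$ (i, j)
        = to_mat n (\<Sum>l\<le>k. scalar (b l) * (P * T ^ l)) $$ (i, j)"
      using ij by (simp add: to_mat_def)
  qed (simp_all add: to_mat_def)
  show ?thesis unfolding generated_algebra_def polynomials_def eq by blast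
qed

theorem theorem3p10:
  fixes n :: nat
    and A :: "'a::complex_hilbert bop set"
    and T :: "'a bop mat"
  assumes "n > 0"
    and "abelian_von_neumann_algebra A"
    and "T \<in> matrix_algebra n A"
  shows "(strongly_irreducible_in (matrix_algebra n A) T \<longleftrightarrow>
      (\<exists>U t. unitary_in n A U \<and> t = mat_adj U * T * U \<and>
         upper_triangular t \<and>
         (\<forall>j<n - 1. t $$ (j, j) = t $$ (n - 1, n - 1)) \<and>
         (\<forall>j<n - 1. is_range_projection A (t $$ (j, Suc j)) 1)))
    \<and> (strongly_irreducible_in (matrix_algebra n A) T \<longrightarrow>
      relative_commutant (matrix_algebra n A) T = mat_sot n closure_of generated_algebra n A T
      \<and> (\<forall>X \<in> relative_commutant (matrix_algebra n A) T.
           \<exists>k. mat_power n (X - center_valued_trace n X) k = 0\<^sub>m n n))"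
proof -
  interpret abelian_vna A by standard (rule assms(2))
  note n_pos = assms(1) and T_in = assms(3)
  define T' where "T' = of_mat T"
  have T'_in: "T' \<in> mats {..<n}" unfolding T'_def by (rule of_mat_in[OF T_in])
  have irr_iff: "strongly_irreducible_in (matrix_algebra n A) T \<longleftrightarrow> strongly_irreducible {..<n} T'"
    unfolding T'_def by (rule strongly_irreducible_in_iff[OF n_pos T_in])
  have "strongly_irreducible {..<n} T' \<longleftrightarrow> (\<exists>V a. triangular_form n T' V a)"
  proof
    assume "\<exists>V a. triangular_form n T' V a"
    then obtain V a where "triangular_form n T' V a" by blast
    then interpret triangularized A n T' V a using n_pos T'_in by unfold_locales
    show "strongly_irreducible {..<n} T'" by (rule is_strongly_irreducible)
  qed (rule strongly_irreducible_imp_triangular[OF T'_in n_pos])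
  then have iff: "strongly_irreducible_in (matrix_algebra n A) T \<longleftrightarrow>
      (\<exists>U t. unitary_in n A U \<and> t = mat_adj U * T * U \<and>
         upper_triangular t \<and>
         (\<forall>j<n - 1. t $$ (j, j) = t $$ (n - 1, n - 1)) \<and>
         (\<forall>j<n - 1. is_range_projection A (t $$ (j, Suc j)) 1))"
    unfolding triangular_form_iff[OF n_pos T_in] irr_iff T'_def .
  have "relative_commutant (matrix_algebra n A) T = mat_sot n closure_of generated_algebra n A T
      \<and> (\<forall>X \<in> relative_commutant (matrix_algebra n A) T.
           \<exists>k. mat_power n (X - center_valued_trace n X) k = 0\<^sub>m n n)"
    if irr: "strongly_irreducible_in (matrix_algebra n A) T"
  proof (intro conjI ballI)
    obtain V a where "triangular_form n T' V a"
      using strongly_irreducible_imp_triangular[OF T'_in n_pos] irr irr_iff by blast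
    then interpret triangularized A n T' V a using n_pos T'_in by unfold_locales
    have gen: "generated_algebra n A T = to_mat n ` polynomials"
      by (rule generated_algebra_eq[OF T_in]) (simp add: T'_def)
    show "relative_commutant (matrix_algebra n A) T = mat_sot n closure_of generated_algebra n A T"
    proof (intro equalityI subsetI)
      fix X assume "X \<in> mat_sot n closure_of generated_algebra n A T"
      then show "X \<in> relative_commutant (matrix_algebra n A) T"
      proof (rule closure_in_relative_commutant[OF T_in])
        show "generated_algebra n A T \<subseteq> relative_commutant (matrix_algebra n A) T"
          unfolding gen using polynomials_commute
          by (auto simp: relative_commutant_iff[OF T_in] to_mat_in of_mat_to_mat_mats T'_def[symmetric])
      qed
    next
      fix X assume "X \<in> relative_commutant (matrix_algebra n A) T"
      then have X: "X \<in> matrix_algebra n A" "of_mat X * T' = T' * of_mat X"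
        using relative_commutant_iff[OF T_in] by (simp_all add: T'_def)
      note Xc = matrix_algebra_carrier[OF X(1)]
      obtain c where c: "c \<in> A" "regular c" "scalar c * of_mat X \<in> polynomials"
        using commutant_regular_multiple[OF of_mat_in[OF X(1)] X(2)] by blast
      obtain D where D: "\<And>k. D k \<in> A" "\<And>x. (\<lambda>k. (D k * c) \<rhd> x) \<longlonglongrightarrow> x"
        using regular_approximate_inverse[OF c(1,2)] by blast
      define Y where "Y k = to_mat n (scalar (D k) * (scalar c * of_mat X))" for k
      have "limitin (mat_sot n) Y X sequentially"
      proof (rule limitin_mat_sot[OF _ Xc])
        show "Y k \<in> carrier_mat n n" for k by (simp add: Y_def)
        fix i j x assume ij: "i < n" "j < n"
        have "Y k $$ (i, j) = D k * c * X $$ (i, j)" for k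
          using ij ent_of_mat[OF Xc, of i j] by (simp add: Y_def to_mat_def mult.assoc)
        then show "(\<lambda>k. Y k $$ (i, j) \<rhd> x) \<longlonglongrightarrow> X $$ (i, j) \<rhd> x"
          using D(2)[of "X $$ (i, j) \<rhd> x"] by simp
      qed
      moreover have "Y k \<in> generated_algebra n A T" for k
        unfolding gen Y_def using polynomials_scalar[OF D(1) c(3)] by blast
      ultimately show "X \<in> mat_sot n closure_of generated_algebra n A T"
        unfolding in_closure_of limitin_def
        by (metis eventually_happens' sequentially_bot)
    qed
    fix X assume "X \<in> relative_commutant (matrix_algebra n A) T"
    then have X: "X \<in> matrix_algebra n A" "of_mat X * T' = T' * of_mat X"
      using relative_commutant_iff[OF T_in] by (simp_all add: T'_def)
    note Xc = matrix_algebra_carrier[OF X(1)]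
    define Z where "Z = X - center_valued_trace n X"
    have Zc: "Z \<in> carrier_mat n n" 
      unfolding Z_def by (rule minus_carrier_mat[OF center_valued_trace_carrier])
    have "of_mat Z = of_mat X - scalar (bop_scale (1 / of_nat n) (tr {..<n} (of_mat X))) * P"
      using of_mat_diff[OF Xc center_valued_trace_carrier] of_mat_center_valued_trace[OF Xc]
      by (simp add: Z_def)
    then have "of_mat Z ^ n = 0"
      using commutant_trace_nilpotent[OF of_mat_in[OF X(1)] X(2)] by simp
    then have "of_mat (mat_power n Z n) = of_mat (0\<^sub>m n n)"
      using mat_power_carrier(2)[OF Zc, of n] by (simp add: of_mat_zero)
    then have "mat_power n Z n = 0\<^sub>m n n"
      using of_mat_inject[OF mat_power_carrier(1)[OF Zc], of "0\<^sub>m n n"] by simp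
    then show "\<exists>k. mat_power n (X - center_valued_trace n X) k = 0\<^sub>m n n" unfolding Z_def by blast
  qed
  with iff show ?thesis by blast
qed


end
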